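(* Let $G$ be a bipartite graph with at least one edge, let $p\geq 3$, and let $n$ be sufficiently large (depending on $G$ and $p$). Let $\mathcal{M}=\mathcal{M}(G^{p+1})$, $q=q(\mathcal{M})$, $\mathcal{B}=\mathcal{B}(\mathcal{M})$, $k$ and $A$ be as defined in the context. (i) If $q=|A|$, then $$h'(n,p,q)+\mathrm{ex}(q-1,\mathcal{B}) \leq \mathrm{ex}(n,G^{p+1})\leq h(n,p,q)+ f(k-1,k-1).$$ Furthermore, both bounds are best possible, i.e. each of the two bounds is attained with equality (for all sufficiently large $n$) for some bipartite graph $G$ with $q=|A|$. (ii) If $q<|A|$, then $$\mathrm{ex}(n,G^{p+1})=h'(n,p,q)+\mathrm{ex}(q-1,\mathcal{B}).$$ Moreover, the extremal graphs for $G^{p+1}$ on $n$ vertices are exactly the graphs $Q+T_p(n-q+1)$ with $Q\in \mathrm{EX}(q-1,\mathcal{B})$.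
   Context: Graphs are finite and simple. For a family $\mathcal{H}$ of graphs, $\mathrm{ex}(n,\mathcal{H})$ is the maximum number of edges of an $n$-vertex graph containing no member of $\mathcal{H}$ as a (not necessarily induced) subgraph, and $\mathrm{EX}(n,\mathcal{H})$ is the set of $n$-vertex $\mathcal{H}$-free graphs with $\mathrm{ex}(n,\mathcal{H})$ edges (the extremal graphs); for a single graph $H$ write $\mathrm{ex}(n,H)$, $\mathrm{EX}(n,H)$. $\overline{K}_m$ is the edgeless graph on $m$ vertices; $G\cup H$ is the disjoint union; $G+H$ is the join (disjoint union plus all edges between). $T_p(n)$ is the balanced complete $p$-partite graph on $n$ vertices, with $t_p(n)$ edges. Edge blow-up: $G^{p+1}$ is obtained from $G$ by replacing each edge by a clique of order $p+1$ containing that edge, the new vertices of the different cliques being all distinct. For $G$ with $2\le\chi(G)\le p-1$ one has $\chi(G^{p+1})=p+1$. Decomposition family: $\mathcal{M}=\mathcal{M}(G^{p+1})$ is the family of graphs $M$, minimal under the subgraph relation, for which there is a constant $t$ with $G^{p+1}\subseteq (M\cup\overline{K}_{t})+ T_{p-1}((p-1)t)$. A covering of a graph is a set of vertices meeting all edges; an independent covering is a covering that is an independent set (so it exists only for bipartite graphs). For a bipartite graph $F$, $q(F)$ is the minimum size of an independent covering of $F$. $q=q(\mathcal{M})=\min\{q(F): F\in\mathcal{M}\text{ bipartite}\}$. $\mathcal{S}(\mathcal{M})$ is the family of all independent coverings of size $q$ of bipartite graphs in $\mathcal{M}$; for $S\in\mathcal S(\mathcal M)$, $H_S\in\mathcal{M}$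 denotes the bipartite graph of which $S$ is an independent covering. $k=\min\{d_{H_S}(x): x\in S,\ S\in\mathcal{S}(\mathcal{M})\}$. $\mathcal{B}=\mathcal{B}(\mathcal{M})$ is the set of all graphs (with isolated vertices disregarded) that are subgraphs of some $F\in\mathcal{M}$ induced by a covering of $F$ of size at most $q-1$; if no $F\in\mathcal{M}$ has a covering of size at most $q-1$, set $\mathcal{B}=\{K_q\}$. $A$ is the smaller color class of $G$: $V(G)=A\cup B$ is a partition into two independent sets, chosen so that $|A|$ is as small as possible. $h(n,p,s)$ is the number of edges of $K_{s-1}+T_p(n-s+1)$ and $h'(n,p,s)$ is the number of edges of $\overline{K}_{s-1}+T_p(n-s+1)$. $f(\nu,\Delta)$ is the maximum number of edges of a graph with matching number at most $\nu$ and maximum degree at most $\Delta$. *)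

theory Defs
  imports Main
begin

section \<open>Finite simple graphs\<close>

datatype 'a graph = Graph (verts: "'a set") (edges: "'a set set")

definition simple_graph :: "'a graph \<Rightarrow> bool" where
  "simple_graph G \<longleftrightarrow> finite (verts G) \<and> (\<forall>e\<in>edges G. e \<subseteq> verts G \<and> card e = 2)"

definition subgraph :: "'a graph \<Rightarrow> 'a graph \<Rightarrow> bool" where
  "subgraph H G \<longleftrightarrow> verts H \<subseteq> verts G \<and> edges H \<subseteq> edges G"

text \<open>\<open>embeds H G\<close>: \<open>G\<close> contains a (not necessarily induced) copy of \<open>H\<close>.\<close>

definition embeds :: "'a graph \<Rightarrow> 'b graph \<Rightarrow> bool" where
  "embeds H G \<longleftrightarrow> (\<exists>\<phi>. inj_on \<phi> (verts H) \<and> \<phi> ` verts H \<subseteq> verts G \<and>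
      (\<forall>e\<in>edges H. \<phi> ` e \<in> edges G))"

definition graph_iso :: "'a graph \<Rightarrow> 'b graph \<Rightarrow> bool" where
  "graph_iso G H \<longleftrightarrow> (\<exists>\<phi>. bij_betw \<phi> (verts G) (verts H) \<and> edges H = (\<lambda>e. \<phi> ` e) ` edges G)"

definition induced_subgraph :: "'a graph \<Rightarrow> 'a set \<Rightarrow> 'a graph" where
  "induced_subgraph G U = Graph U {e \<in> edges G. e \<subseteq> U}"

definition remove_isolated :: "'a graph \<Rightarrow> 'a graph" where
  "remove_isolated G = Graph (\<Union> (edges G)) (edges G)"

definition degree :: "'a graph \<Rightarrow> 'a \<Rightarrow> nat" where
  "degree G x = card {e \<in> edges G. x \<in> e}"

definition matching :: "'a graph \<Rightarrow> 'a set set \<Rightarrow> bool" where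
  "matching G W \<longleftrightarrow> W \<subseteq> edges G \<and> pairwise disjnt W"

definition matching_number :: "'a graph \<Rightarrow> nat" where
  "matching_number G = Max {card W | W. matching G W}"

definition independent :: "'a graph \<Rightarrow> 'a set \<Rightarrow> bool" where
  "independent G U \<longleftrightarrow> U \<subseteq> verts G \<and> (\<forall>e\<in>edges G. \<not> e \<subseteq> U)"

definition covering :: "'a graph \<Rightarrow> 'a set \<Rightarrow> bool" where
  "covering G U \<longleftrightarrow> U \<subseteq> verts G \<and> (\<forall>e\<in>edges G. e \<inter> U \<noteq> {})"

definition independent_covering :: "'a graph \<Rightarrow> 'a set \<Rightarrow> bool" where
  "independent_covering G U \<longleftrightarrow> independent G U \<and> covering G U"

definition bipartition :: "'a graph \<Rightarrow> 'a set \<Rightarrow> 'a set \<Rightarrow> bool" where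
  "bipartition G A B \<longleftrightarrow> A \<union> B = verts G \<and> A \<inter> B = {} \<and> independent G A \<and> independent G B"

definition bipartite :: "'a graph \<Rightarrow> bool" where
  "bipartite G \<longleftrightarrow> (\<exists>A B. bipartition G A B)"

definition smaller_color_class :: "'a graph \<Rightarrow> 'a set \<Rightarrow> bool" where
  "smaller_color_class G A \<longleftrightarrow>
     (\<exists>B. bipartition G A B) \<and> (\<forall>A' B'. bipartition G A' B' \<longrightarrow> card A \<le> card A')"


section \<open>Constructions\<close>

definition complete_graph :: "nat \<Rightarrow> nat graph" where
  "complete_graph m = Graph {..<m} {e. e \<subseteq> {..<m} \<and> card e = 2}"

definition edgeless_graph :: "nat \<Rightarrow> nat graph" where
  "edgeless_graph m = Graph {..<m} {}"

definition disjoint_union :: "'a graph \<Rightarrow> 'b graph \<Rightarrow> ('a + 'b) graph" where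
  "disjoint_union G H =
     Graph (verts G <+> verts H) ((\<lambda>e. Inl ` e) ` edges G \<union> (\<lambda>e. Inr ` e) ` edges H)"

definition join :: "'a graph \<Rightarrow> 'b graph \<Rightarrow> ('a + 'b) graph" where
  "join G H =
     Graph (verts G <+> verts H)
       (edges (disjoint_union G H) \<union> {{Inl x, Inr y} | x y. x \<in> verts G \<and> y \<in> verts H})"

text \<open>The \<open>p\<close> parts of the balanced complete \<open>p\<close>-partite graph (\<open>p \<ge> 1\<close>) are the residue
  classes modulo \<open>p\<close> in \<open>{..<n}\<close>, whose sizes differ by at most one.\<close>

definition turan_graph :: "nat \<Rightarrow> nat \<Rightarrow> nat graph" where
  "turan_graph p n =
     Graph {..<n} {{i, j} | i j. i < n \<and> j < n \<and> i mod p \<noteq> j mod p}"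

text \<open>\<open>edge_blowup G r\<close> is \<open>G\<^sup>r\<close> for \<open>r \<ge> 2\<close>: the clique replacing the edge \<open>e\<close> consists of the
  two ends of \<open>e\<close> and of the \<open>r - 2\<close> new vertices \<open>Inr (e, i)\<close>.\<close>

definition blowup_clique :: "nat \<Rightarrow> 'a set \<Rightarrow> ('a + 'a set \<times> nat) set" where
  "blowup_clique r e = Inl ` e \<union> Inr ` ({e} \<times> {..<r - 2})"

definition edge_blowup :: "'a graph \<Rightarrow> nat \<Rightarrow> ('a + 'a set \<times> nat) graph" where
  "edge_blowup G r =
     Graph (Inl ` verts G \<union> (\<Union>e\<in>edges G. blowup_clique r e))
       (\<Union>e\<in>edges G. {d. d \<subseteq> blowup_clique r e \<and> card d = 2})"


section \<open>Extremal numbers\<close>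

text \<open>Host graphs range over all finite simple graphs with vertices in \<open>nat\<close>, which represent all
  isomorphism types; hence \<open>extremal_graphs n \<H>\<close> is closed under isomorphism within \<open>nat graph\<close>.\<close>

definition free_graphs :: "nat \<Rightarrow> 'a graph set \<Rightarrow> nat graph set" where
  "free_graphs n \<H> =
     {L. simple_graph L \<and> card (verts L) = n \<and> (\<forall>H\<in>\<H>. \<not> embeds H L)}"

definition ex_num :: "nat \<Rightarrow> 'a graph set \<Rightarrow> nat" where
  "ex_num n \<H> = Max {card (edges L) | L. L \<in> free_graphs n \<H>}"

definition extremal_graphs :: "nat \<Rightarrow> 'a graph set \<Rightarrow> nat graph set" where
  "extremal_graphs n \<H> = {L \<in> free_graphs n \<H>. card (edges L) = ex_num n \<H>}"

text \<open>For \<open>1 \<le> s \<le> n\<close>, the truncated subtractions below are the integer ones.\<close>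

definition h_edges :: "nat \<Rightarrow> nat \<Rightarrow> nat \<Rightarrow> nat" where
  "h_edges n p s = card (edges (join (complete_graph (s - 1)) (turan_graph p (n - s + 1))))"

definition h'_edges :: "nat \<Rightarrow> nat \<Rightarrow> nat \<Rightarrow> nat" where
  "h'_edges n p s = card (edges (join (edgeless_graph (s - 1)) (turan_graph p (n - s + 1))))"

text \<open>The set below is finite: at most \<open>2\<nu>\<close> vertices, each of degree at most \<open>\<Delta>\<close>, meet all edges.\<close>

definition f_edges :: "nat \<Rightarrow> nat \<Rightarrow> nat" where
  "f_edges \<nu> \<Delta> = Max {card (edges L) | L :: nat graph.
     simple_graph L \<and> matching_number L \<le> \<nu> \<and> (\<forall>x\<in>verts L. degree L x \<le> \<Delta>)}"


section \<open>Decomposition families and their parameters\<close>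

definition decomposes :: "nat \<Rightarrow> 'a graph \<Rightarrow> 'b graph \<Rightarrow> bool" where
  "decomposes p H M \<longleftrightarrow>
     (\<exists>t. embeds H (join (disjoint_union M (edgeless_graph t)) (turan_graph (p - 1) ((p - 1) * t))))"

text \<open>For \<open>H\<close> of chromatic number \<open>p + 1\<close>. The members are labelled graphs; the family contains every
  copy of each of them with vertices in \<open>nat\<close>.\<close>

definition decomposition_family :: "nat \<Rightarrow> 'a graph \<Rightarrow> nat graph set" where
  "decomposition_family p H =
     {M. simple_graph M \<and> decomposes p H M \<and>
         (\<forall>M'. simple_graph M' \<and> subgraph M' M \<and> decomposes p H M' \<longrightarrow> M' = M)}"

definition q_graph :: "'a graph \<Rightarrow> nat" where
  "q_graph F = (LEAST m. \<exists>U. independent_covering F U \<and> card U = m)"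

definition q_family :: "'a graph set \<Rightarrow> nat" where
  "q_family \<M> = (LEAST m. \<exists>F\<in>\<M>. bipartite F \<and> q_graph F = m)"

text \<open>The elements of \<open>\<S>(\<M>)\<close>, each paired with the graph \<open>H\<^sub>S\<close> that it covers.\<close>

definition S_family :: "'a graph set \<Rightarrow> ('a graph \<times> 'a set) set" where
  "S_family \<M> =
     {(F, S). F \<in> \<M> \<and> bipartite F \<and> independent_covering F S \<and> card S = q_family \<M>}"

definition k_family :: "'a graph set \<Rightarrow> nat" where
  "k_family \<M> = (LEAST d. \<exists>(F, S)\<in>S_family \<M>. \<exists>x\<in>S. degree F x = d)"

definition B_family :: "nat graph set \<Rightarrow> nat graph set" where
  "B_family \<M> =
     (let q = q_family \<M>;
          \<C> = {(F, U). F \<in> \<M> \<and> covering F U \<and> card U \<le> q - 1}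
      in if \<C> = {} then {complete_graph q}
         else {remove_isolated (induced_subgraph F U) | F U. (F, U) \<in> \<C>})"

end

theory Submission
  imports Defs
begin

text \<open>
  For an independent set \<open>S\<^sub>0\<close> of \<open>G\<close>, splitting all vertices outside \<open>S\<^sub>0\<close> turns \<open>G\<close> into the disjoint
  union of the stars at \<open>S\<^sub>0\<close> and of one edge for every edge of \<open>G\<close> that misses \<open>S\<^sub>0\<close>. Hence \<open>q\<close> is the
  minimum of \<open>|S\<^sub>0|\<close> plus the number of edges missing \<open>S\<^sub>0\<close>. If a minimiser leaves an edge uncovered,
  which is always so for \<open>q < |A|\<close>, then \<open>q - 1\<close> vertices joined to a large complete \<open>p\<close>-partite
  graph, together with one edge inside a part, already contain \<open>G\<^bsup>p+1\<^esup>\<close>; otherwise a vertex of degree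
  at most \<open>k\<close> in the minimiser bounds the edges inside the parts by a Chen-Gould-Pfender-Wei argument.

  The structure needed for this comes from Simonovits' progressive induction. By a minimum degree
  version of the Erdos-Stone theorem an extremal graph contains a large balanced complete
  \<open>p\<close>-partite graph; take as many vertices as possible, at most \<open>q - 1\<close>, completely joined to a large
  complete \<open>p\<close>-partite subgraph of it. If there are fewer than \<open>q - 1\<close> of them, or if some other vertex
  does not fit into one of the \<open>p\<close> classes, then deleting boundedly many vertices destroys fewer edges
  than \<open>h'(\<cdot>,p,q)\<close> loses, so \<open>ex(n) - h'(n,p,q)\<close> increases when \<open>n\<close> decreases. This cannot be repeated
  down to bounded \<open>n\<close>, hence for large \<open>n\<close> every extremal graph has the desired structure.
\<close>

section \<open>Finite simple graphs\<close>

text \<open>All embeddings place cliques on p + 1 vertices over p colour classes that are nearly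
  complete to each other. Such a clique needs something beyond one vertex per class: either an apex
  joined to everything or an edge inside a class. The \<open>cost\<close> of an independent set of
  \<open>G\<close> counts the apices and edges that are needed in this way, and the parameters
  \<open>q\<close> and \<open>k\<close> are translated into statements about \<open>G\<close> in
  both directions: independent sets give members of the family with coverings, and coverings of
  members give back independent sets. One use of p \<ge> 3 is that an edge inside one class leaves
  two further classes for the two sides of \<open>G\<close>; another is that the class with the
  smallest share of a matching has at most half of what the other classes have together. The main
  obstacle is that the exceptional vertices have to be recognised with bounds independent of n. This
  forces a fixed hierarchy of core sizes, \<open>part_size\<close>, in which each level exceeds the
  next by a factor depending only on \<open>G\<close> and p, and the deficits at one level are
  measured in units of the next.\<close>

definition neighbours :: "'a graph \<Rightarrow> 'a \<Rightarrow> 'a set" where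
  "neighbours L x = {y. {x, y} \<in> edges L}"

definition edges_within :: "'a graph \<Rightarrow> 'a set \<Rightarrow> nat" where
  "edges_within L S = card {e \<in> edges L. e \<subseteq> S}"

lemma simple_graphD:
  assumes "simple_graph L"
  shows "finite (verts L)" "e \<in> edges L \<Longrightarrow> e \<subseteq> verts L" "e \<in> edges L \<Longrightarrow> card e = 2"
    "e \<in> edges L \<Longrightarrow> finite e"
  using assms finite_subset by (auto simp: simple_graph_def)

lemma simple_graph_edgeE:
  assumes "simple_graph L" "e \<in> edges L"
  obtains x y where "e = {x, y}" "x \<noteq> y" "x \<in> verts L" "y \<in> verts L"
  using assms by (auto simp: simple_graph_def card_2_iff)

lemma finite_edges: "simple_graph L \<Longrightarrow> finite (edges L)"
  by (rule finite_subset[of _ "Pow (verts L)"]) (auto simp: simple_graph_def)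

lemma simple_graph_adj:
  assumes "simple_graph L" "{x, y} \<in> edges L"
  shows "x \<noteq> y" "x \<in> verts L" "y \<in> verts L"
proof -
  have "{x, y} \<subseteq> verts L" "card {x, y} = 2" using simple_graphD[OF assms(1)] assms(2) by blast+
  then show "x \<noteq> y" "x \<in> verts L" "y \<in> verts L" by auto
qed

lemma neighbours_subset: "simple_graph L \<Longrightarrow> neighbours L x \<subseteq> verts L - {x}"
  using simple_graph_adj[of L x] by (auto simp: neighbours_def)

lemma finite_neighbours: "simple_graph L \<Longrightarrow> finite (neighbours L x)"
  using finite_subset[OF neighbours_subset, of L x] simple_graphD(1)[of L] by simp

text \<open>A pair between the two sides is counted from its end in \<open>R\<close>, so later edge
  counts become sums of degrees into \<open>S\<close> that can be bounded vertex by vertex.\<close>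

lemma edges_within_Un:
  assumes L: "simple_graph L" and fin: "finite S" "finite R" and dis: "S \<inter> R = {}"
  shows "edges_within L (S \<union> R) =
    edges_within L S + edges_within L R + (\<Sum>x\<in>R. card (neighbours L x \<inter> S))"
proof -
  let ?P = "SIGMA x:R. neighbours L x \<inter> S"
  let ?f = "\<lambda>(x, y). {x, y}"
  have eq: "{e \<in> edges L. e \<subseteq> S \<union> R} =
      ({e \<in> edges L. e \<subseteq> S} \<union> {e \<in> edges L. e \<subseteq> R}) \<union> ?f ` ?P" (is "?A = (?B \<union> ?C) \<union> ?D")
  proof
    show "?A \<subseteq> (?B \<union> ?C) \<union> ?D"
    proof
      fix e assume e: "e \<in> ?A"
      then obtain x y where xy: "e = {x, y}" using simple_graph_edgeE[OF L] by blast
      show "e \<in> (?B \<union> ?C) \<union> ?D"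
      proof (cases "(x \<in> S \<and> y \<in> S) \<or> (x \<in> R \<and> y \<in> R)")
        case True then show ?thesis using e xy by auto
      next
        case False
        then have "(x \<in> R \<and> y \<in> S) \<or> (y \<in> R \<and> x \<in> S)" using e xy by auto
        then have "(x, y) \<in> ?P \<or> (y, x) \<in> ?P"
          using e xy by (auto simp: neighbours_def insert_commute)
        then have "?f (x, y) \<in> ?D \<or> ?f (y, x) \<in> ?D" by (meson imageI)
        moreover have "?f (y, x) = e" "?f (x, y) = e" using xy by auto
        ultimately show ?thesis by (simp only: disj_absorb UnI2)
      qed
    qed
    show "(?B \<union> ?C) \<union> ?D \<subseteq> ?A" by (auto simp: neighbours_def)
  qed
  have "inj_on ?f ?P" using dis by (auto simp: inj_on_def doubleton_eq_iff)
  then have D: "card ?D = (\<Sum>x\<in>R. card (neighbours L x \<inter> S))"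
    using fin by (simp add: card_image)
  \<comment> \<open>The only set inside both disjoint sides is the empty one, so it has to be
    excluded as an edge.\<close>
  have "{} \<notin> edges L" using simple_graphD(3)[OF L, of "{}"] by auto
  moreover have "e = {}" if "e \<subseteq> S" "e \<subseteq> R" for e using dis that by blast
  ultimately have BC: "?B \<inter> ?C = {}" by blast
  have nD: "\<not> d \<subseteq> S \<and> \<not> d \<subseteq> R" if d: "d \<in> ?D" for d
  proof -
    obtain x y where "d = {x, y}" "x \<in> R" "y \<in> S" using d by auto
    then show ?thesis using dis by blast
  qed
  have BCD: "(?B \<union> ?C) \<inter> ?D = {}"
  proof (rule equals0I)
    fix d assume "d \<in> (?B \<union> ?C) \<inter> ?D"
    then have "d \<in> ?D" "d \<subseteq> S \<or> d \<subseteq> R" by auto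
    then show False using nD by metis
  qed
  have fD: "finite ?D" using fin by (intro finite_imageI finite_SigmaI) simp_all
  have fB: "finite ?B" and fC: "finite ?C" using finite_edges[OF L] by simp_all
  have "card ?A = card (?B \<union> ?C) + card ?D"
    unfolding eq by (rule card_Un_disjoint[OF finite_UnI[OF fB fC] fD BCD])
  also have "card (?B \<union> ?C) = card ?B + card ?C" by (rule card_Un_disjoint[OF fB fC BC])
  finally show ?thesis unfolding edges_within_def D .
qed

lemma edges_within_verts: "simple_graph L \<Longrightarrow> edges_within L (verts L) = card (edges L)"
  unfolding edges_within_def by (rule arg_cong[of _ _ card]) (auto dest: simple_graphD(2))

lemma simple_induced: "simple_graph L \<Longrightarrow> U \<subseteq> verts L \<Longrightarrow> simple_graph (induced_subgraph L U)"
  by (auto simp: simple_graph_def induced_subgraph_def finite_subset)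

lemma card_edges_induced: "card (edges (induced_subgraph L U)) = edges_within L U"
  by (simp add: induced_subgraph_def edges_within_def)

section \<open>Embeddings and extremal numbers\<close>

lemma embeds_trans:
  assumes "embeds F G" "embeds G H" and F: "\<And>e. e \<in> edges F \<Longrightarrow> e \<subseteq> verts F"
  shows "embeds F H"
proof -
  obtain f g where f: "inj_on f (verts F)" "f ` verts F \<subseteq> verts G" "\<forall>e\<in>edges F. f ` e \<in> edges G"
    and g: "inj_on g (verts G)" "g ` verts G \<subseteq> verts H" "\<forall>e\<in>edges G. g ` e \<in> edges H"
    using assms by (auto simp: embeds_def)
  show ?thesis unfolding embeds_def
  proof (intro exI[of _ "g \<circ> f"] conjI)
    show "inj_on (g \<circ> f) (verts F)"
      using f g by (meson comp_inj_on inj_on_subset)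
    show "(g \<circ> f) ` verts F \<subseteq> verts H" using f g by fastforce
    show "\<forall>e\<in>edges F. (g \<circ> f) ` e \<in> edges H" using f g unfolding image_comp[symmetric] by blast
  qed
qed

lemma embeds_induced: "embeds (induced_subgraph L U) L" if "U \<subseteq> verts L"
  using that unfolding embeds_def induced_subgraph_def by (intro exI[of _ id]) auto

lemma subgraph_embeds: "subgraph F G \<Longrightarrow> embeds F G"
  unfolding embeds_def subgraph_def by (intro exI[of _ id]) auto

lemma graph_iso_card:
  assumes "simple_graph G" "graph_iso G H"
  shows "card (verts H) = card (verts G)" "card (edges H) = card (edges G)"
proof -
  obtain f where f: "bij_betw f (verts G) (verts H)" "edges H = (\<lambda>e. f ` e) ` edges G"
    using assms by (auto simp: graph_iso_def)
  show "card (verts H) = card (verts G)" using f by (metis bij_betw_same_card)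
  have "inj_on ((`) f) (edges G)"
    using f simple_graphD(2)[OF assms(1)] unfolding bij_betw_def
    by (intro inj_onI) (metis inj_on_image_eq_iff)
  then show "card (edges H) = card (edges G)" using f by (simp add: card_image)
qed

lemma graph_iso_sym:
  assumes "simple_graph G" "graph_iso G H" shows "graph_iso H G"
proof -
  obtain f where f: "bij_betw f (verts G) (verts H)" "edges H = (\<lambda>e. f ` e) ` edges G"
    using assms by (auto simp: graph_iso_def)
  let ?g = "inv_into (verts G) f"
  have g: "bij_betw ?g (verts H) (verts G)" using f by (simp add: bij_betw_inv_into)
  have "?g ` f ` e = e" if "e \<in> edges G" for e
    using f simple_graphD(2)[OF assms(1) that] by (metis bij_betw_def inv_into_image_cancel)
  then have "edges G = (\<lambda>e. ?g ` e) ` edges H"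
    unfolding f(2) image_image by force
  then show ?thesis using g by (auto simp: graph_iso_def)
qed

lemma graph_iso_embeds: "graph_iso G H \<Longrightarrow> embeds G H"
  unfolding graph_iso_def embeds_def bij_betw_def by (metis imageI order_refl)

lemma graph_iso_simple:
  assumes "simple_graph G" "graph_iso G H" shows "simple_graph H"
proof -
  obtain f where f: "bij_betw f (verts G) (verts H)" "edges H = (\<lambda>e. f ` e) ` edges G"
    using assms by (auto simp: graph_iso_def)
  have "card (f ` e) = card e" if "e \<in> edges G" for e
    by (rule card_image[OF inj_on_subset[OF bij_betw_imp_inj_on[OF f(1)]
            simple_graphD(2)[OF assms(1) that]]])
  moreover have "f ` e \<subseteq> verts H" if "e \<in> edges G" for e
    using image_mono[OF simple_graphD(2)[OF assms(1) that], of f] bij_betw_imp_surj_on[OF f(1)]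
    by simp
  moreover have "finite (verts H)"
    using bij_betw_finite[OF f(1)] simple_graphD(1)[OF assms(1)] by simp
  ultimately show ?thesis using f assms(1) by (auto simp: simple_graph_def)
qed

lemma ex_nat_graph_iso:
  assumes "simple_graph G"
  obtains G' :: "nat graph" where "graph_iso G G'" "verts G' = {..<card (verts G)}"
proof -
  obtain f where f: "bij_betw f (verts G) {0..<card (verts G)}"
    using ex_bij_betw_finite_nat simple_graphD(1)[OF assms] by blast
  show thesis
    by (rule that[of "Graph {..<card (verts G)} ((\<lambda>e. f ` e) ` edges G)"])
      (use f in \<open>auto simp: graph_iso_def atLeast0LessThan\<close>)
qed

text \<open>A crude bound whose purpose is to make the set under the \<open>Max\<close> of
  \<open>ex_num\<close> finite.\<close>

lemma card_edges_le: "simple_graph L \<Longrightarrow> card (edges L) \<le> 2 ^ card (verts L)"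
  using card_mono[of "Pow (verts L)" "edges L"] by (auto simp: simple_graph_def card_Pow)

lemma finite_free_counts: "finite {card (edges L) | L. L \<in> free_graphs n \<H>}"
  by (rule finite_subset[of _ "{..2 ^ n}"]) (auto simp: free_graphs_def dest: card_edges_le)

lemma ex_num_ge: "L \<in> free_graphs n \<H> \<Longrightarrow> card (edges L) \<le> ex_num n \<H>"
  unfolding ex_num_def by (rule Max_ge[OF finite_free_counts]) auto

lemma ex_num_attained:
  assumes "free_graphs n \<H> \<noteq> {}" obtains L where "L \<in> extremal_graphs n \<H>"
proof -
  have "ex_num n \<H> \<in> {card (edges L) | L. L \<in> free_graphs n \<H>}"
    unfolding ex_num_def using assms by (intro Max_in[OF finite_free_counts]) auto
  then show thesis using that by (auto simp: extremal_graphs_def)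
qed

lemma iso_free_graphs:
  fixes L :: "'b graph" and H :: "'a graph" and L' :: "nat graph"
  assumes L: "simple_graph L" and free: "\<not> embeds H L" and H: "\<And>e. e \<in> edges H \<Longrightarrow> e \<subseteq> verts H"
    and iso: "graph_iso L L'"
  shows "L' \<in> free_graphs (card (verts L)) {H}"
  using graph_iso_card[OF L iso] graph_iso_simple[OF L iso] free
    embeds_trans[OF _ graph_iso_embeds[OF graph_iso_sym[OF L iso]] H]
  by (auto simp: free_graphs_def)

text \<open>\<open>ex_num\<close> ranges over hosts with vertices in \<open>nat\<close>, whereas
  joins live on sum types; passing to an isomorphic copy removes the difference.\<close>

lemma card_edges_le_ex_num:
  fixes L :: "'b graph" and H :: "'a graph"
  assumes L: "simple_graph L" and "\<not> embeds H L" and "\<And>e. e \<in> edges H \<Longrightarrow> e \<subseteq> verts H"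
  shows "card (edges L) \<le> ex_num (card (verts L)) {H}"
proof -
  obtain L' :: "nat graph" where "graph_iso L L'" using ex_nat_graph_iso[OF L] by blast
  then show ?thesis
    using ex_num_ge[OF iso_free_graphs[OF assms]] graph_iso_card[OF L] by metis
qed

lemma edge_blowup_edges_subset: "d \<in> edges (edge_blowup G r) \<Longrightarrow> d \<subseteq> verts (edge_blowup G r)"
  by (auto simp: edge_blowup_def)

lemma simple_edge_blowup:
  assumes "simple_graph G" shows "simple_graph (edge_blowup G r)"
proof -
  have "finite (blowup_clique r e)" if "e \<in> edges G" for e
    using simple_graphD(4)[OF assms that] by (simp add: blowup_clique_def)
  then show ?thesis
    using assms finite_edges[OF assms] edge_blowup_edges_subset[of _ G r]
    by (auto simp: simple_graph_def edge_blowup_def)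
qed

section \<open>Turan graphs\<close>

text \<open>Edge set of the complete multipartite graph whose parts are the colour classes of
  \<open>\<kappa>\<close> on \<open>R\<close>. Turan graphs and the colour classes of an extremal
  graph are both treated through it.\<close>

definition cross_pairs :: "('a \<Rightarrow> nat) \<Rightarrow> 'a set \<Rightarrow> 'a set set" where
  "cross_pairs \<kappa> R = {{x, y} | x y. x \<in> R \<and> y \<in> R \<and> \<kappa> x \<noteq> \<kappa> y}"

text \<open>This is t_p(n), summed in the order in which vertices are inserted: vertex
  \<open>i\<close> misses the \<open>i div p\<close> earlier vertices of its own residue
  class.\<close>

definition turan_number :: "nat \<Rightarrow> nat \<Rightarrow> nat" where
  "turan_number p n = (\<Sum>i<n. i - i div p)"

lemma turan_number_Suc: "turan_number p (Suc m) = turan_number p m + (m - m div p)"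
  by (simp add: turan_number_def del: Nat.add_diff_assoc)

lemma finite_cross_pairs: "finite R \<Longrightarrow> finite (cross_pairs \<kappa> R)"
  by (rule finite_subset[of _ "Pow R"]) (auto simp: cross_pairs_def)

lemma card_cross_pairs_insert:
  assumes "finite R" "v \<notin> R"
  shows "card (cross_pairs \<kappa> (insert v R)) = card (cross_pairs \<kappa> R) + card {x \<in> R. \<kappa> x \<noteq> \<kappa> v}"
proof -
  have "cross_pairs \<kappa> (insert v R) = cross_pairs \<kappa> R \<union> (\<lambda>x. {v, x}) ` {x \<in> R. \<kappa> x \<noteq> \<kappa> v}"
    by (fastforce simp: cross_pairs_def insert_commute)
  moreover have "cross_pairs \<kappa> R \<inter> (\<lambda>x. {v, x}) ` {x \<in> R. \<kappa> x \<noteq> \<kappa> v} = {}"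
    using assms by (auto simp: cross_pairs_def doubleton_eq_iff)
  moreover have "inj_on (\<lambda>x. {v, x}) {x \<in> R. \<kappa> x \<noteq> \<kappa> v}"
    by (auto simp: inj_on_def doubleton_eq_iff)
  ultimately show ?thesis
    using assms by (simp add: card_Un_disjoint finite_cross_pairs card_image)
qed

lemma card_residue:
  assumes "p \<ge> 1" shows "card {x. x < n \<and> x mod p = n mod p} = n div p"
proof -
  have "{x. x < n \<and> x mod p = n mod p} = (\<lambda>j. p * j + n mod p) ` {..<n div p}"
  proof
    show "{x. x < n \<and> x mod p = n mod p} \<subseteq> (\<lambda>j. p * j + n mod p) ` {..<n div p}"
    proof
      fix x assume x: "x \<in> {x. x < n \<and> x mod p = n mod p}"
      then have *: "x = p * (x div p) + n mod p" by (metis (mono_tags) mem_Collect_eq mult_div_mod_eq)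
      moreover have "x div p < n div p"
      proof (rule ccontr)
        assume "\<not> x div p < n div p"
        then have "p * (x div p) \<ge> p * (n div p)" by simp
        then show False using * x by (metis (mono_tags) add_le_mono1 leD mem_Collect_eq mult_div_mod_eq)
      qed
      ultimately show "x \<in> (\<lambda>j. p * j + n mod p) ` {..<n div p}" by blast
    qed
    show "(\<lambda>j. p * j + n mod p) ` {..<n div p} \<subseteq> {x. x < n \<and> x mod p = n mod p}"
    proof
      fix x assume "x \<in> (\<lambda>j. p * j + n mod p) ` {..<n div p}"
      then obtain j where j: "j < n div p" "x = p * j + n mod p" by blast
      have "p * j < p * (n div p)" using j assms by simp
      then have "x < p * (n div p) + n mod p" using j by linarith
      then show "x \<in> {x. x < n \<and> x mod p = n mod p}" using j by simp
    qed
  qed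
  moreover have "inj_on (\<lambda>j. p * j + n mod p) {..<n div p}" using assms by (auto simp: inj_on_def)
  ultimately show ?thesis by (simp add: card_image)
qed

lemma turan_graph_edges: "edges (turan_graph p n) = cross_pairs (\<lambda>i. i mod p) {..<n}"
  by (auto simp: turan_graph_def cross_pairs_def)

lemma card_turan_graph:
  assumes "p \<ge> 1" shows "card (edges (turan_graph p n)) = turan_number p n"
  unfolding turan_graph_edges
proof (induction n)
  case 0 then show ?case by (simp add: turan_number_def cross_pairs_def)
next
  case (Suc n)
  have eq: "{x \<in> {..<n}. x mod p \<noteq> n mod p} = {..<n} - {x. x < n \<and> x mod p = n mod p}" by auto
  have "card {x \<in> {..<n}. x mod p \<noteq> n mod p} = n - n div p"
    unfolding eq using card_residue[OF assms] by (subst card_Diff_subset) auto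
  then show ?case
    using Suc card_cross_pairs_insert[of "{..<n}" n "\<lambda>i. i mod p"]
    by (simp add: lessThan_Suc turan_number_def)
qed

text \<open>Enlarging each of the p parts by \<open>N\<close> adds a copy of T_p(pN) and gives each
  of the \<open>m\<close> old vertices (p - 1)N new neighbours.\<close>

lemma turan_number_add:
  assumes "p \<ge> 1"
  shows "turan_number p (m + p * N) = turan_number p m + turan_number p (p * N) + (p - 1) * N * m"
proof (induction m)
  case 0 then show ?case by (simp add: turan_number_def)
next
  case (Suc m)
  have "m div p \<le> m" by simp
  then have "(m + p * N) - (m + p * N) div p = (m - m div p) + (p - 1) * N"
    using assms by (simp add: diff_mult_distrib)
  then have "m + p * N - (m + p * N) div p = (m - m div p) + (p - 1) * N" .
  then show ?case using Suc
    by (simp only: add_Suc turan_number_Suc mult_Suc_right)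
qed

text \<open>Turan's bound for p-partite graphs, by deleting a vertex of a class of at least average
  size. That class has more than \<open>m div p\<close> of the \<open>Suc m\<close> vertices, so the
  deleted vertex accounts for at most \<open>m - m div p\<close> pairs, the increment of
  \<open>turan_number\<close>.\<close>

lemma card_cross_pairs_le:
  assumes "p \<ge> 1" "finite R" "\<kappa> ` R \<subseteq> {..<p}"
  shows "card (cross_pairs \<kappa> R) \<le> turan_number p (card R)"
  using assms(2,3)
proof (induction "card R" arbitrary: R)
  case 0 then show ?case by (simp add: cross_pairs_def)
next
  case (Suc m)
  let ?a = "\<lambda>i. card {x \<in> R. \<kappa> x = i}"
  have "\<exists>i<p. Suc m \<le> p * ?a i"
  proof (rule ccontr)
    assume *: "\<not> (\<exists>i<p. Suc m \<le> p * ?a i)"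
    have "(\<Union>i<p. {x \<in> R. \<kappa> x = i}) = R" using Suc by auto
    moreover have "card (\<Union>i<p. {x \<in> R. \<kappa> x = i}) = (\<Sum>i<p. ?a i)"
      using Suc by (subst card_UN_disjoint) auto
    ultimately have "card R = (\<Sum>i<p. ?a i)" by simp
    then have "p * card R = (\<Sum>i<p. p * ?a i)" by (simp add: sum_distrib_left)
    also have "\<dots> < (\<Sum>i<p. Suc m)"
    proof (rule sum_strict_mono)
      show "{..<p} \<noteq> {}" using assms(1) by (simp add: lessThan_empty_iff)
    qed (use * in \<open>auto simp: not_le\<close>)
    finally show False using Suc by simp
  qed
  then obtain i where i: "i < p" "Suc m \<le> p * ?a i" by blast
  have large: "m div p < ?a i"
    using i assms(1) by (simp add: less_mult_imp_div_less mult.commute)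
  then have "{x \<in> R. \<kappa> x = i} \<noteq> {}" by force
  then obtain v where v: "v \<in> R" "\<kappa> v = i" by auto
  let ?R = "R - {v}"
  have cR: "card ?R = m" using Suc v by simp
  have "{x \<in> ?R. \<kappa> x \<noteq> \<kappa> v} = R - {x \<in> R. \<kappa> x = i}" using v by auto
  then have "card {x \<in> ?R. \<kappa> x \<noteq> \<kappa> v} = Suc m - ?a i"
    using Suc by (simp add: card_Diff_subset)
  also have "\<dots> \<le> m - m div p" using large by linarith
  finally have le: "card {x \<in> ?R. \<kappa> x \<noteq> \<kappa> v} \<le> m - m div p" .
  have "card (cross_pairs \<kappa> ?R) \<le> turan_number p m"
    using Suc(1)[of ?R] cR Suc(3,4) by auto
  moreover have "insert v ?R = R" using v by blast
  ultimately show ?case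
    using card_cross_pairs_insert[of ?R v \<kappa>, OF finite_Diff[OF Suc(3)]] le turan_number_Suc[of p m]
    unfolding Suc(2)[symmetric] by (simp del: Nat.add_diff_assoc)
qed

lemma card_cross_pairs_remove:
  assumes "finite R" "v \<in> R"
  shows "card (cross_pairs \<kappa> R) =
    card (cross_pairs \<kappa> (R - {v})) + (card R - card {x \<in> R. \<kappa> x = \<kappa> v})"
proof -
  have "insert v (R - {v}) = R" using assms by blast
  then have "card (cross_pairs \<kappa> R) =
      card (cross_pairs \<kappa> (R - {v})) + card {x \<in> R - {v}. \<kappa> x \<noteq> \<kappa> v}"
    using card_cross_pairs_insert[of "R - {v}" v \<kappa>] assms by simp
  moreover have "{x \<in> R - {v}. \<kappa> x \<noteq> \<kappa> v} = R - {x \<in> R. \<kappa> x = \<kappa> v}" by blast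
  ultimately show ?thesis using assms by (simp add: card_Diff_subset)
qed

text \<open>Recolouring one vertex from a class that is larger by two or more into the smaller class
  would push the number of pairs beyond Turan's bound.\<close>

lemma cross_pairs_maximum_balanced:
  assumes p: "p \<ge> 1" and R: "finite R" "\<kappa> ` R \<subseteq> {..<p}"
    and max: "card (cross_pairs \<kappa> R) = turan_number p (card R)" and ij: "i < p" "j < p"
  shows "card {x \<in> R. \<kappa> x = i} \<le> Suc (card {x \<in> R. \<kappa> x = j})"
proof (rule ccontr)
  let ?a = "\<lambda>i. card {x \<in> R. \<kappa> x = i}"
  assume "\<not> ?a i \<le> Suc (?a j)"
  then have gt: "?a i \<ge> ?a j + 2" by simp
  then have "?a i \<noteq> 0" by linarith
  then have "{x \<in> R. \<kappa> x = i} \<noteq> {}" by (metis card.empty)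
  then obtain v where v: "v \<in> R" "\<kappa> v = i" by blast
  let ?\<kappa> = "\<kappa>(v := j)"
  have "i \<noteq> j" using gt by auto
  have eq1: "cross_pairs ?\<kappa> (R - {v}) = cross_pairs \<kappa> (R - {v})"
    by (auto simp: cross_pairs_def)
  have "{x \<in> R. ?\<kappa> x = j} = insert v {x \<in> R. \<kappa> x = j}" using v by auto
  then have eq2: "card {x \<in> R. ?\<kappa> x = ?\<kappa> v} = Suc (?a j)"
    using R v \<open>i \<noteq> j\<close> by simp
  have "?\<kappa> ` R \<subseteq> {..<p}" using R ij by auto
  then have "card (cross_pairs ?\<kappa> R) \<le> card (cross_pairs \<kappa> R)"
    using card_cross_pairs_le[OF p R(1), of ?\<kappa>] max by simp
  then have "card R - Suc (?a j) \<le> card R - ?a i"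
    using card_cross_pairs_remove[OF R(1) v(1), of \<kappa>] card_cross_pairs_remove[OF R(1) v(1), of ?\<kappa>]
      v eq1 eq2 by simp
  moreover have "?a i \<le> card R" using R by (intro card_mono) auto
  ultimately show False using gt by linarith
qed

lemma cross_pairs_maximum_turan:
  assumes p: "p \<ge> 1" and R: "finite R" "\<kappa> ` R \<subseteq> {..<p}"
    and max: "card (cross_pairs \<kappa> R) = turan_number p (card R)"
  obtains g where "bij_betw g R {..<card R}"
    "\<And>x y. x \<in> R \<Longrightarrow> y \<in> R \<Longrightarrow> g x mod p = g y mod p \<longleftrightarrow> \<kappa> x = \<kappa> y"
proof -
  let ?V = "\<lambda>i. {x \<in> R. \<kappa> x = i}"
  let ?a = "\<lambda>i. card (?V i)"
  define d where "d = Min (?a ` {..<p})"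
  have ne: "?a ` {..<p} \<noteq> {}" using p by (simp add: lessThan_empty_iff)
  have "d \<in> ?a ` {..<p}" unfolding d_def using ne by (intro Min_in) auto
  then obtain i0 where i0: "i0 < p" "?a i0 = d" by auto
  have dle: "d \<le> ?a i" if "i < p" for i unfolding d_def using that by (intro Min_le) auto
  have led: "?a i \<le> Suc d" if "i < p" for i
    using cross_pairs_maximum_balanced[OF p R max that i0(1)] i0 by simp
  \<comment> \<open>The classes with one extra vertex have to receive the residues below
    \<open>card S\<close>, because these are the larger residue classes of
    \<open>{..<card R}\<close>.\<close>
  define S where "S = {i. i < p \<and> ?a i = Suc d}"
  have S: "S \<subseteq> {..<p} - {i0}" using i0 by (auto simp: S_def)
  have finS: "finite S" using S finite_subset by blast
  have cS: "card S < p"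
    using card_mono[OF _ S] i0(1) by simp
  have a_eq: "?a i = d + (if i \<in> S then 1 else 0)" if "i < p" for i
    using dle[OF that] led[OF that] that by (auto simp: S_def)
  have "(\<Union>i<p. ?V i) = R" using R by auto
  moreover have "card (\<Union>i<p. ?V i) = (\<Sum>i<p. ?a i)"
    using R by (subst card_UN_disjoint) auto
  ultimately have "card R = (\<Sum>i<p. d + (if i \<in> S then 1 else 0))" using a_eq by simp
  also have "\<dots> = p * d + card S"
  proof -
    have "{..<p} \<inter> S = S" using S by blast
    then show ?thesis by (simp add: sum.distrib sum.If_cases)
  qed
  finally have cR: "card R = p * d + card S" .
  have "card ({..<p} - S) = card {card S..<p}"
    using S finS by (subst card_Diff_subset) auto
  then obtain \<pi>2 where \<pi>2: "bij_betw \<pi>2 ({..<p} - S) {card S..<p}"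
    using finite_same_card_bij[of "{..<p} - S" "{card S..<p}"] by auto
  obtain \<pi>1 where \<pi>1: "bij_betw \<pi>1 S {..<card S}"
    using finite_same_card_bij[of S "{..<card S}"] finS by auto
  define \<pi> where "\<pi> i = (if i \<in> S then \<pi>1 i else \<pi>2 i)" for i
  have \<pi>S: "\<pi> i < card S" if "i \<in> S" for i using \<pi>1 that by (auto simp: \<pi>_def bij_betw_def)
  have \<pi>N: "card S \<le> \<pi> i \<and> \<pi> i < p" if "i < p" "i \<notin> S" for i
    using \<pi>2 that by (auto simp: \<pi>_def bij_betw_def)
  have \<pi>_lt: "\<pi> i < p" if "i < p" for i using \<pi>S \<pi>N cS that by (meson less_trans)
  have \<pi>_inj: "i = j" if "\<pi> i = \<pi> j" "i < p" "j < p" for i j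
  proof (cases "i \<in> S")
    case True
    then have "j \<in> S" using \<pi>S[of i] \<pi>N[of j] that by force
    then show ?thesis using \<pi>1 True that by (auto simp: \<pi>_def bij_betw_def inj_on_def)
  next
    case False
    then have "j \<notin> S" using \<pi>S[of j] \<pi>N[of i] that by force
    then show ?thesis using \<pi>2 False that by (auto simp: \<pi>_def bij_betw_def inj_on_def)
  qed
  have "\<exists>h. bij_betw h (?V i) {..<?a i}" for i
    using finite_same_card_bij[of "?V i" "{..<?a i}"] R by auto
  then obtain h where h: "\<And>i. bij_betw (h i) (?V i) {..<?a i}" by metis
  \<comment> \<open>The position within the class becomes the quotient and the permuted colour the
    remainder modulo \<open>p\<close>.\<close>
  define g where "g x = p * h (\<kappa> x) x + \<pi> (\<kappa> x)" for x
  have gmod: "g x mod p = \<pi> (\<kappa> x)" if "x \<in> R" for x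
    using \<pi>_lt[of "\<kappa> x"] that R by (auto simp: g_def)
  have same: "g x mod p = g y mod p \<longleftrightarrow> \<kappa> x = \<kappa> y" if "x \<in> R" "y \<in> R" for x y
    using gmod[OF that(1)] gmod[OF that(2)] \<pi>_inj[of "\<kappa> x" "\<kappa> y"] that R by auto
  have inj: "inj_on g R"
  proof (rule inj_onI)
    fix x y assume xy: "x \<in> R" "y \<in> R" "g x = g y"
    then have \<kappa>: "\<kappa> x = \<kappa> y" using same[of x y] by simp
    then have "h (\<kappa> x) x = h (\<kappa> x) y" using xy p by (simp add: g_def)
    then show "x = y" using h[of "\<kappa> x"] xy \<kappa> by (auto simp: bij_betw_def inj_on_def)
  qed
  have "g x < card R" if x: "x \<in> R" for x
  proof -
    let ?i = "\<kappa> x"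
    have i: "?i < p" using x R by auto
    have hx: "h ?i x < ?a ?i" using h[of ?i] x by (auto simp: bij_betw_def)
    show ?thesis
    proof (cases "?i \<in> S")
      case True
      then have "h ?i x \<le> d" using hx a_eq[OF i] by simp
      then have "p * h ?i x \<le> p * d" by simp
      then show ?thesis using \<pi>S[OF True] unfolding cR g_def by linarith
    next
      case False
      then have "Suc (h ?i x) \<le> d" using hx a_eq[OF i] by simp
      then have "p * Suc (h ?i x) \<le> p * d" by (rule mult_le_mono2)
      then show ?thesis using \<pi>_lt[OF i] unfolding cR g_def by simp
    qed
  qed
  then have "g ` R = {..<card R}"
    using card_image[OF inj] by (intro card_subset_eq) auto
  then show thesis using that[of g] inj same by (auto simp: bij_betw_def)
qed

section \<open>Embedding edge blow-ups\<close>

text \<open>The cliques may be chosen as mere sets: the new vertices of each one are numbered inside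
  \<open>Q e\<close> afterwards, while \<open>new\<close> and \<open>dis\<close> keep them apart
  from the images of vertices of \<open>G\<close> and from each other.\<close>

lemma blowup_embeds:
  fixes G :: "'a graph" and L :: "'b graph"
  assumes G: "simple_graph G" and r: "r \<ge> 2"
    and \<theta>: "inj_on \<theta> (verts G)" "\<theta> ` verts G \<subseteq> verts L"
    and Q: "\<And>e. e \<in> edges G \<Longrightarrow> \<theta> ` e \<subseteq> Q e \<and> card (Q e) = r \<and> Q e \<subseteq> verts L"
    and clique: "\<And>e x y. e \<in> edges G \<Longrightarrow> x \<in> Q e \<Longrightarrow> y \<in> Q e \<Longrightarrow> x \<noteq> y \<Longrightarrow> {x, y} \<in> edges L"
    and new: "\<And>e. e \<in> edges G \<Longrightarrow> Q e \<inter> \<theta> ` verts G \<subseteq> \<theta> ` e"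
    and dis: "\<And>e e'. e \<in> edges G \<Longrightarrow> e' \<in> edges G \<Longrightarrow> e \<noteq> e' \<Longrightarrow> Q e \<inter> Q e' \<subseteq> \<theta> ` verts G"
  shows "embeds (edge_blowup G r) L"
proof -
  have "\<exists>g. bij_betw g {..<r - 2} (Q e - \<theta> ` e)" if e: "e \<in> edges G" for e
  proof -
    have fin: "finite (Q e)" using Q[OF e] r by (metis card.infinite not_numeral_le_zero)
    have "card (\<theta> ` e) = 2"
      using simple_graphD[OF G] e by (metis \<theta>(1) card_image inj_on_subset)
    then have "card (Q e - \<theta> ` e) = r - 2"
      using Q[OF e] fin by (metis card_Diff_subset finite_subset)
    then show ?thesis using finite_same_card_bij[of "{..<r - 2}" "Q e - \<theta> ` e"] fin by auto
  qed
  then obtain g where g: "\<And>e. e \<in> edges G \<Longrightarrow> bij_betw (g e) {..<r - 2} (Q e - \<theta> ` e)"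
    by metis
  have gin: "g e i \<in> Q e - \<theta> ` verts G" if "e \<in> edges G" "i < r - 2" for e i
  proof -
    have "g e i \<in> Q e - \<theta> ` e" using g[OF that(1)] that(2) by (auto simp: bij_betw_def)
    then show ?thesis using new[OF that(1)] by blast
  qed
  define \<phi> where "\<phi> v = (case v of Inl x \<Rightarrow> \<theta> x | Inr (e, i) \<Rightarrow> g e i)" for v
  have cq: "\<phi> ` blowup_clique r e \<subseteq> Q e" if e: "e \<in> edges G" for e
  proof
    fix y assume "y \<in> \<phi> ` blowup_clique r e"
    then consider x where "x \<in> e" "y = \<theta> x" | i where "i < r - 2" "y = g e i"
      by (auto simp: blowup_clique_def \<phi>_def)
    then show "y \<in> Q e" using Q[OF e] gin[OF e] by cases auto
  qed
  have Vcases: "(\<exists>x\<in>verts G. v = Inl x) \<or> (\<exists>e i. e \<in> edges G \<and> i < r - 2 \<and> v = Inr (e, i))"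
    if "v \<in> verts (edge_blowup G r)" for v
    using that simple_graphD(2)[OF G] by (auto simp: edge_blowup_def blowup_clique_def)
  have inj: "inj_on \<phi> (verts (edge_blowup G r))"
  proof (rule inj_onI)
    fix v w assume v: "v \<in> verts (edge_blowup G r)" and w: "w \<in> verts (edge_blowup G r)"
      and eq: "\<phi> v = \<phi> w"
    consider x y where "x \<in> verts G" "v = Inl x" "y \<in> verts G" "w = Inl y"
      | x e i where "x \<in> verts G" "v = Inl x" "e \<in> edges G" "i < r - 2" "w = Inr (e, i)"
      | x e i where "x \<in> verts G" "w = Inl x" "e \<in> edges G" "i < r - 2" "v = Inr (e, i)"
      | e i e' i' where "e \<in> edges G" "i < r - 2" "v = Inr (e, i)"
          "e' \<in> edges G" "i' < r - 2" "w = Inr (e', i')"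
      using Vcases[OF v] Vcases[OF w] by metis
    then show "v = w"
    proof cases
      case 1 then show ?thesis using eq \<theta>(1) by (auto simp: \<phi>_def inj_on_def)
    next
      case 2
      then show ?thesis using eq gin[of e i] imageI[of x "verts G" \<theta>] by (simp add: \<phi>_def)
    next
      case 3
      then show ?thesis using eq gin[of e i] imageI[of x "verts G" \<theta>] by (simp add: \<phi>_def)
    next
      case 4
      then have gg: "g e i = g e' i'" using eq by (simp add: \<phi>_def)
      have "e = e'"
      proof (rule ccontr)
        assume "e \<noteq> e'"
        then have "Q e \<inter> Q e' \<subseteq> \<theta> ` verts G" using dis 4 by blast
        then show False using gin[of e i] gin[of e' i'] gg 4 by auto
      qed
      moreover have "i = i'"
        using g[of e] gg 4 calculation by (auto simp: bij_betw_def inj_on_def)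
      ultimately show ?thesis using 4 by simp
    qed
  qed
  have sub: "\<phi> v \<in> verts L" if "v \<in> verts (edge_blowup G r)" for v
  proof -
    from Vcases[OF that] consider x where "x \<in> verts G" "v = Inl x"
      | e i where "e \<in> edges G" "i < r - 2" "v = Inr (e, i)" by blast
    then show ?thesis
    proof cases
      case 1 then show ?thesis using \<theta>(2) by (auto simp: \<phi>_def)
    next
      case 2 then show ?thesis using gin[of e i] Q[of e] by (auto simp: \<phi>_def)
    qed
  qed
  have "\<phi> ` d \<in> edges L" if d: "d \<in> edges (edge_blowup G r)" for d
  proof -
    obtain e where e: "e \<in> edges G" "d \<subseteq> blowup_clique r e" "card d = 2"
      using d by (auto simp: edge_blowup_def)
    obtain u w where uw: "d = {u, w}" "u \<noteq> w" using e(3) by (auto simp: card_2_iff)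
    have "u \<in> verts (edge_blowup G r)" "w \<in> verts (edge_blowup G r)"
      using edge_blowup_edges_subset[OF d] uw by auto
    then have "\<phi> u \<noteq> \<phi> w" using inj uw by (auto simp: inj_on_def)
    moreover have "\<phi> u \<in> Q e" "\<phi> w \<in> Q e" using cq[OF e(1)] e(2) uw by auto
    ultimately show ?thesis using clique[OF e(1)] uw by simp
  qed
  then show ?thesis using inj sub unfolding embeds_def by (intro exI[of _ \<phi>]) auto
qed

section \<open>Complete multipartite cores and a general embedding scheme\<close>

definition complete_parts :: "'b graph \<Rightarrow> nat \<Rightarrow> (nat \<Rightarrow> 'b set) \<Rightarrow> bool" where
  "complete_parts L p B \<longleftrightarrow>
     (\<forall>i<p. B i \<subseteq> verts L) \<and>
     (\<forall>i<p. \<forall>j<p. i \<noteq> j \<longrightarrow> (\<forall>x\<in>B i. \<forall>y\<in>B j. {x, y} \<in> edges L))"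

lemma complete_parts_disjoint:
  assumes "simple_graph L" "complete_parts L p B" "i < p" "j < p" "i \<noteq> j"
  shows "B i \<inter> B j = {}"
  using assms simple_graph_adj(1)[OF assms(1)] by (fastforce simp: complete_parts_def)

text \<open>The clique of an edge \<open>e\<close> of \<open>G\<close> consists of the images of the ends of \<open>e\<close> in \<open>S\<close>, of the
  vertices in \<open>X e\<close>, and of one vertex from each part \<open>B j\<close>, \<open>j \<in> J e\<close>; an end \<open>w\<close> outside \<open>S\<close> is
  the vertex from the part \<open>col w\<close>.\<close>

lemma blowup_embeds_scheme:
  fixes G :: "'a graph" and L :: "'b graph"
  assumes G: "simple_graph G" and L: "simple_graph L" and p: "p \<ge> 1"
    and B: "complete_parts L p B"
    and large: "\<And>i. i < p \<Longrightarrow> finite (B i) \<and> card (verts G) + card (edges G) \<le> card (B i)"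
    and \<sigma>: "inj_on \<sigma> S" "\<sigma> ` S \<subseteq> verts L" and S: "S \<subseteq> verts G"
    and X: "\<And>e. e \<in> edges G \<Longrightarrow> finite (X e) \<and> X e \<subseteq> verts L \<and> X e \<inter> \<sigma> ` S = {}"
    and Xdis: "\<And>e e'. e \<in> edges G \<Longrightarrow> e' \<in> edges G \<Longrightarrow> e \<noteq> e' \<Longrightarrow> X e \<inter> X e' = {}"
    and BS: "\<And>i. i < p \<Longrightarrow> B i \<inter> \<sigma> ` S = {}"
    and BX: "\<And>i e. i < p \<Longrightarrow> e \<in> edges G \<Longrightarrow> B i \<inter> X e = {}"
    and J: "\<And>e. e \<in> edges G \<Longrightarrow> J e \<subseteq> {..<p} \<and> card (\<sigma> ` (e \<inter> S) \<union> X e) + card (J e) = p + 1"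
    and clique: "\<And>e x y. e \<in> edges G \<Longrightarrow> x \<in> \<sigma> ` (e \<inter> S) \<union> X e \<Longrightarrow> y \<in> \<sigma> ` (e \<inter> S) \<union> X e \<Longrightarrow>
        x \<noteq> y \<Longrightarrow> {x, y} \<in> edges L"
    and adj: "\<And>e x j y. e \<in> edges G \<Longrightarrow> x \<in> \<sigma> ` (e \<inter> S) \<union> X e \<Longrightarrow> j \<in> J e \<Longrightarrow> y \<in> B j \<Longrightarrow>
        {x, y} \<in> edges L"
    and col: "\<And>w. w \<in> verts G \<Longrightarrow> w \<notin> S \<Longrightarrow> col w < p"
    and colJ: "\<And>e w. e \<in> edges G \<Longrightarrow> w \<in> e \<Longrightarrow> w \<notin> S \<Longrightarrow> col w \<in> J e"
    and colinj: "\<And>e. e \<in> edges G \<Longrightarrow> inj_on col (e - S)"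
  shows "embeds (edge_blowup G (p + 1)) L"
proof -
  have finG: "finite (verts G)" "finite (edges G)" using simple_graphD[OF G] finite_edges[OF G] by auto
  \<comment> \<open>Every part reserves one slot per vertex and one per edge of \<open>G\<close>:
    slot \<open>Inl w\<close> for the image of a vertex outside \<open>S\<close>, slot
    \<open>Inr e\<close> for a new vertex of the clique of \<open>e\<close>. The size requirement on
    the parts comes from here.\<close>
  have "\<exists>b. inj_on b (verts G <+> edges G) \<and> b ` (verts G <+> edges G) \<subseteq> B i" if "i < p" for i
    using card_le_inj[of "verts G <+> edges G" "B i"] large[OF that] finG
    by (auto simp: card_Plus)
  then obtain b where b: "\<And>i. i < p \<Longrightarrow> inj_on (b i) (verts G <+> edges G)"
      "\<And>i. i < p \<Longrightarrow> b i ` (verts G <+> edges G) \<subseteq> B i" by metis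
  define \<theta> where "\<theta> w = (if w \<in> S then \<sigma> w else b (col w) (Inl w))" for w
  \<comment> \<open>In the part of an end of \<open>e\<close> outside \<open>S\<close> the clique
    has to use the image of that end; in all other parts it uses its private slot.\<close>
  define pick where "pick e j =
    (if \<exists>w\<in>e - S. col w = j then b j (Inl (SOME w. w \<in> e - S \<and> col w = j)) else b j (Inr e))" for e j
  define Q where "Q e = (\<sigma> ` (e \<inter> S) \<union> X e) \<union> pick e ` J e" for e
  have sub: "e \<subseteq> verts G" if "e \<in> edges G" for e using simple_graphD(2)[OF G that] .
  have pickw: "pick e (col w) = \<theta> w" if "e \<in> edges G" "w \<in> e" "w \<notin> S" for e w
  proof -
    have "(SOME w'. w' \<in> e - S \<and> col w' = col w) = w"
      using colinj[OF that(1)] that by (intro some_equality) (auto simp: inj_on_def)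
    then show ?thesis using that by (auto simp: pick_def \<theta>_def)
  qed
  have pick_cases: "(\<exists>w\<in>e - S. col w = j \<and> pick e j = \<theta> w) \<or> pick e j = b j (Inr e)"
    if "e \<in> edges G" for e j
  proof (cases "\<exists>w\<in>e - S. col w = j")
    case True
    then obtain w where w: "w \<in> e - S" "col w = j" by blast
    then have "pick e j = \<theta> w" using pickw[OF that, of w] by auto
    then show ?thesis using w by blast
  next
    case False
    then show ?thesis by (simp add: pick_def)
  qed
  have \<theta>B: "\<theta> w \<in> B (col w)" if "w \<in> verts G" "w \<notin> S" for w
    using b(2)[OF col[OF that]] that by (auto simp: \<theta>_def)
  have pickB: "pick e j \<in> B j" if e: "e \<in> edges G" and j: "j \<in> J e" for e j
    using pick_cases[OF e, of j]
  proof
    assume "\<exists>w\<in>e - S. col w = j \<and> pick e j = \<theta> w"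
    then show ?thesis using \<theta>B sub[OF e] by auto
  next
    assume "pick e j = b j (Inr e)"
    then show ?thesis using b(2)[of j] J[OF e] e j by auto
  qed
  have part_eq: "i = j" if "x \<in> B i" "x \<in> B j" "i < p" "j < p" for x i j
    using complete_parts_disjoint[OF L B] that by blast
  have \<theta>inj: "inj_on \<theta> (verts G)"
  proof (rule inj_onI)
    fix v w assume v: "v \<in> verts G" and w: "w \<in> verts G" and eq: "\<theta> v = \<theta> w"
    have no: False if "x \<in> S" "y \<in> verts G" "y \<notin> S" "\<theta> x = \<theta> y" for x y
    proof -
      have "\<theta> x \<in> B (col y)" using \<theta>B[of y] that by simp
      moreover have "\<theta> x \<in> \<sigma> ` S" using that(1) by (simp add: \<theta>_def)
      ultimately show False using BS[OF col[of y]] that by blast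
    qed
    show "v = w"
    proof (cases "v \<in> S \<or> w \<in> S")
      case True
      then have "v \<in> S" "w \<in> S" using no[of v w] no[of w v] v w eq by metis+
      then show ?thesis using eq \<sigma>(1) by (auto simp: \<theta>_def inj_on_def)
    next
      case False
      then have "col v = col w" using part_eq \<theta>B v w eq col by metis
      then show ?thesis
        using False eq v w b(1)[OF col[of v]] by (auto simp: \<theta>_def inj_on_def)
    qed
  qed
  have \<theta>X: "\<theta> w \<notin> X e" if "w \<in> verts G" "e \<in> edges G" for w e
  proof (cases "w \<in> S")
    case True then show ?thesis using X[OF that(2)] by (auto simp: \<theta>_def)
  next
    case False
    then show ?thesis using \<theta>B[OF that(1)] BX[OF col[OF that(1)] that(2)] by auto
  qed
  have \<theta>new: "\<theta> w \<noteq> b j (Inr e)" if w: "w \<in> verts G" and e: "e \<in> edges G" and j: "j < p" for w e j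
  proof
    assume eq: "\<theta> w = b j (Inr e)"
    have bB: "b j (Inr e) \<in> B j" using b(2)[OF j] e by auto
    show False
    proof (cases "w \<in> S")
      case True
      then have "b j (Inr e) \<in> \<sigma> ` S" using eq by (simp add: \<theta>_def image_iff) metis
      then show ?thesis using BS[OF j] bB by blast
    next
      case False
      then have "col w = j" using part_eq[OF _ _ col[OF w] j] \<theta>B[OF w] bB eq by metis
      then show ?thesis using eq b(1)[OF j] w e False by (auto simp: \<theta>_def inj_on_def)
    qed
  qed
  show ?thesis
  proof (rule blowup_embeds[OF G _ \<theta>inj])
    show "2 \<le> p + 1" using p by simp
    show "\<theta> ` verts G \<subseteq> verts L"
    proof safe
      fix w assume w: "w \<in> verts G"
      show "\<theta> w \<in> verts L"
      proof (cases "w \<in> S")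
        case True then show ?thesis using \<sigma>(2) by (auto simp: \<theta>_def)
      next
        case False
        then show ?thesis using \<theta>B[OF w] col[OF w] B by (auto simp: complete_parts_def)
      qed
    qed
    fix e assume e: "e \<in> edges G"
    have Jp: "J e \<subseteq> {..<p}" and fJ: "finite (J e)" using J[OF e] finite_subset by auto
    have fe: "finite e" using simple_graphD(4)[OF G e] .
    have pinj: "inj_on (pick e) (J e)"
    proof (rule inj_onI)
      fix i j assume "i \<in> J e" "j \<in> J e" "pick e i = pick e j"
      then show "i = j" using pickB[OF e] part_eq Jp by (metis lessThan_iff subsetD)
    qed
    have sp_pick: "(\<sigma> ` (e \<inter> S) \<union> X e) \<inter> pick e ` J e = {}"
    proof (rule equals0I)
      fix x assume x: "x \<in> (\<sigma> ` (e \<inter> S) \<union> X e) \<inter> pick e ` J e"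
      then obtain j where j: "j \<in> J e" "x = pick e j" by blast
      then have "x \<in> B j" "j < p" using pickB[OF e] Jp by auto
      moreover have "x \<in> \<sigma> ` S \<or> x \<in> X e" using x by blast
      ultimately show False using BS[of j] BX[of j e] e by blast
    qed
    have "card (Q e) = card (\<sigma> ` (e \<inter> S) \<union> X e) + card (pick e ` J e)"
      unfolding Q_def using X[OF e] fe fJ by (intro card_Un_disjoint sp_pick) auto
    then have c: "card (Q e) = p + 1" using J[OF e] pinj by (simp add: card_image)
    have \<theta>e: "\<theta> ` e \<subseteq> Q e"
    proof safe
      fix w assume w: "w \<in> e"
      show "\<theta> w \<in> Q e"
      proof (cases "w \<in> S")
        case True then show ?thesis using w by (auto simp: Q_def \<theta>_def)
      next
        case False
        then have "\<theta> w = pick e (col w)" using pickw[OF e w] by simp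
        then show ?thesis using colJ[OF e w False] by (auto simp: Q_def)
      qed
    qed
    have "Q e \<subseteq> verts L"
    proof -
      have "pick e j \<in> verts L" if "j \<in> J e" for j
        using pickB[OF e that] B Jp that by (auto simp: complete_parts_def)
      then show ?thesis using X[OF e] \<sigma>(2) by (auto simp: Q_def)
    qed
    then show "\<theta> ` e \<subseteq> Q e \<and> card (Q e) = p + 1 \<and> Q e \<subseteq> verts L" using c \<theta>e by simp
    show "Q e \<inter> \<theta> ` verts G \<subseteq> \<theta> ` e"
    proof safe
      fix w assume w: "w \<in> verts G" "\<theta> w \<in> Q e"
      consider x where "x \<in> e" "x \<in> S" "\<theta> w = \<theta> x" | j where "j \<in> J e" "\<theta> w = pick e j"
        using w \<theta>X[OF w(1) e] by (auto simp: Q_def \<theta>_def)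
      then show "\<theta> w \<in> \<theta> ` e"
      proof cases
        case 1 then show ?thesis by simp
      next
        case 2
        then show ?thesis
          using pick_cases[OF e, of j] \<theta>new[OF w(1) e] Jp by (metis DiffD1 imageI lessThan_iff subsetD)
      qed
    qed
    show "{x, y} \<in> edges L" if xy: "x \<in> Q e" "y \<in> Q e" "x \<noteq> y" for x y
    proof -
      have PP: "{pick e i, pick e j} \<in> edges L" if "i \<in> J e" "j \<in> J e" "pick e i \<noteq> pick e j" for i j
      proof -
        have "i \<noteq> j" "i < p" "j < p" using that Jp by auto
        then show ?thesis using B pickB[OF e] that unfolding complete_parts_def by blast
      qed
      have SP: "{s, pick e j} \<in> edges L" if "s \<in> \<sigma> ` (e \<inter> S) \<union> X e" "j \<in> J e" for s j
        using adj[OF e that] pickB[OF e that(2)] by blast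
      consider "x \<in> \<sigma> ` (e \<inter> S) \<union> X e" "y \<in> \<sigma> ` (e \<inter> S) \<union> X e"
        | j where "x \<in> \<sigma> ` (e \<inter> S) \<union> X e" "j \<in> J e" "y = pick e j"
        | i where "i \<in> J e" "x = pick e i" "y \<in> \<sigma> ` (e \<inter> S) \<union> X e"
        | i j where "i \<in> J e" "x = pick e i" "j \<in> J e" "y = pick e j"
        using xy(1,2) unfolding Q_def by blast
      then show ?thesis
      proof cases
        case 1 then show ?thesis using clique[OF e _ _ xy(3)] by blast
      next
        case 2 then show ?thesis using SP by simp
      next
        case 3 then show ?thesis using SP[of y i] by (simp add: insert_commute)
      next
        case 4 then show ?thesis using PP xy(3) by simp
      qed
    qed
    show "Q e \<inter> Q e' \<subseteq> \<theta> ` verts G" if e': "e' \<in> edges G" and ne: "e \<noteq> e'" for e'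
    proof
      fix x assume x: "x \<in> Q e \<inter> Q e'"
      have Jp': "J e' \<subseteq> {..<p}" using J[OF e'] by auto
      have XP: False if f: "f \<in> edges G" "f' \<in> edges G" "x \<in> X f" "x \<in> pick f' ` J f'" for f f'
      proof -
        obtain j where j: "j \<in> J f'" "x = pick f' j" using f(4) by blast
        then have "x \<in> B j" "j < p" using pickB[OF f(2)] J[OF f(2)] by auto
        then show False using BX[of j f] f by blast
      qed
      \<comment> \<open>A vertex that two cliques take from the parts lies in the same part for
        both; were it not the image of a vertex of \<open>G\<close>, it would be the private slot of
        two different edges.\<close>
      have PP: "x \<in> \<theta> ` verts G" if ij: "i \<in> J e" "x = pick e i" "j \<in> J e'" "x = pick e' j" for i j
      proof -
        have "i < p" "j < p" using ij Jp Jp' by auto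
        moreover have "x \<in> B i" using pickB[OF e ij(1)] ij(2) by simp
        moreover have "x \<in> B j" using pickB[OF e' ij(3)] ij(4) by simp
        ultimately have "i = j" using part_eq by blast
        show ?thesis
        proof (rule ccontr)
          assume no: "x \<notin> \<theta> ` verts G"
          have "pick e i \<noteq> \<theta> w" if "w \<in> e - S" for w using no ij(2) sub[OF e] that by blast
          then have 1: "x = b i (Inr e)" using pick_cases[OF e, of i] ij(2) by metis
          have "pick e' j \<noteq> \<theta> w" if "w \<in> e' - S" for w
            using no ij(4) sub[OF e'] that by blast
          then have 2: "x = b i (Inr e')" using pick_cases[OF e', of j] ij(4) \<open>i = j\<close> by metis
          have "i < p" using Jp ij(1) by auto
          then have "Inr e = (Inr e' :: 'a + 'a set)"
            using inj_onD[OF b(1)[OF \<open>i < p\<close>]] 1 2 e e' by (metis InrI)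
          then show False using ne by simp
        qed
      qed
      have S\<theta>: "x \<in> \<theta> ` verts G" if "x \<in> \<sigma> ` (f \<inter> S)" for f
        using that S by (force simp: \<theta>_def)
      show "x \<in> \<theta> ` verts G"
        using x S\<theta> PP XP[OF e e'] XP[OF e' e] Xdis[OF e e' ne] unfolding Q_def by blast
    qed
  qed
qed

section \<open>Configurations of apices and coloured cores\<close>

text \<open>\<open>E\<close> holds the apices, and the \<open>B i\<close> are the cores of the
  colour classes of \<open>\<kappa>\<close> on \<open>R\<close>. A vertex of \<open>R\<close> may
  miss up to \<open>l\<close> vertices of a foreign core; inside the classes nothing is prescribed,
  and edges there are what the embeddings exploit. \<open>N\<close> will be compared with multiples
  of \<open>l\<close>, so that the cores survive the losses caused by boundedly many
  vertices.\<close>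

locale configuration =
  fixes L :: "'b graph" and p :: nat and E :: "'b set" and B :: "nat \<Rightarrow> 'b set"
    and R :: "'b set" and \<kappa> :: "'b \<Rightarrow> nat" and N l :: nat
  assumes L: "simple_graph L" and E: "E \<subseteq> verts L" and R: "R \<subseteq> verts L" and ER: "E \<inter> R = {}"
    and \<kappa>: "\<kappa> ` R \<subseteq> {..<p}" and complete: "complete_parts L p B"
    and B: "i < p \<Longrightarrow> B i \<subseteq> R" "i < p \<Longrightarrow> x \<in> B i \<Longrightarrow> \<kappa> x = i" "i < p \<Longrightarrow> N \<le> card (B i)"
    and EB: "i < p \<Longrightarrow> x \<in> E \<Longrightarrow> y \<in> B i \<Longrightarrow> {x, y} \<in> edges L"
    and missing: "x \<in> R \<Longrightarrow> j < p \<Longrightarrow> j \<noteq> \<kappa> x \<Longrightarrow> card (B j - neighbours L x) \<le> l"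
    and l: "1 \<le> l"
begin

text \<open>What remains of a core once the vertices of \<open>X\<close> are in use. A vertex of
  \<open>X\<close> with colour \<open>i\<close> need not see core \<open>i\<close>, since the
  cliques built through it take no vertex from there.\<close>

definition common :: "'b set \<Rightarrow> nat \<Rightarrow> 'b set" where
  "common X i = {y \<in> B i. y \<notin> X \<and> (\<forall>x\<in>X. \<kappa> x \<noteq> i \<longrightarrow> {x, y} \<in> edges L)}"

lemma finite_sets: "finite E" "finite R"
  using finite_subset[OF E] finite_subset[OF R] simple_graphD(1)[OF L] by auto

lemma finite_parts: "i < p \<Longrightarrow> finite (B i)"
  using finite_subset[OF B(1)] finite_sets by blast

lemma common_subset: "common X i \<subseteq> B i"
  by (auto simp: common_def)

lemma complete_common: "complete_parts L p (common X)"
  using complete common_subset unfolding complete_parts_def by blast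

text \<open>Every vertex of \<open>X\<close> costs at most \<open>l\<close> core vertices: itself if
  it has colour \<open>i\<close>, which is paid for by \<open>1 \<le> l\<close>, and its missing
  neighbours otherwise.\<close>

lemma card_common:
  assumes X: "X \<subseteq> R" and i: "i < p"
  shows "N \<le> card (common X i) + card X * l"
proof -
  have fX: "finite X" using X finite_sets finite_subset by blast
  let ?D = "\<lambda>x. if \<kappa> x = i then {x} else B i - neighbours L x"
  have "B i \<subseteq> common X i \<union> (\<Union>x\<in>X. ?D x)"
    using B(2)[OF i] by (auto simp: common_def neighbours_def)
  moreover have fD: "finite (?D x)" for x using finite_parts[OF i] by simp
  moreover have "finite (common X i)" using finite_parts[OF i] common_subset finite_subset by blast
  ultimately have "card (B i) \<le> card (common X i \<union> (\<Union>x\<in>X. ?D x))"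
    by (intro card_mono finite_UnI finite_UN_I[OF fX])
  also have "\<dots> \<le> card (common X i) + card (\<Union>x\<in>X. ?D x)" by (rule card_Un_le)
  also have "card (\<Union>x\<in>X. ?D x) \<le> (\<Sum>x\<in>X. card (?D x))" using fX by (rule card_UN_le)
  also have "\<dots> \<le> (\<Sum>x\<in>X. l)"
  proof (rule sum_mono)
    fix x assume "x \<in> X"
    then show "card (?D x) \<le> l" using missing[of x i] X i l by auto
  qed
  finally show ?thesis using B(3)[OF i] by simp
qed

text \<open>A clique on p + 1 vertices consists of an apex and one vertex of every class, or of an
  edge inside class \<open>i\<close> and one vertex of every other class. An edge of
  \<open>G\<close> meeting \<open>S0\<close> uses the apex of its end in \<open>S0\<close>; the
  other edges of \<open>G\<close> take spare apices as new vertices, and then edges of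
  \<open>W\<close>.\<close>

lemma embed_matching:
  fixes G :: "'a graph"
  assumes G: "simple_graph G" and bip: "bipartition G P P'" and p: "p \<ge> 3"
    and S0: "independent G S0" "card S0 \<le> card E"
    and W: "finite W" "W \<subseteq> edges L" "pairwise disjnt W"
    and Wi: "\<And>d. d \<in> W \<Longrightarrow> d \<subseteq> R \<and> \<kappa> ` d \<subseteq> {i}" and i: "i < p"
    and cards: "card S0 + card {e \<in> edges G. e \<inter> S0 = {}} \<le> card E + card W"
    and N: "card (verts G) + card (edges G) + 2 * card (edges G) * l \<le> N"
  shows "embeds (edge_blowup G (p + 1)) L"
proof -
  define U where "U = {e \<in> edges G. e \<inter> S0 = {}}"
  have finG: "finite (verts G)" "finite (edges G)" using simple_graphD[OF G] finite_edges[OF G] by auto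
  have finU: "finite U" using finG by (simp add: U_def)
  have S0V: "S0 \<subseteq> verts G" using S0 by (simp add: independent_def)
  have finS0: "finite S0" using S0V finG finite_subset by blast
  \<comment> \<open>Spare apices are used up before the matching, so that by \<open>cards\<close>
    the matching suffices for the rest.\<close>
  obtain R1 where R1: "R1 \<subseteq> U" "card R1 = min (card U) (card E - card S0)"
    using obtain_subset_with_card_n[of "min (card U) (card E - card S0)" U] by auto
  define R2 where "R2 = U - R1"
  have fin12: "finite R1" "finite R2" using finU R1 finite_subset by (auto simp: R2_def)
  have "card R2 = card U - card R1" using R1 fin12 by (simp add: R2_def card_Diff_subset)
  then have cR: "card S0 + card R1 \<le> card E" "card R2 \<le> card W"
    using R1 S0(2) cards by (auto simp: U_def[symmetric])
  obtain f where f: "inj_on f (S0 <+> R1)" "f ` (S0 <+> R1) \<subseteq> E"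
    using card_le_inj[of "S0 <+> R1" E] finite_sets cR fin12 finS0 by (auto simp: card_Plus)
  obtain g where g: "inj_on g R2" "g ` R2 \<subseteq> W"
    using card_le_inj[of R2 W] fin12 W cR by auto
  define X where "X e = (if e \<in> R1 then {f (Inr e)} else if e \<in> R2 then g e else {})" for e
  define J where "J e = (if e \<in> R2 then {..<p} - {i} else {..<p})" for e
  define \<sigma> where "\<sigma> x = f (Inl x)" for x
  \<comment> \<open>Both sides of the bipartition are placed outside class \<open>i\<close>, because
    a clique with a matching edge has no room for another vertex of that class. This is where p
    \<ge> 3 is used.\<close>
  obtain j1 j2 where j: "j1 < p" "j2 < p" "j1 \<noteq> i" "j2 \<noteq> i" "j1 \<noteq> j2"
  proof -
    have "2 \<le> card ({..<p} - {i})" using p i by simp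
    then obtain T where "T \<subseteq> {..<p} - {i}" "card T = 2" by (meson obtain_subset_with_card_n)
    then show thesis using that by (auto simp: card_2_iff)
  qed
  define col where "col w = (if w \<in> P then j1 else j2)" for w
  define XX where "XX = \<Union> (g ` R2)"
  have ge: "g e \<in> edges L" "g e \<subseteq> R" "\<And>x. x \<in> g e \<Longrightarrow> \<kappa> x = i" if "e \<in> R2" for e
    using g(2) W Wi[of "g e"] that by blast+
  have XXR: "XX \<subseteq> R" using ge by (auto simp: XX_def)
  have "card XX \<le> (\<Sum>e\<in>R2. card (g e))" unfolding XX_def using fin12 by (intro card_UN_le) auto
  also have "\<dots> = 2 * card R2" using ge simple_graphD(3)[OF L] by simp
  also have "card R2 \<le> card (edges G)"
    using finG by (intro card_mono) (auto simp: R2_def U_def)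
  finally have cXX: "card XX \<le> 2 * card (edges G)" by simp
  have disjU: "R1 \<inter> R2 = {}" by (auto simp: R2_def)
  have RU: "e \<inter> S0 = {}" if "e \<in> R1 \<or> e \<in> R2" for e using that R1 by (auto simp: R2_def U_def)
  have cov: "\<exists>v. e \<inter> S0 = {v}" if e: "e \<in> edges G" "e \<notin> R1" "e \<notin> R2" for e
  proof -
    have "e \<inter> S0 \<noteq> {}" using e by (auto simp: R2_def U_def)
    moreover have "\<not> e \<subseteq> S0" using S0 e by (auto simp: independent_def)
    moreover obtain a b where "e = {a, b}" using simple_graph_edgeE[OF G e(1)] by metis
    ultimately show ?thesis by auto
  qed
  have Sp_cases: "(e \<in> R1 \<and> \<sigma> ` (e \<inter> S0) \<union> X e = {f (Inr e)} \<and> f (Inr e) \<in> E) \<or>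
      (e \<in> R2 \<and> \<sigma> ` (e \<inter> S0) \<union> X e = g e) \<or>
      (e \<notin> R2 \<and> (\<exists>v\<in>S0. \<sigma> ` (e \<inter> S0) \<union> X e = {\<sigma> v} \<and> \<sigma> v \<in> E))" if e: "e \<in> edges G" for e
  proof -
    consider "e \<in> R1" | "e \<in> R2" | "e \<notin> R1" "e \<notin> R2" by blast
    then show ?thesis
    proof cases
      case 1
      then have "f (Inr e) \<in> E" using f by auto
      then show ?thesis using 1 RU[of e] by (auto simp: X_def)
    next
      case 2 then show ?thesis using RU[of e] disjU by (auto simp: X_def)
    next
      case 3
      then obtain v where v: "e \<inter> S0 = {v}" using cov e by blast
      then have "v \<in> S0" by blast
      then have "\<sigma> v \<in> E" using f by (auto simp: \<sigma>_def)
      then show ?thesis using 3 v \<open>v \<in> S0\<close> by (auto simp: X_def)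
    qed
  qed
  have commonR: "common XX j \<subseteq> R" if "j < p" for j using common_subset B(1)[OF that] by blast
  show ?thesis
  proof (rule blowup_embeds_scheme[OF G L _ complete_common[of XX], where S = S0 and \<sigma> = \<sigma> and
        X = X and J = J and col = col])
    show "1 \<le> p" using p by simp
    show "finite (common XX j) \<and> card (verts G) + card (edges G) \<le> card (common XX j)" if "j < p" for j
    proof -
      have "card XX * l \<le> 2 * card (edges G) * l" using cXX by simp
      then have "card (verts G) + card (edges G) \<le> card (common XX j)"
        using card_common[OF XXR that] N by linarith
      then show ?thesis using finite_subset[OF common_subset finite_parts[OF that]] by simp
    qed
    show "inj_on \<sigma> S0" using f(1) by (auto simp: \<sigma>_def inj_on_def)
    have \<sigma>E: "\<sigma> ` S0 \<subseteq> E" using f(2) by (auto simp: \<sigma>_def)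
    then show "\<sigma> ` S0 \<subseteq> verts L" using E by blast
    show "S0 \<subseteq> verts G" by fact
    have Xcase: "X e = {} \<or> (e \<in> R1 \<and> X e = {f (Inr e)} \<and> f (Inr e) \<in> E) \<or> (e \<in> R2 \<and> X e = g e)" for e
      using f(2) by (auto simp: X_def)
    show "finite (X e) \<and> X e \<subseteq> verts L \<and> X e \<inter> \<sigma> ` S0 = {}" if "e \<in> edges G" for e
      using Xcase[of e]
    proof (elim disjE)
      assume a: "e \<in> R1 \<and> X e = {f (Inr e)} \<and> f (Inr e) \<in> E"
      then have "f (Inr e) \<noteq> \<sigma> x" if "x \<in> S0" for x
        using f(1) that by (auto simp: \<sigma>_def inj_on_def)
      then show ?thesis using a E by auto
    next
      assume "e \<in> R2 \<and> X e = g e"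
      then have e2: "e \<in> R2" "X e = g e" by blast+
      then have "X e \<inter> \<sigma> ` S0 = {}" using ge(2)[OF e2(1)] ER \<sigma>E by blast
      then show ?thesis using e2 simple_graphD(2,4)[OF L ge(1)[OF e2(1)]] by simp
    qed auto
    show "X e \<inter> X e' = {}" if "e \<in> edges G" "e' \<in> edges G" "e \<noteq> e'" for e e'
    proof -
      have RE: "X e \<inter> X e' = {}" if "e \<in> R1" "e' \<in> R2" for e e'
        using that f(2) ge(2)[of e'] ER disjU by (auto simp: X_def)
      consider "X e = {}" | "X e' = {}" | "e \<in> R1" "e' \<in> R1" | "e \<in> R1" "e' \<in> R2"
        | "e' \<in> R1" "e \<in> R2" | "e \<in> R2" "e' \<in> R2" using Xcase by metis
      then show ?thesis
      proof cases
        case 3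
        then show ?thesis using f(1) \<open>e \<noteq> e'\<close> by (auto simp: X_def inj_on_def)
      next
        case 4 then show ?thesis using RE by blast
      next
        case 5 then show ?thesis using RE by blast
      next
        case 6
        then have "g e \<noteq> g e'" "g e \<in> W" "g e' \<in> W" using g \<open>e \<noteq> e'\<close> by (auto simp: inj_on_def)
        then have "disjnt (g e) (g e')" using W(3) by (auto simp: pairwise_def)
        then show ?thesis using 6 disjU by (auto simp: X_def disjnt_def)
      qed auto
    qed
    show "common XX j \<inter> \<sigma> ` S0 = {}" if "j < p" for j using commonR[OF that] \<sigma>E ER by blast
    show "common XX j \<inter> X e = {}" if "j < p" "e \<in> edges G" for j e
      using Xcase[of e] commonR[OF that(1)] ER by (auto simp: common_def XX_def)
    show "J e \<subseteq> {..<p} \<and> card (\<sigma> ` (e \<inter> S0) \<union> X e) + card (J e) = p + 1" if "e \<in> edges G" for e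
      using Sp_cases[OF that]
    proof (elim disjE)
      assume a: "e \<in> R1 \<and> \<sigma> ` (e \<inter> S0) \<union> X e = {f (Inr e)} \<and> f (Inr e) \<in> E"
      then have "e \<notin> R2" using disjU by blast
      then show ?thesis using a by (simp add: J_def)
    next
      assume a: "e \<in> R2 \<and> \<sigma> ` (e \<inter> S0) \<union> X e = g e"
      then have "card (g e) = 2" using simple_graphD(3)[OF L ge(1)[of e]] by simp
      then show ?thesis using a i by (auto simp: J_def)
    next
      assume "e \<notin> R2 \<and> (\<exists>v\<in>S0. \<sigma> ` (e \<inter> S0) \<union> X e = {\<sigma> v} \<and> \<sigma> v \<in> E)"
      then show ?thesis by (auto simp: J_def)
    qed
    show "{x, y} \<in> edges L" if e: "e \<in> edges G" "x \<in> \<sigma> ` (e \<inter> S0) \<union> X e"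
      "y \<in> \<sigma> ` (e \<inter> S0) \<union> X e" "x \<noteq> y" for e x y
    proof -
      define T where "T = \<sigma> ` (e \<inter> S0) \<union> X e"
      have "e \<in> R2" "x \<in> g e" "y \<in> g e"
        using Sp_cases[OF e(1), folded T_def] e(2-4)[folded T_def] by auto
      moreover obtain a b where "g e = {a, b}"
        using simple_graph_edgeE[OF L ge(1)[OF \<open>e \<in> R2\<close>]] by metis
      ultimately have "g e = {x, y}" using e(4) by auto
      then show ?thesis using ge(1)[OF \<open>e \<in> R2\<close>] by simp
    qed
    show "{x, y} \<in> edges L" if e: "e \<in> edges G" "x \<in> \<sigma> ` (e \<inter> S0) \<union> X e"
      "j \<in> J e" "y \<in> common XX j" for e x j y
    proof -
      have j: "j < p" using e(3) by (auto simp: J_def split: if_splits)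
      define T where "T = \<sigma> ` (e \<inter> S0) \<union> X e"
      have "x \<in> E \<or> (e \<in> R2 \<and> x \<in> g e)"
        using Sp_cases[OF e(1), folded T_def] e(2)[folded T_def] by auto
      then show ?thesis
      proof
        assume "x \<in> E" then show ?thesis using EB[OF j] e(4) common_subset by blast
      next
        assume x: "e \<in> R2 \<and> x \<in> g e"
        then have "j \<noteq> i" "\<kappa> x = i" "x \<in> XX" using e(3) ge(3) by (auto simp: J_def XX_def)
        then show ?thesis using e(4) by (auto simp: common_def)
      qed
    qed
    show "col w < p" for w using j by (simp add: col_def)
    show "col w \<in> J e" for w e using j by (simp add: col_def J_def)
    show "inj_on col (e - S0)" if e: "e \<in> edges G" for e
    proof (rule inj_onI)
      fix u w assume uw: "u \<in> e - S0" "w \<in> e - S0" "col u = col w"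
      show "u = w"
      proof (rule ccontr)
        assume "u \<noteq> w"
        moreover obtain a b where "e = {a, b}" using simple_graph_edgeE[OF G e(1)] by metis
        ultimately have euw: "e = {u, w}" using uw by auto
        have "u \<in> P \<longleftrightarrow> w \<in> P" using uw(3) j(5) by (auto simp: col_def split: if_splits)
        moreover have "u \<in> P \<or> u \<in> P'" "w \<in> P \<or> w \<in> P'"
          using bip simple_graphD(2)[OF G e] euw by (auto simp: bipartition_def)
        ultimately have "e \<subseteq> P \<or> e \<subseteq> P'" using euw by auto
        then show False using bip e by (auto simp: bipartition_def independent_def)
      qed
    qed
  qed
qed

text \<open>The centre \<open>x0\<close> is played by a vertex \<open>y\<close> of \<open>R\<close>,
  which saves an apex. A clique through \<open>y\<close> then needs an edge inside a class: either
  \<open>{y, z}\<close> in the class of \<open>y\<close>, or an edge of another class completely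
  joined to \<open>y\<close>. One of these is spent on each edge of \<open>G\<close> at
  \<open>x0\<close>.\<close>

lemma embed_star:
  fixes G :: "'a graph"
  assumes G: "simple_graph G" and p: "p \<ge> 3"
    and S0: "independent_covering G S0" "card S0 \<le> card E + 1" and x0: "x0 \<in> S0"
    and y: "y \<in> R" and Z: "finite Z" "\<And>z. z \<in> Z \<Longrightarrow> z \<in> R \<and> \<kappa> z = \<kappa> y \<and> {y, z} \<in> edges L"
    and W: "finite W" "W \<subseteq> edges L" "pairwise disjnt W"
    and Wi: "\<And>d. d \<in> W \<Longrightarrow> d \<subseteq> R \<and> (\<exists>j. j \<noteq> \<kappa> y \<and> \<kappa> ` d \<subseteq> {j})"
    and Wy: "\<And>d u. d \<in> W \<Longrightarrow> u \<in> d \<Longrightarrow> {y, u} \<in> edges L"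
    and cards: "degree G x0 \<le> card Z + card W"
    and N: "card (verts G) + card (edges G) + (2 * card (edges G) + 1) * l \<le> N"
  shows "embeds (edge_blowup G (p + 1)) L"
proof -
  have finG: "finite (verts G)" "finite (edges G)" using simple_graphD[OF G] finite_edges[OF G] by auto
  have S0V: "S0 \<subseteq> verts G" and ind: "\<And>e. e \<in> edges G \<Longrightarrow> \<not> e \<subseteq> S0"
    and cov: "\<And>e. e \<in> edges G \<Longrightarrow> e \<inter> S0 \<noteq> {}"
    using S0 by (auto simp: independent_covering_def independent_def covering_def)
  have finS0: "finite S0" using S0V finG finite_subset by blast
  define M where "M = {e \<in> edges G. x0 \<in> e}"
  have finM: "finite M" using finG by (simp add: M_def)
  have e1: "\<exists>v. e \<inter> S0 = {v}" if e: "e \<in> edges G" for e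
  proof -
    obtain a b where "e = {a, b}" using simple_graph_edgeE[OF G e(1)] by metis
    then show ?thesis using ind[OF e] cov[OF e] by auto
  qed
  have eM: "e \<inter> S0 = {x0}" if e: "e \<in> M" for e
  proof -
    obtain v where "e \<inter> S0 = {v}" using e1[of e] e by (auto simp: M_def)
    moreover have "x0 \<in> e \<inter> S0" using e x0 by (simp add: M_def)
    ultimately show ?thesis by simp
  qed
  have "card (S0 - {x0}) \<le> card E" using S0(2) x0 finS0 by simp
  then obtain f where f: "inj_on f (S0 - {x0})" "f ` (S0 - {x0}) \<subseteq> E"
    using card_le_inj[of "S0 - {x0}" E] finite_sets finS0 by blast
  obtain h where h: "inj_on h M" "h ` M \<subseteq> Z <+> W"
    using card_le_inj[of M "Z <+> W"] finM Z(1) W(1) cards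
    by (auto simp: card_Plus degree_def M_def)
  define X where "X e = (if e \<in> M then (case h e of Inl z \<Rightarrow> {z} | Inr d \<Rightarrow> d) else {})" for e
  \<comment> \<open>The classes of \<open>y\<close> and of \<open>X e\<close> are already
    represented. This leaves p - 1 classes to complete two vertices, or p - 2 classes to complete
    three.\<close>
  define J where "J e = (if e \<in> M then {..<p} - insert (\<kappa> y) (\<kappa> ` X e) else {..<p})" for e
  define \<sigma> where "\<sigma> x = (if x = x0 then y else f x)" for x
  \<comment> \<open>Only an edge \<open>{x0, w}\<close> restricts the class of \<open>w\<close>,
    since the cliques at other centres use every class; 0 is a default for vertices not joined to
    \<open>x0\<close>.\<close>
  define col where "col w = (if {x0, w} \<in> M then SOME j. j \<in> J {x0, w} else 0)" for w
  define XX where "XX = insert y (\<Union> (X ` M))"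
  have XM: "(\<exists>z\<in>Z. h e = Inl z \<and> X e = {z}) \<or> (\<exists>d\<in>W. h e = Inr d \<and> X e = d)" if "e \<in> M" for e
    using h(2) that by (fastforce simp: X_def)
  have Wd: "card d = 2" "finite d" if "d \<in> W" for d using W(2) simple_graphD(3,4)[OF L] that by blast+
  have XR: "X e \<subseteq> R" for e
  proof (cases "e \<in> M")
    case True
    from XM[OF this] show ?thesis
    proof
      assume "\<exists>z\<in>Z. h e = Inl z \<and> X e = {z}"
      then show ?thesis using Z(2) by force
    next
      assume "\<exists>d\<in>W. h e = Inr d \<and> X e = d"
      then show ?thesis using Wi by force
    qed
  qed (simp add: X_def)
  have cX: "card (X e) \<le> 2" "finite (X e)" if "e \<in> M" for e using XM[OF that] Wd by auto
  have XXR: "XX \<subseteq> R" using XR y by (auto simp: XX_def)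
  have "card XX \<le> Suc (card (\<Union> (X ` M)))" unfolding XX_def by (rule card_insert_le_m1) auto
  also have "card (\<Union> (X ` M)) \<le> (\<Sum>e\<in>M. card (X e))" using finM by (intro card_UN_le) auto
  also have "\<dots> \<le> (\<Sum>e\<in>M. 2)" using cX by (intro sum_mono) auto
  also have "\<dots> \<le> 2 * card (edges G)" using finG by (simp add: M_def card_mono)
  finally have cXX: "card XX \<le> 2 * card (edges G) + 1" by simp
  have yX: "{y, x} \<in> edges L" if "e \<in> M" "x \<in> X e" for e x
    using XM[OF that(1)] that(2) Z(2) Wy by auto
  have ynX: "y \<notin> X e" for e
    using yX[of e y] simple_graph_adj(1)[OF L, of y y] by (cases "e \<in> M") (auto simp: X_def)
  \<comment> \<open>Nonemptiness of \<open>J e\<close> relies on p \<ge> 3: when \<open>y\<close>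
    and an edge of a second class are in use, a class must be left for the other end of
    \<open>e\<close>.\<close>
  have cJ: "card (insert y (X e)) + card (J e) = p + 1 \<and> J e \<noteq> {}" if e: "e \<in> M" for e
    using XM[OF e]
  proof
    assume "\<exists>z\<in>Z. h e = Inl z \<and> X e = {z}"
    then obtain z where z: "z \<in> Z" "X e = {z}" by blast
    then have "J e = {..<p} - {\<kappa> y}" using Z(2)[of z] e by (auto simp: J_def)
    then have "card (J e) = p - 1" using \<kappa> y by auto
    then show ?thesis using z ynX[of e] p by auto
  next
    assume "\<exists>d\<in>W. h e = Inr d \<and> X e = d"
    then obtain d where d: "d \<in> W" "X e = d" by blast
    obtain j where j: "j \<noteq> \<kappa> y" "\<kappa> ` d \<subseteq> {j}" "d \<subseteq> R" using Wi[OF d(1)] by blast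
    have "d \<noteq> {}" using Wd[OF d(1)] by auto
    then obtain u where "u \<in> d" by blast
    then have "\<kappa> u = j" "u \<in> R" using j by auto
    then have kd: "\<kappa> ` d = {j}" "j < p" using j \<kappa> \<open>u \<in> d\<close> by auto
    have "\<kappa> y < p" using \<kappa> y by auto
    have "J e = {..<p} - {\<kappa> y, j}" using kd d e by (simp add: J_def)
    then have "card (J e) = p - 2" using kd j \<open>\<kappa> y < p\<close> by (simp add: card_Diff_subset)
    moreover have "card (insert y d) = 3" using Wd[OF d(1)] ynX[of e] d by simp
    ultimately show ?thesis using p d by auto
  qed
  have Sp: "\<sigma> ` (e \<inter> S0) \<union> X e = (if e \<in> M then insert y (X e) else \<sigma> ` (e \<inter> S0))" for e
    using eM by (auto simp: \<sigma>_def X_def)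
  have nM: "\<exists>v\<in>S0 - {x0}. \<sigma> ` (e \<inter> S0) = {\<sigma> v} \<and> \<sigma> v \<in> E" if e: "e \<in> edges G" "e \<notin> M" for e
  proof -
    obtain v where v: "e \<inter> S0 = {v}" using e1[OF e(1)] by blast
    then have "v \<noteq> x0" "v \<in> S0" using e by (auto simp: M_def)
    then show ?thesis using v f by (auto simp: \<sigma>_def)
  qed
  have commonR: "common XX j \<subseteq> R" if "j < p" for j using common_subset B(1)[OF that] by blast
  have XyE: "\<sigma> ` S0 \<subseteq> insert y E" using f(2) by (auto simp: \<sigma>_def)
  show ?thesis
  proof (rule blowup_embeds_scheme[OF G L _ complete_common[of XX], where S = S0 and \<sigma> = \<sigma> and
        X = X and J = J and col = col])
    show "1 \<le> p" using p by simp
    show "finite (common XX j) \<and> card (verts G) + card (edges G) \<le> card (common XX j)" if "j < p" for j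
    proof -
      have "card XX * l \<le> (2 * card (edges G) + 1) * l" by (rule mult_le_mono1[OF cXX])
      then have "card (verts G) + card (edges G) \<le> card (common XX j)"
        using card_common[OF XXR that] N by linarith
      then show ?thesis using finite_subset[OF common_subset finite_parts[OF that]] by simp
    qed
    show "inj_on \<sigma> S0"
    proof (rule inj_onI)
      fix u w assume uw: "u \<in> S0" "w \<in> S0" "\<sigma> u = \<sigma> w"
      have "f v \<noteq> y" if "v \<in> S0 - {x0}" for v using f(2) that ER y by blast
      then show "u = w" using uw f(1) by (auto simp: \<sigma>_def inj_on_def split: if_splits)
    qed
    show "\<sigma> ` S0 \<subseteq> verts L" using XyE E R y by blast
    show "S0 \<subseteq> verts G" by fact
    show "finite (X e) \<and> X e \<subseteq> verts L \<and> X e \<inter> \<sigma> ` S0 = {}" if "e \<in> edges G" for e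
    proof -
      have "finite (X e)" using cX[of e] by (cases "e \<in> M") (auto simp: X_def)
      moreover have "X e \<inter> \<sigma> ` S0 = {}" using XyE ynX[of e] XR[of e] ER by blast
      ultimately show ?thesis using XR[of e] R by blast
    qed
    show "X e \<inter> X e' = {}" if "e \<in> edges G" "e' \<in> edges G" "e \<noteq> e'" for e e'
    proof (cases "e \<in> M \<and> e' \<in> M")
      case True
      then have hne: "h e \<noteq> h e'" using h(1) that(3) by (auto simp: inj_on_def)
      have ZW: "z \<notin> d" if "z \<in> Z" "d \<in> W" for z d using Z(2)[OF that(1)] Wi[OF that(2)] by auto
      have WW: "d \<inter> d' = {}" if "d \<in> W" "d' \<in> W" "d \<noteq> d'" for d d'
        using W(3) that by (auto simp: pairwise_def disjnt_def)
      have me: "e \<in> M" "e' \<in> M" using True by auto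
      from XM[OF me(1)] show ?thesis
      proof (elim conjE disjE bexE)
        fix z assume z: "z \<in> Z" "h e = Inl z" "X e = {z}"
        from XM[OF me(2)] show ?thesis
        proof (elim conjE disjE bexE)
          fix z' assume "z' \<in> Z" "h e' = Inl z'" "X e' = {z'}"
          then show ?thesis using z hne by simp
        next
          fix d assume "d \<in> W" "X e' = d"
          then show ?thesis using z ZW[of z d] by simp
        qed
      next
        fix d assume d: "d \<in> W" "h e = Inr d" "X e = d"
        from XM[OF me(2)] show ?thesis
        proof (elim conjE disjE bexE)
          fix z assume "z \<in> Z" "X e' = {z}"
          then show ?thesis using d ZW[of z d] by simp
        next
          fix d' assume "d' \<in> W" "h e' = Inr d'" "X e' = d'"
          then show ?thesis using d hne WW[of d d'] by simp
        qed
      qed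
    qed (auto simp: X_def)
    show "common XX j \<inter> \<sigma> ` S0 = {}" if "j < p" for j
      using commonR[OF that] XyE ER by (auto simp: common_def XX_def)
    show "common XX j \<inter> X e = {}" if "j < p" "e \<in> edges G" for j e
      by (cases "e \<in> M") (auto simp: common_def XX_def X_def)
    show "J e \<subseteq> {..<p} \<and> card (\<sigma> ` (e \<inter> S0) \<union> X e) + card (J e) = p + 1" if "e \<in> edges G" for e
    proof (cases "e \<in> M")
      case True then show ?thesis unfolding Sp using cJ[OF True] by (auto simp: J_def)
    next
      case False
      then have "card (\<sigma> ` (e \<inter> S0)) = 1" using nM[OF that False] by auto
      then show ?thesis unfolding Sp using False by (simp add: J_def)
    qed
    show "{x, y'} \<in> edges L" if e: "e \<in> edges G" "x \<in> \<sigma> ` (e \<inter> S0) \<union> X e"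
      "y' \<in> \<sigma> ` (e \<inter> S0) \<union> X e" "x \<noteq> y'" for e x y'
    proof (cases "e \<in> M")
      case True
      then have "x = y \<or> x \<in> X e" "y' = y \<or> y' \<in> X e" using e Sp[of e] by auto
      moreover have "{x, y'} \<in> edges L" if xx: "x \<in> X e" "y' \<in> X e"
      proof -
        obtain d where d: "d \<in> W" "X e = d" using XM[OF True] xx e(4) by auto
        then obtain a b where "d = {a, b}" using Wd(1)[OF d(1)] by (auto simp: card_2_iff)
        then have "d = {x, y'}" using xx d e(4) by auto
        then show ?thesis using d W(2) by blast
      qed
      ultimately show ?thesis using yX[OF True] e(4) by (metis insert_commute)
    next
      case False
      then have "x \<in> \<sigma> ` (e \<inter> S0)" "y' \<in> \<sigma> ` (e \<inter> S0)" using e Sp[of e] by simp_all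
      then show ?thesis using nM[OF e(1) False] e(4) by (metis singletonD)
    qed
    show "{x, b} \<in> edges L" if e: "e \<in> edges G" "x \<in> \<sigma> ` (e \<inter> S0) \<union> X e"
      "j \<in> J e" "b \<in> common XX j" for e x j b
    proof (cases "e \<in> M")
      case True
      then have x: "x = y \<or> x \<in> X e" using e(2) Sp[of e] by auto
      then have "\<kappa> x \<noteq> j" "x \<in> XX" using e(3) True by (auto simp: J_def XX_def)
      then show ?thesis using e(4) by (auto simp: common_def)
    next
      case False
      then have "x \<in> \<sigma> ` (e \<inter> S0)" using e Sp[of e] by simp
      then have "x \<in> E" using nM[OF e(1) False] by (metis singletonD)
      moreover have "j < p" using e(3) False by (simp add: J_def)
      ultimately show ?thesis using EB e(4) common_subset by blast
    qed
    have Jne: "(SOME j. j \<in> J e) \<in> J e" if "e \<in> M" for e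
      using cJ[OF that] by (simp add: some_in_eq)
    show "col w < p" for w
    proof (cases "{x0, w} \<in> M")
      case True
      then show ?thesis using Jne[OF True] by (auto simp: col_def J_def)
    next
      case False then show ?thesis using p by (simp add: col_def)
    qed
    then show "col w \<in> J e" if e: "e \<in> edges G" "w \<in> e" "w \<notin> S0" for w e
    proof (cases "e \<in> M")
      case True
      obtain a b where "e = {a, b}" using simple_graph_edgeE[OF G e(1)] by metis
      then have "e = {x0, w}" using e True x0 by (auto simp: M_def)
      then show ?thesis using True Jne[OF True] by (auto simp: col_def)
    next
      case False then show ?thesis using \<open>\<And>w. col w < p\<close> by (simp add: J_def)
    qed
    show "inj_on col (e - S0)" if e: "e \<in> edges G" for e
    proof -
      obtain a b where "e = {a, b}" using simple_graph_edgeE[OF G e(1)] by metis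
      then have "\<exists>w. e - S0 \<subseteq> {w}" using cov[OF e] by auto
      then show ?thesis by (auto simp: inj_on_def)
    qed
  qed
qed

text \<open>Only the subgraph of \<open>F\<close> induced by \<open>U\<close> has to be realised
  among the apices. The vertices outside the covering are independent and go to core 0 together with
  the isolated vertices, the p - 1 parts of the Turan graph go to the other cores, and all remaining
  edges are present because the cores are complete to each other and to \<open>E\<close>.\<close>

lemma embed_decomposition:
  fixes H :: "'a graph" and F :: "'c graph"
  assumes H: "simple_graph H" and p: "p \<ge> 2" and dec: "decomposes p H F"
    and U: "covering F U" and \<psi>: "inj_on \<psi> U" "\<psi> ` U \<subseteq> E"
    and \<psi>e: "\<And>e. e \<in> edges F \<Longrightarrow> e \<subseteq> U \<Longrightarrow> \<psi> ` e \<in> edges L"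
    and N: "card (verts H) \<le> N"
  shows "embeds H L"
proof -
  obtain t \<phi> where \<phi>: "inj_on \<phi> (verts H)"
    "\<forall>e\<in>edges H. \<phi> ` e \<in> edges (join (disjoint_union F (edgeless_graph t))
        (turan_graph (p - 1) ((p - 1) * t)))"
    using dec by (auto simp: decomposes_def embeds_def)
  have finH: "finite (verts H)" using simple_graphD(1)[OF H] .
  have "\<exists>b. inj_on b (verts H) \<and> b ` verts H \<subseteq> B i" if "i < p" for i
    using card_le_inj[OF finH finite_parts[OF that]] B(3)[OF that] N by auto
  then obtain b where b: "\<And>i. i < p \<Longrightarrow> inj_on (b i) (verts H)"
      "\<And>i. i < p \<Longrightarrow> b i ` verts H \<subseteq> B i" by metis
  define part where "part v = (case \<phi> v of Inl a \<Rightarrow> 0 | Inr j \<Rightarrow> 1 + j mod (p - 1))" for v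
  define inU where "inU v \<longleftrightarrow> (\<exists>u\<in>U. \<phi> v = Inl (Inl u))" for v
  \<comment> \<open>Each core has a slot for every vertex of \<open>H\<close>, so two vertices
    placed in the same core never collide.\<close>
  define \<Phi> where "\<Phi> v = (if inU v then \<psi> (projl (projl (\<phi> v))) else b (part v) v)" for v
  have part: "part v < p" for v
  proof (cases "\<phi> v")
    case (Inr j)
    have "j mod (p - 1) < p - 1" using p by simp
    then show ?thesis using Inr by (simp add: part_def)
  qed (use p in \<open>simp add: part_def\<close>)
  have \<Phi>E: "\<Phi> v \<in> E" if "inU v" for v using that \<psi>(2) by (auto simp: \<Phi>_def inU_def)
  have \<Phi>B: "\<Phi> v \<in> B (part v)" if "v \<in> verts H" "\<not> inU v" for v
    using b(2)[OF part] that by (auto simp: \<Phi>_def)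
  have BE: "x \<notin> E" if "x \<in> B i" "i < p" for x i using B(1)[OF that(2)] ER that(1) by blast
  have inj: "inj_on \<Phi> (verts H)"
  proof (rule inj_onI)
    fix v w assume v: "v \<in> verts H" and w: "w \<in> verts H" and eq: "\<Phi> v = \<Phi> w"
    have same: "inU v \<longleftrightarrow> inU w" using \<Phi>E \<Phi>B v w eq BE part by metis
    show "v = w"
    proof (cases "inU v")
      case True
      then obtain u u' where "u \<in> U" "\<phi> v = Inl (Inl u)" "u' \<in> U" "\<phi> w = Inl (Inl u')"
        using same by (auto simp: inU_def)
      then have "\<phi> v = \<phi> w" using eq True same \<psi>(1) by (auto simp: \<Phi>_def inj_on_def)
      then show ?thesis using \<phi>(1) v w by (auto simp: inj_on_def)
    next
      case False
      then have "part v = part w"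
        using \<Phi>B[OF v] \<Phi>B[OF w] same eq B(2)[OF part] by metis
      then show ?thesis using eq False same b(1)[OF part[of w]] v w by (auto simp: \<Phi>_def inj_on_def)
    qed
  qed
  have sub: "\<Phi> ` verts H \<subseteq> verts L"
    using \<Phi>E \<Phi>B E B(1)[OF part] R by blast
  have edge: "\<Phi> ` e \<in> edges L" if e: "e \<in> edges H" for e
  proof -
    obtain v w where vw: "e = {v, w}" "v \<in> verts H" "w \<in> verts H"
      using simple_graph_edgeE[OF H e] by metis
    have EBadj: "{\<Phi> v, \<Phi> w} \<in> edges L" if "inU v" "\<not> inU w" "w \<in> verts H" for v w
      using EB[OF part \<Phi>E[OF that(1)] \<Phi>B[OF that(3,2)]] .
    have parts: "{\<Phi> v, \<Phi> w} \<in> edges L" if "\<not> inU v" "\<not> inU w" "v \<in> verts H" "w \<in> verts H"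
      "part v \<noteq> part w" for v w
      using complete \<Phi>B[OF that(3,1)] \<Phi>B[OF that(4,2)] part that(5)
      unfolding complete_parts_def by blast
    have mixed: "{\<Phi> v, \<Phi> w} \<in> edges L" if "v \<in> verts H" "w \<in> verts H" "part v \<noteq> part w" for v w
    proof (cases "inU v"; cases "inU w")
      assume "inU v" "inU w"
      then have "part v = part w" by (auto simp: inU_def part_def)
      then show ?thesis using that by simp
    qed (use EBadj[of v w] EBadj[of w v] parts[of v w] that in \<open>auto simp: insert_commute\<close>)
    have "\<phi> ` e \<in> edges (join (disjoint_union F (edgeless_graph t)) (turan_graph (p - 1) ((p - 1) * t)))"
      using \<phi>(2) e by blast
    then consider d where "d \<in> edges F" "\<phi> ` e = Inl ` Inl ` d"
      | i j where "i mod (p - 1) \<noteq> j mod (p - 1)" "\<phi> ` e = {Inr i, Inr j}"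
      | x y where "\<phi> ` e = {Inl x, Inr y}"
      by (auto simp: join_def disjoint_union_def edgeless_graph_def turan_graph_def)
    then have "{\<Phi> v, \<Phi> w} \<in> edges L"
    proof cases
      case 1
      have "\<phi> v \<in> Inl ` Inl ` d" "\<phi> w \<in> Inl ` Inl ` d" using 1(2) vw by auto
      then obtain a a' where a: "\<phi> v = Inl (Inl a)" "\<phi> w = Inl (Inl a')" "a \<in> d" "a' \<in> d" by blast
      have "\<phi> ` e = Inl ` Inl ` {a, a'}" using vw a by simp
      then have d: "d = {a, a'}" using 1(2) by (metis inj_Inl inj_image_eq_iff)
      have inU: "inU v \<longleftrightarrow> a \<in> U" "inU w \<longleftrightarrow> a' \<in> U" using a by (auto simp: inU_def)
      have "d \<inter> U \<noteq> {}" using U 1(1) by (auto simp: covering_def)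
      then consider "a \<in> U" "a' \<in> U" | "inU v" "\<not> inU w" | "inU w" "\<not> inU v" using d inU by auto
      then show ?thesis
      proof cases
        case 1
        then have "\<psi> ` d \<in> edges L" using \<psi>e[OF \<open>d \<in> edges F\<close>] d by blast
        then show ?thesis using a d 1 inU by (simp add: \<Phi>_def)
      next
        case 2 then show ?thesis using EBadj vw by blast
      next
        case 3 then show ?thesis using EBadj[of w v] vw by (simp add: insert_commute)
      qed
    next
      case 2
      then have "{\<phi> v, \<phi> w} = {Inr i, Inr j}" using vw by simp
      then have "part v \<noteq> part w" using 2(1) by (auto simp: part_def doubleton_eq_iff)
      then show ?thesis using mixed vw by blast
    next
      case 3
      then have "{\<phi> v, \<phi> w} = {Inl x, Inr y}" using vw by simp
      then have "part v \<noteq> part w" by (auto simp: part_def doubleton_eq_iff)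
      then show ?thesis using mixed vw by blast
    qed
    then show ?thesis using vw by simp
  qed
  show ?thesis unfolding embeds_def using inj sub edge by (intro exI[of _ \<Phi>]) blast
qed

end

section \<open>Decomposition families\<close>

lemma edges_join_disjoint_union:
  "d \<in> edges (join (disjoint_union F K) T) \<longleftrightarrow>
    (\<exists>e\<in>edges F. d = Inl ` Inl ` e) \<or> (\<exists>e\<in>edges K. d = Inl ` Inr ` e) \<or> (\<exists>e\<in>edges T. d = Inr ` e) \<or>
    (\<exists>x y. d = {Inl x, Inr y} \<and> x \<in> verts F <+> verts K \<and> y \<in> verts T)"
  unfolding join_def disjoint_union_def graph.sel Un_iff image_iff[of d] bex_Un bex_simps(7) mem_Collect_eq
  by (simp only: disj_assoc)

lemma join_disjoint_union_edgesI:
  "e \<in> edges F \<Longrightarrow> Inl ` Inl ` e \<in> edges (join (disjoint_union F K) T)"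
  "d \<in> edges T \<Longrightarrow> Inr ` d \<in> edges (join (disjoint_union F K) T)"
  "x \<in> verts F <+> verts K \<Longrightarrow> y \<in> verts T \<Longrightarrow>
    {Inl x, Inr y} \<in> edges (join (disjoint_union F K) T)"
  unfolding edges_join_disjoint_union by metis+

lemma inj_on_map_sum_Plus:
  assumes "inj_on f A" "inj_on g B" shows "inj_on (map_sum f g) (A <+> B)"
proof (rule inj_onI)
  fix x y assume "x \<in> A <+> B" "y \<in> A <+> B" "map_sum f g x = map_sum f g y"
  then show "x = y"
    by (elim PlusE) (simp_all add: inj_on_eq_iff[OF assms(1)] inj_on_eq_iff[OF assms(2)])
qed

lemma verts_join_disjoint_union:
  "verts (join (disjoint_union F K) T) = (verts F <+> verts K) <+> verts T"
  by (simp add: join_def disjoint_union_def)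

lemma embeds_join_left:
  assumes "embeds F F'"
  shows "embeds (join (disjoint_union F K) T) (join (disjoint_union F' K) T)"
proof -
  obtain f where f: "inj_on f (verts F)" "f ` verts F \<subseteq> verts F'" "\<forall>e\<in>edges F. f ` e \<in> edges F'"
    using assms by (auto simp: embeds_def)
  let ?g = "map_sum (map_sum f id) id"
  let ?V = "(verts F <+> verts K) <+> verts T"
  have "inj_on ?g ?V" using f(1) by (intro inj_on_map_sum_Plus) simp_all
  moreover have sub: "?g ` ?V \<subseteq> (verts F' <+> verts K) <+> verts T" using f(2) by auto
  moreover have "?g ` d \<in> edges (join (disjoint_union F' K) T)"
    if "d \<in> edges (join (disjoint_union F K) T)" for d
    using that unfolding edges_join_disjoint_union[of d]
  proof (elim disjE bexE exE conjE)
    fix e assume e: "e \<in> edges F" "d = Inl ` Inl ` e"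
    then have "?g ` d = Inl ` Inl ` f ` e" by (simp add: image_image)
    moreover have "f ` e \<in> edges F'" using f(3) e(1) by blast
    ultimately show ?thesis unfolding edges_join_disjoint_union by metis
  next
    fix e assume e: "e \<in> edges K" "d = Inl ` Inr ` e"
    then have "?g ` d = Inl ` Inr ` e" by (simp add: image_image)
    then show ?thesis unfolding edges_join_disjoint_union using e(1) by metis
  next
    fix e assume e: "e \<in> edges T" "d = Inr ` e"
    then have "?g ` d = Inr ` e" by (simp add: image_image)
    then show ?thesis unfolding edges_join_disjoint_union using e(1) by metis
  next
    fix x y assume e: "d = {Inl x, Inr y}" "x \<in> verts F <+> verts K" "y \<in> verts T"
    then have "?g ` d = {Inl (map_sum f id x), Inr y}" by simp
    moreover have "map_sum f id x \<in> verts F' <+> verts K" using e(2) f(2) by auto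
    ultimately show ?thesis unfolding edges_join_disjoint_union using e(3) by metis
  qed
  ultimately show ?thesis
    unfolding embeds_def verts_join_disjoint_union by (intro exI[of _ ?g] conjI ballI)
qed

lemma decomposes_mono:
  assumes "simple_graph H" "decomposes p H F" "embeds F F'" shows "decomposes p H F'"
  using assms embeds_trans embeds_join_left simple_graphD(2)[OF assms(1)]
  unfolding decomposes_def by meson

text \<open>The family consists of graphs on \<open>nat\<close>, so the descent starts from a copy
  of \<open>F\<close>. A decomposing subgraph with the fewest vertices plus edges is minimal for the
  subgraph relation, isolated vertices included.\<close>

lemma decomposition_family_below:
  fixes F :: "'b graph" and H :: "'a graph"
  assumes H: "simple_graph H" and F: "simple_graph F" "decomposes p H F"
  obtains F' where "F' \<in> decomposition_family p H" "embeds F' F"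
proof -
  obtain F0 :: "nat graph" where F0: "graph_iso F F0" using ex_nat_graph_iso[OF F(1)] by blast
  let ?P = "\<lambda>F'. simple_graph F' \<and> subgraph F' F0 \<and> decomposes p H F'"
  have "?P F0"
    using graph_iso_simple[OF F(1) F0] decomposes_mono[OF H F(2) graph_iso_embeds[OF F0]]
    by (simp add: subgraph_def)
  then obtain F' where F': "?P F'"
      and min: "\<And>M. ?P M \<Longrightarrow> card (verts F') + card (edges F') \<le> card (verts M) + card (edges M)"
    using ex_has_least_nat[of ?P F0 "\<lambda>M. card (verts M) + card (edges M)"] by blast
  have "M = F'" if M: "simple_graph M" "subgraph M F'" "decomposes p H M" for M
  proof -
    have sub: "verts M \<subseteq> verts F'" "edges M \<subseteq> edges F'" using M(2) by (auto simp: subgraph_def)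
    then have "?P M" using M F' by (auto simp: subgraph_def)
    then have "card (verts F') + card (edges F') \<le> card (verts M) + card (edges M)" by (rule min)
    moreover have fin: "finite (verts F')" "finite (edges F')"
      using F' simple_graphD(1) finite_edges by blast+
    then have "card (verts M) \<le> card (verts F')" "card (edges M) \<le> card (edges F')"
      using sub by (auto intro: card_mono)
    ultimately have "card (verts M) = card (verts F')" "card (edges M) = card (edges F')" by linarith+
    then have "verts M = verts F'" "edges M = edges F'" using sub fin card_subset_eq by blast+
    then show ?thesis by (simp add: graph.expand)
  qed
  then have "F' \<in> decomposition_family p H" using F' by (auto simp: decomposition_family_def)
  moreover have "embeds F' F"
    using embeds_trans[OF subgraph_embeds graph_iso_embeds[OF graph_iso_sym[OF F(1) F0]]]
      F' simple_graphD(2) by blast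
  ultimately show thesis by (rule that)
qed

text \<open>Together with the converse below, bipartite graphs are those with an independent
  covering, so \<open>q_graph\<close> is a true minimum on the members that \<open>q_family\<close>
  inspects.\<close>

lemma independent_covering_bipartition:
  assumes "simple_graph F" "independent_covering F U" shows "bipartition F U (verts F - U)"
proof -
  have "\<not> e \<subseteq> verts F - U" if "e \<in> edges F" for e
    using assms that by (auto simp: independent_covering_def covering_def)
  then show ?thesis
    using assms by (auto simp: bipartition_def independent_covering_def independent_def)
qed

lemma bipartition_independent_covering:
  assumes "simple_graph F" "bipartition F U U'" shows "independent_covering F U"
proof -
  have "e \<inter> U \<noteq> {}" if e: "e \<in> edges F" for e
  proof
    assume "e \<inter> U = {}"
    then have "e \<subseteq> U'" using simple_graphD(2)[OF assms(1) e] assms(2) by (auto simp: bipartition_def)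
    then show False using assms(2) e by (auto simp: bipartition_def independent_def)
  qed
  then show ?thesis
    using assms(2) by (auto simp: bipartition_def independent_covering_def covering_def)
qed

lemma q_family_le:
  assumes "F \<in> decomposition_family p H" "independent_covering F U"
  shows "q_family (decomposition_family p H) \<le> card U"
proof -
  have "bipartite F"
    using assms independent_covering_bipartition
    by (auto simp: bipartite_def decomposition_family_def)
  then have "q_family (decomposition_family p H) \<le> q_graph F"
    unfolding q_family_def using assms(1) by (intro Least_le) blast
  also have "q_graph F \<le> card U" unfolding q_graph_def using assms(2) by (intro Least_le) blast
  finally show ?thesis .
qed

text \<open>\<open>q_family\<close> nests two \<open>LEAST\<close> operators, which carry
  information only if something satisfies them; the given \<open>F\<close> and \<open>U\<close>
  provide this.\<close>

lemma q_family_attained: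
  assumes "F \<in> decomposition_family p H" "independent_covering F U"
  obtains F' S where "F' \<in> decomposition_family p H" "bipartite F'" "independent_covering F' S"
    "card S = q_family (decomposition_family p H)"
proof -
  let ?M = "decomposition_family p H"
  have "bipartite F"
    using assms independent_covering_bipartition
    by (auto simp: bipartite_def decomposition_family_def)
  then have "\<exists>m. \<exists>F\<in>?M. bipartite F \<and> q_graph F = m" using assms(1) by blast
  then have "\<exists>F\<in>?M. bipartite F \<and> q_graph F = q_family ?M"
    unfolding q_family_def by (rule LeastI_ex)
  then obtain F' where F': "F' \<in> ?M" "bipartite F'" "q_graph F' = q_family ?M" by blast
  obtain A A' where "bipartition F' A A'" using F'(2) by (auto simp: bipartite_def)
  then have "independent_covering F' A"
    using bipartition_independent_covering F'(1) by (auto simp: decomposition_family_def)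
  then have "\<exists>m U. independent_covering F' U \<and> card U = m" by blast
  then have "\<exists>U. independent_covering F' U \<and> card U = q_graph F'"
    unfolding q_graph_def by (rule LeastI_ex)
  then show thesis using that F' by metis
qed

section \<open>Independent sets of the bipartite graph and the parameters of its family\<close>

locale edge_blowup_setting =
  fixes G :: "'a graph" and P P' :: "'a set" and p :: nat
  assumes G: "simple_graph G" and bip: "bipartition G P P'" and ne: "edges G \<noteq> {}" and p: "p \<ge> 3"
begin

abbreviation H where "H \<equiv> edge_blowup G (p + 1)"
abbreviation \<M> where "\<M> \<equiv> decomposition_family p H"
abbreviation q where "q \<equiv> q_family \<M>"

definition uncovered :: "'a set \<Rightarrow> 'a set set" where
  "uncovered S0 = {e \<in> edges G. e \<inter> S0 = {}}"

definition cost :: "'a set \<Rightarrow> nat" where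
  "cost S0 = card S0 + card (uncovered S0)"

text \<open>One constant for both kinds of embedding: slots for the vertices and edges of
  \<open>G\<close> in every core, and slots for all of \<open>H\<close> in
  \<open>embed_decomposition\<close>.\<close>

definition size_bound :: nat where
  "size_bound = card (verts G) + card (edges G) + card (verts H)"

lemma H: "simple_graph H" by (rule simple_edge_blowup[OF G])

lemma finite_uncovered: "finite (uncovered S0)"
  using finite_edges[OF G] by (simp add: uncovered_def)

lemma \<M>_simple: "F \<in> \<M> \<Longrightarrow> simple_graph F"
  by (simp add: decomposition_family_def)

lemma \<M>_decomposes: "F \<in> \<M> \<Longrightarrow> decomposes p H F"
  by (simp add: decomposition_family_def)

text \<open>The side of size \<open>cost S0\<close> serves as the set of apices, the other side as
  one core, and the Turan graph supplies the remaining p - 1 cores. With as many apices as the cost,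
  no edge inside a class is required.\<close>

lemma decomposes_complete_bipartite:
  assumes S0: "independent G S0"
  defines "w \<equiv> card (verts G) + card (edges G) + 2 * card (edges G) * 1"
  shows "decomposes p H (Graph {..<cost S0 + w} {{i, j} | i j. i < cost S0 \<and> cost S0 \<le> j \<and> j < cost S0 + w})"
    (is "decomposes p H ?F")
proof -
  define c where "c = cost S0"
  let ?L = "join (disjoint_union ?F (edgeless_graph w)) (turan_graph (p - 1) ((p - 1) * w))"
  define E where "E = (Inl ` Inl ` {..<c} :: ((nat + nat) + nat) set)"
  define B where "B i = (if i = 0 then Inl ` Inl ` {c..<c + w}
    else Inr ` ((\<lambda>a. (p - 1) * a + (i - 1)) ` {..<w}) :: ((nat + nat) + nat) set)" for i :: nat
  define R where "R = (\<Union>i<p. B i)"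
  define \<kappa> where "\<kappa> x = (case x of Inl _ \<Rightarrow> 0 | Inr j \<Rightarrow> Suc (j mod (p - 1)))"
    for x :: "(nat + nat) + nat"
  have simple: "simple_graph ?L"
  proof -
    have "card {Inl x, Inr y} = 2" for x :: "nat + nat" and y :: nat by simp
    moreover have "card (Inl ` Inl ` {i, j} :: ((nat + nat) + nat) set) = 2" if "i \<noteq> j" for i j :: nat
      using that by simp
    moreover have "card {Inr i, Inr j :: (nat + nat) + nat} = 2" if "i mod d \<noteq> j mod d" for i j d :: nat
      using that by (metis card_2_iff sum.inject(2))
    ultimately show ?thesis
      by (auto simp: simple_graph_def join_def disjoint_union_def edgeless_graph_def turan_graph_def)
  qed
  have mod_small: "((p - 1) * a + (i - 1)) mod (p - 1) = i - 1" if "i < p" "i \<noteq> 0" for a i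
  proof -
    have "i - 1 < p - 1" using that by simp
    then show ?thesis by (simp only: mod_mult_self4 mod_less)
  qed
  have bound: "(p - 1) * a + (i - 1) < (p - 1) * w" if "i < p" "i \<noteq> 0" "a < w" for a i
  proof -
    have "(p - 1) * Suc a \<le> (p - 1) * w" using that by (intro mult_le_mono2) simp
    moreover have "i - 1 < p - 1" using that by simp
    ultimately show ?thesis by simp
  qed
  have EV: "E \<subseteq> verts ?L" by (auto simp: E_def c_def join_def disjoint_union_def)
  have BV: "B i \<subseteq> verts ?L" if "i < p" for i
    using bound[of i] that
    by (auto simp: B_def c_def join_def disjoint_union_def turan_graph_def)
  have B\<kappa>: "\<kappa> x = i" if "i < p" "x \<in> B i" for x i
    using that mod_small[of i] by (auto simp: B_def \<kappa>_def split: if_splits)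
  have cB: "card (B i) = w" if "i < p" for i
  proof (cases "i = 0")
    case True then show ?thesis by (simp add: B_def card_image)
  next
    case False
    have "inj_on (\<lambda>a. (p - 1) * a + (i - 1)) {..<w}" using p by (auto simp: inj_on_def)
    then show ?thesis using False by (simp add: B_def card_image)
  qed
  have BB: "{x, y} \<in> edges ?L" if ij: "i < p" "j < p" "i \<noteq> j" "x \<in> B i" "y \<in> B j" for i j x y
  proof -
    have zero: "{x, y} \<in> edges ?L" if j: "j < p" "j \<noteq> 0" "x \<in> B 0" "y \<in> B j" for x y j
    proof -
      obtain b where b: "x = Inl (Inl b)" "c \<le> b" "b < c + w" using j(3) by (auto simp: B_def)
      obtain a where a: "y = Inr a" using j(2,4) by (auto simp: B_def)
      have "Inl b \<in> verts ?F <+> verts (edgeless_graph w)"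
        using b by (auto simp: c_def)
      moreover have "a \<in> verts (turan_graph (p - 1) ((p - 1) * w))"
        using BV[OF j(1)] j(4) a by (auto simp: join_def)
      ultimately show ?thesis unfolding a b(1) by (rule join_disjoint_union_edgesI(3))
    qed
    consider "i = 0" | "j = 0" | "i \<noteq> 0" "j \<noteq> 0" by blast
    then show ?thesis
    proof cases
      case 1 then show ?thesis using zero[of j x y] ij by simp
    next
      case 2 then show ?thesis using zero[of i y x] ij by (simp add: insert_commute)
    next
      case 3
      then obtain a b where a: "x = Inr ((p - 1) * a + (i - 1))" "a < w"
        and b: "y = Inr ((p - 1) * b + (j - 1))" "b < w" using ij by (auto simp: B_def)
      let ?x = "(p - 1) * a + (i - 1)" and ?y = "(p - 1) * b + (j - 1)"
      have "?x mod (p - 1) \<noteq> ?y mod (p - 1)"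
        unfolding mod_small[OF ij(1) 3(1)] mod_small[OF ij(2) 3(2)] using ij(3) 3 by simp
      then have "{?x, ?y} \<in> edges (turan_graph (p - 1) ((p - 1) * w))"
        using bound[OF ij(1) 3(1) a(2)] bound[OF ij(2) 3(2) b(2)]
        by (simp only: turan_graph_def graph.sel) blast
      then have "Inr ` {?x, ?y} \<in> edges ?L" by (rule join_disjoint_union_edgesI(2))
      then show ?thesis using a b by simp
    qed
  qed
  have EB: "{x, y} \<in> edges ?L" if i: "i < p" "x \<in> E" "y \<in> B i" for i x y
  proof (cases "i = 0")
    case True
    then obtain a b where ab: "x = Inl (Inl a)" "a < c" "y = Inl (Inl b)" "c \<le> b" "b < c + w"
      using i by (auto simp: E_def B_def)
    then have "{a, b} \<in> edges ?F" by (auto simp: c_def)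
    then have "Inl ` Inl ` {a, b} \<in> edges ?L" by (rule join_disjoint_union_edgesI(1))
    then show ?thesis using ab by simp
  next
    case False
    obtain a where a: "x = Inl (Inl a)" "a < c" using i(2) by (auto simp: E_def)
    obtain b where b: "y = Inr b" using i(3) False by (auto simp: B_def)
    have "Inl a \<in> verts ?F <+> verts (edgeless_graph w)"
      using a by (auto simp: c_def)
    moreover have "b \<in> verts (turan_graph (p - 1) ((p - 1) * w))"
      using BV[OF i(1)] i(3) b by (auto simp: join_def)
    ultimately show ?thesis unfolding a(1) b by (rule join_disjoint_union_edgesI(3))
  qed
  \<comment> \<open>Nothing is missing between different cores, so the least admissible value 1 of
    \<open>l\<close> will do; it is the factor 1 in the last summand of \<open>w\<close>.\<close>
  interpret configuration ?L p E B R \<kappa> w 1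
  proof
    show "simple_graph ?L" by fact
    show "E \<subseteq> verts ?L" by fact
    show "R \<subseteq> verts ?L" using BV by (auto simp: R_def)
    show "E \<inter> R = {}" by (auto simp: E_def R_def B_def split: if_splits)
    show "\<kappa> ` R \<subseteq> {..<p}" using B\<kappa> by (auto simp: R_def)
    show "complete_parts ?L p B" using BV BB unfolding complete_parts_def by blast
    show "B i \<subseteq> R" if "i < p" for i using that by (auto simp: R_def)
    show "\<kappa> x = i" if "i < p" "x \<in> B i" for i x using B\<kappa> that by blast
    show "w \<le> card (B i)" if "i < p" for i using cB that by simp
    show "{x, y} \<in> edges ?L" if "i < p" "x \<in> E" "y \<in> B i" for i x y using EB that by blast
    show "card (B j - neighbours ?L x) \<le> 1" if xj: "x \<in> R" "j < p" "j \<noteq> \<kappa> x" for x j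
    proof -
      obtain i where "i < p" "x \<in> B i" using xj(1) by (auto simp: R_def)
      then have "B j - neighbours ?L x = {}"
        using BB[of i j x] B\<kappa>[of i x] xj(2,3) by (auto simp: neighbours_def)
      then show ?thesis by (simp only: card.empty zero_le)
    qed
  qed simp
  have cE: "card E = c" by (simp add: E_def card_image)
  have "embeds H ?L"
  proof (rule embed_matching[OF G bip p S0, where W = "{}" and i = 0])
    show "card S0 \<le> card E" "card S0 + card {e \<in> edges G. e \<inter> S0 = {}} \<le> card E + card {}"
      by (simp_all add: cE c_def cost_def uncovered_def)
    show "card (verts G) + card (edges G) + 2 * card (edges G) * 1 \<le> w" by (simp add: w_def)
  qed (use p in auto)
  then show ?thesis unfolding decomposes_def by blast
qed

text \<open>A member found inside the complete bipartite graph inherits its bipartition; the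
  vertices sent to the side of size \<open>cost S0\<close> form the covering.\<close>

lemma ex_family_covering:
  assumes S0: "independent G S0"
  obtains F U where "F \<in> \<M>" "independent_covering F U" "card U \<le> cost S0"
proof -
  define w where "w = card (verts G) + card (edges G) + 2 * card (edges G) * 1"
  let ?c = "cost S0"
  let ?F = "Graph {..<?c + w} {{i, j} | i j. i < ?c \<and> ?c \<le> j \<and> j < ?c + w}"
  have dec: "decomposes p H ?F" unfolding w_def by (rule decomposes_complete_bipartite[OF S0])
  have "simple_graph ?F" by (auto simp: simple_graph_def)
  then obtain F where F: "F \<in> \<M>" "embeds F ?F"
    using decomposition_family_below[OF H _ dec] by blast
  obtain f where f: "inj_on f (verts F)" "\<forall>e\<in>edges F. f ` e \<in> edges ?F"
    using F(2) by (auto simp: embeds_def)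
  define U where "U = {u \<in> verts F. f u < ?c}"
  have "e \<inter> U \<noteq> {} \<and> \<not> e \<subseteq> U" if e: "e \<in> edges F" for e
  proof -
    obtain i j where ij: "f ` e = {i, j}" "i < ?c" "?c \<le> j" using f(2) e by auto
    then obtain a b where ab: "a \<in> e" "f a = i" "b \<in> e" "f b = j" by (metis imageE insertI1 insertI2)
    then have "a \<in> U" "b \<notin> U"
      using ij simple_graphD(2)[OF \<M>_simple[OF F(1)] e] by (auto simp: U_def)
    then show ?thesis using ab by blast
  qed
  then have "independent_covering F U"
    by (auto simp: independent_covering_def independent_def covering_def U_def)
  moreover have "card U \<le> card {..<?c}"
    using f(1) by (intro card_inj_on_le[of f]) (auto simp: U_def inj_on_def)
  ultimately show thesis using that F(1) by simp
qed

lemma q_le_cost: "independent G S0 \<Longrightarrow> q \<le> cost S0"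
  using ex_family_covering q_family_le by (metis le_trans)

text \<open>An embedding is read backwards. The Turan graph has only p - 1 parts, so every clique
  leaves an edge in \<open>F\<close>, and \<open>S\<close> meets it. If neither end of
  \<open>e\<close> lies over \<open>S\<close>, then a new vertex of its clique does, and these
  differ for different edges; so \<open>S\<close> has room for \<open>S0\<close> and for all
  uncovered edges.\<close>

lemma covering_pullback:
  fixes F :: "'b graph"
  assumes F: "simple_graph F" and dec: "decomposes p H F" and S: "independent_covering F S"
  obtains S0 where "independent G S0" "cost S0 \<le> card S"
    "cost S0 = card S \<longrightarrow> uncovered S0 = {} \<longrightarrow> (\<forall>x\<in>S. \<exists>x0\<in>S0. degree G x0 \<le> degree F x)"
proof -
  obtain t \<phi> where \<phi>: "inj_on \<phi> (verts H)"
    "\<forall>e\<in>edges H. \<phi> ` e \<in> edges (join (disjoint_union F (edgeless_graph t))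
        (turan_graph (p - 1) ((p - 1) * t)))" (is "\<forall>e\<in>_. _ \<in> edges ?L")
    using dec by (auto simp: decomposes_def embeds_def)
  have SV: "S \<subseteq> verts F" and finS: "finite S"
    using S simple_graphD(1)[OF F] finite_subset
    by (auto simp: independent_covering_def covering_def)
  define S0 where "S0 = {v \<in> verts G. \<exists>s\<in>S. \<phi> (Inl v) = Inl (Inl s)}"
  have cliqueV: "blowup_clique (p + 1) e \<subseteq> verts H" if "e \<in> edges G" for e
    using that by (auto simp: edge_blowup_def)
  have cliqueE: "{a, b} \<in> edges H" if "e \<in> edges G" "a \<in> blowup_clique (p + 1) e"
    "b \<in> blowup_clique (p + 1) e" "a \<noteq> b" for e a b
    using that by (auto simp: edge_blowup_def)
  have clique_card: "card (blowup_clique (p + 1) e) = p + 1" "finite (blowup_clique (p + 1) e)"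
    if "e \<in> edges G" for e
  proof -
    have "card e = 2" "finite e" using simple_graphD(3,4)[OF G that] .
    moreover have "card (Inr ` ({e} \<times> {..<p + 1 - 2}) :: ('a + 'a set \<times> nat) set) = p - 1"
      by (simp add: card_image card_cartesian_product)
    moreover have "card (Inl ` e :: ('a + 'a set \<times> nat) set) = card e" by (simp add: card_image)
    moreover have "Inl ` e \<inter> Inr ` ({e} \<times> {..<p + 1 - 2}) = ({} :: ('a + 'a set \<times> nat) set)" by blast
    ultimately show "card (blowup_clique (p + 1) e) = p + 1" "finite (blowup_clique (p + 1) e)"
      unfolding blowup_clique_def using p by (simp_all add: card_Un_disjoint)
  qed
  have VH: "Inl v \<in> verts H" if "v \<in> verts G" for v using that by (auto simp: edge_blowup_def)
  have inl: "{u, w} \<in> edges F" if "{a, b} \<in> edges H" "\<phi> a = Inl (Inl u)" "\<phi> b = Inl (Inl w)" for a b u w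
  proof -
    have "\<phi> ` {a, b} \<in> edges ?L" using \<phi>(2) that(1) by blast
    then have "Inl ` Inl ` {u, w} \<in> edges ?L" using that by simp
    then obtain d where "d \<in> edges F" "Inl ` Inl ` {u, w} = (Inl ` Inl ` d :: (('b + nat) + nat) set)"
      unfolding edges_join_disjoint_union by (auto simp: edgeless_graph_def)
    then show ?thesis by (simp only: inj_image_eq_iff[OF inj_Inl])
  qed
  have inl_inl: "\<exists>u w. \<phi> a = Inl (Inl u) \<and> \<phi> b = Inl (Inl w)"
    if "{a, b} \<in> edges H" "\<phi> a = Inl x" "\<phi> b = Inl y" for a b x y
  proof -
    have "\<phi> ` {a, b} \<in> edges ?L" using \<phi>(2) that(1) by blast
    then have "{Inl x, Inl y} \<in> edges ?L" using that by simp
    then obtain d where "d \<in> edges F" "{Inl x, Inl y} = (Inl ` Inl ` d :: (('b + nat) + nat) set)"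
      unfolding edges_join_disjoint_union by (auto simp: edgeless_graph_def)
    then have "Inl x \<in> (Inl ` Inl ` d :: (('b + nat) + nat) set)"
      "Inl y \<in> (Inl ` Inl ` d :: (('b + nat) + nat) set)" by blast+
    then show ?thesis using that by auto
  qed
  \<comment> \<open>Pigeonhole on p - 1 residue classes. Asking only for p of the p + 1 clique
    vertices allows a second application after one vertex has been removed.\<close>
  have some_inl: "\<exists>b\<in>D. \<exists>z. \<phi> b = Inl z"
    if D: "e \<in> edges G" "D \<subseteq> blowup_clique (p + 1) e" "p \<le> card D" for e D
  proof (rule ccontr)
    assume no: "\<not> (\<exists>b\<in>D. \<exists>z. \<phi> b = Inl z)"
    then have inr: "\<exists>j. \<phi> b = Inr j" if "b \<in> D" for b using that by (metis sum.exhaust)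
    define \<rho> where "\<rho> b = projr (\<phi> b) mod (p - 1)" for b
    have "inj_on \<rho> D"
    proof (rule inj_onI, rule ccontr)
      fix a b assume ab: "a \<in> D" "b \<in> D" "\<rho> a = \<rho> b" "a \<noteq> b"
      then have "{a, b} \<in> edges H" using cliqueE D by blast
      then have "\<phi> ` {a, b} \<in> edges ?L" using \<phi>(2) by blast
      moreover obtain i j where ij: "\<phi> a = Inr i" "\<phi> b = Inr j" using inr ab by metis
      ultimately have "{Inr i, Inr j} \<in> edges ?L" by simp
      then obtain d where d: "d \<in> edges (turan_graph (p - 1) ((p - 1) * t))"
        "{Inr i, Inr j} = (Inr ` d :: (('b + nat) + nat) set)"
        unfolding edges_join_disjoint_union by fast
      then obtain k l where kl: "d = {k, l}" "k mod (p - 1) \<noteq> l mod (p - 1)"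
        by (auto simp: turan_graph_def)
      then have "{Inr i, Inr j} = ({Inr k, Inr l} :: (('b + nat) + nat) set)" using d by simp
      then have "i mod (p - 1) \<noteq> j mod (p - 1)" using kl by (auto simp: doubleton_eq_iff)
      then show False using ab(3) ij by (simp add: \<rho>_def)
    qed
    moreover have "\<rho> ` D \<subseteq> {..<p - 1}" using p by (auto simp: \<rho>_def)
    ultimately have "card D \<le> card {..<p - 1}" by (intro card_inj_on_le) auto
    then show False using D(3) p by simp
  qed
  have indep: "independent G S0"
  proof -
    have "\<not> e \<subseteq> S0" if e: "e \<in> edges G" for e
    proof
      assume "e \<subseteq> S0"
      obtain u v where uv: "e = {u, v}" "u \<noteq> v" using simple_graph_edgeE[OF G e] by metis
      then obtain s s' where s: "s \<in> S" "s' \<in> S" "\<phi> (Inl u) = Inl (Inl s)" "\<phi> (Inl v) = Inl (Inl s')"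
        using \<open>e \<subseteq> S0\<close> by (auto simp: S0_def)
      have "{Inl u, Inl v} \<in> edges H"
        using cliqueE[OF e, of "Inl u" "Inl v"] uv by (auto simp: blowup_clique_def)
      then have "{s, s'} \<in> edges F" using inl s by blast
      then show False using S s by (auto simp: independent_covering_def independent_def)
    qed
    then show ?thesis by (auto simp: independent_def S0_def)
  qed
  have unc: "\<exists>i s. s \<in> S \<and> Inr (e, i) \<in> verts H \<and> \<phi> (Inr (e, i)) = Inl (Inl s)"
    if e: "e \<in> uncovered S0" for e
  proof -
    have eG: "e \<in> edges G" using e by (simp add: uncovered_def)
    let ?C = "blowup_clique (p + 1) e"
    obtain a x where a: "a \<in> ?C" "\<phi> a = Inl x"
      using some_inl[OF eG order_refl] clique_card[OF eG] by auto
    have "p \<le> card (?C - {a})" using clique_card[OF eG] a by simp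
    then obtain b y where b: "b \<in> ?C" "b \<noteq> a" "\<phi> b = Inl y"
      using some_inl[OF eG, of "?C - {a}"] by blast
    have ab: "{a, b} \<in> edges H" using cliqueE[OF eG] a b by metis
    then obtain u w where uw: "\<phi> a = Inl (Inl u)" "\<phi> b = Inl (Inl w)" using inl_inl a b by metis
    then have "{u, w} \<in> edges F" using inl ab by blast
    then have "u \<in> S \<or> w \<in> S" using S by (auto simp: independent_covering_def covering_def)
    then obtain d s where d: "d \<in> ?C" "\<phi> d = Inl (Inl s)" "s \<in> S" using uw a b by metis
    have "d \<noteq> Inl v" if "v \<in> e" for v
      using d that e simple_graphD(2)[OF G eG] by (auto simp: uncovered_def S0_def)
    then obtain i where "d = Inr (e, i)" using d(1) by (auto simp: blowup_clique_def)
    then show ?thesis using d cliqueV[OF eG] by blast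
  qed
  then obtain I T where IT: "\<And>e. e \<in> uncovered S0 \<Longrightarrow>
      T e \<in> S \<and> Inr (e, I e) \<in> verts H \<and> \<phi> (Inr (e, I e)) = Inl (Inl (T e))" by metis
  have "\<exists>s. v \<in> S0 \<longrightarrow> s \<in> S \<and> \<phi> (Inl v) = Inl (Inl s)" for v by (auto simp: S0_def)
  then obtain T0 where T0: "\<And>v. v \<in> S0 \<Longrightarrow> T0 v \<in> S \<and> \<phi> (Inl v) = Inl (Inl (T0 v))" by metis
  define \<Psi> where "\<Psi> = case_sum T0 T"
  define D where "D = S0 <+> uncovered S0"
  have S0V: "S0 \<subseteq> verts G" by (auto simp: S0_def)
  then have finS0: "finite S0" using simple_graphD(1)[OF G] finite_subset by blast
  have cD: "card D = cost S0" using finS0 finite_uncovered by (simp add: D_def cost_def card_Plus)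
  define lift where "lift x = (case x of Inl v \<Rightarrow> Inl v | Inr e \<Rightarrow> Inr (e, I e))" for x :: "'a + 'a set"
  have lift: "lift x \<in> verts H \<and> \<phi> (lift x) = Inl (Inl (\<Psi> x)) \<and> \<Psi> x \<in> S" if "x \<in> D" for x
    using that IT T0 VH S0V by (auto simp: D_def lift_def \<Psi>_def)
  have "inj_on lift D" by (auto simp: inj_on_def lift_def split: sum.splits)
  have "inj_on \<Psi> D"
  proof (rule inj_onI)
    fix x y assume xy: "x \<in> D" "y \<in> D" "\<Psi> x = \<Psi> y"
    then have "\<phi> (lift x) = \<phi> (lift y)" using lift by simp
    then have "lift x = lift y" using \<phi>(1) lift xy by (meson inj_onD)
    then show "x = y" using \<open>inj_on lift D\<close> xy by (meson inj_onD)
  qed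
  moreover have "\<Psi> ` D \<subseteq> S" using lift by blast
  ultimately have le: "card D \<le> card S" using finS by (intro card_inj_on_le)
  \<comment> \<open>With equality and nothing uncovered, \<open>S\<close> consists of images of
    vertices of \<open>G\<close>. So \<open>x\<close> comes from some \<open>x0\<close>, and the
    clique of every edge at \<open>x0\<close> contributes an edge of \<open>F\<close> at
    \<open>x\<close>.\<close>
  have deg: "\<exists>x0\<in>S0. degree G x0 \<le> degree F x"
    if eq: "cost S0 = card S" and unc: "uncovered S0 = {}" and x: "x \<in> S" for x
  proof -
    have "card (\<Psi> ` D) = card S" using \<open>inj_on \<Psi> D\<close> eq cD by (simp add: card_image)
    then have "\<Psi> ` D = S" using \<open>\<Psi> ` D \<subseteq> S\<close> finS by (intro card_subset_eq)
    then obtain x0 where x0: "x0 \<in> S0" "\<phi> (Inl x0) = Inl (Inl x)"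
      using x unc T0 by (auto simp: D_def \<Psi>_def)
    have "\<exists>b w. b \<in> blowup_clique (p + 1) e \<and> b \<noteq> Inl x0 \<and> \<phi> b = Inl (Inl w) \<and> {x, w} \<in> edges F"
      if e: "e \<in> edges G" "x0 \<in> e" for e
    proof -
      let ?C = "blowup_clique (p + 1) e"
      have xC: "Inl x0 \<in> ?C" using e(2) by (auto simp: blowup_clique_def)
      then have "p \<le> card (?C - {Inl x0})" using clique_card[OF e(1)] by simp
      then obtain b y where b: "b \<in> ?C" "b \<noteq> Inl x0" "\<phi> b = Inl y"
        using some_inl[OF e(1), of "?C - {Inl x0}"] by blast
      have ab: "{Inl x0, b} \<in> edges H" using cliqueE[OF e(1) xC b(1)] b(2) by metis
      then obtain w where "\<phi> b = Inl (Inl w)" using inl_inl[OF ab x0(2) b(3)] by blast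
      then show ?thesis using inl[OF ab x0(2)] b by blast
    qed
    then obtain b w where bw: "\<And>e. e \<in> edges G \<Longrightarrow> x0 \<in> e \<Longrightarrow> b e \<in> blowup_clique (p + 1) e \<and>
        b e \<noteq> Inl x0 \<and> \<phi> (b e) = Inl (Inl (w e)) \<and> {x, w e} \<in> edges F" by metis
    \<comment> \<open>As \<open>G\<close> is simple, cliques of different edges at \<open>x0\<close>
      share nothing but \<open>x0\<close>, so the chosen second vertices are distinct.\<close>
    have "inj_on (\<lambda>e. {x, w e}) {e \<in> edges G. x0 \<in> e}"
    proof (rule inj_onI, rule ccontr)
      fix e e' assume e: "e \<in> {e \<in> edges G. x0 \<in> e}" "e' \<in> {e \<in> edges G. x0 \<in> e}"
        and eq: "{x, w e} = {x, w e'}" and ne: "e \<noteq> e'"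
      have "w e = w e'" using eq by (auto simp: doubleton_eq_iff)
      then have "\<phi> (b e) = \<phi> (b e')" using bw e by simp
      moreover have "b e \<in> verts H" "b e' \<in> verts H" using bw e cliqueV by blast+
      ultimately have "b e = b e'" by (rule inj_onD[OF \<phi>(1)])
      then have mem: "b e \<in> blowup_clique (p + 1) e" "b e \<in> blowup_clique (p + 1) e'" "b e \<noteq> Inl x0"
        using bw[of e] bw[of e'] e by auto
      obtain v where v: "v \<in> e" "v \<in> e'" "v \<noteq> x0"
      proof (cases "b e")
        case (Inl v)
        then have "v \<in> e" "v \<in> e'" "v \<noteq> x0" using mem by (auto simp: blowup_clique_def)
        then show thesis by (rule that)
      next
        case (Inr z)
        then have "fst z = e" "fst z = e'" using mem(1,2) by (auto simp: blowup_clique_def)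
        then show thesis using ne by simp
      qed
      have "d = {x0, v}" if d: "d \<in> edges G" "x0 \<in> d" "v \<in> d" for d
      proof -
        obtain a c where "d = {a, c}" using simple_graph_edgeE[OF G d(1)] by metis
        then show ?thesis using d v(3) by auto
      qed
      then show False using ne e v by blast
    qed
    moreover have "(\<lambda>e. {x, w e}) ` {e \<in> edges G. x0 \<in> e} \<subseteq> {e \<in> edges F. x \<in> e}" using bw by auto
    ultimately have "degree G x0 \<le> degree F x"
      unfolding degree_def using finite_edges[OF F] by (intro card_inj_on_le) auto
    then show ?thesis using x0 by blast
  qed
  show thesis
  proof (rule that[OF indep])
    show "cost S0 \<le> card S" using le cD by simp
    show "cost S0 = card S \<longrightarrow> uncovered S0 = {} \<longrightarrow> (\<forall>x\<in>S. \<exists>x0\<in>S0. degree G x0 \<le> degree F x)"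
      using deg by simp
  qed
qed

lemma \<S>_family_nonempty:
  obtains F S where "F \<in> \<M>" "bipartite F" "independent_covering F S" "card S = q"
proof -
  have "{} \<notin> edges G" using simple_graphD(3)[OF G, of "{}"] by auto
  then have "independent G {}" by (auto simp: independent_def)
  then obtain F U where F: "F \<in> \<M>" "independent_covering F U" by (rule ex_family_covering)
  show thesis using q_family_attained[OF F] that by blast
qed

lemma q_pos: "1 \<le> q"
proof -
  obtain F S where F: "F \<in> \<M>" "independent_covering F S" "card S = q"
    using \<S>_family_nonempty by metis
  then obtain S0 where S0: "independent G S0" "cost S0 \<le> q"
    using covering_pullback[OF \<M>_simple[OF F(1)] \<M>_decomposes[OF F(1)] F(2)] F(3) by metis
  have "cost S0 \<noteq> 0"
  proof
    assume "cost S0 = 0"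
    then have "card S0 = 0" "card (uncovered S0) = 0" by (auto simp: cost_def)
    moreover have "finite S0"
      using S0(1) simple_graphD(1)[OF G] finite_subset by (auto simp: independent_def)
    ultimately have "S0 = {}" "uncovered S0 = {}" using finite_uncovered by auto
    then show False using ne by (auto simp: uncovered_def)
  qed
  then show ?thesis using S0(2) by simp
qed

text \<open>A pair of \<open>S_family\<close> attaining the minimum degree is pulled back. By
  \<open>q_le_cost\<close> the result cannot be cheaper than \<open>q\<close>, so equality holds and
  the degree statement applies whenever nothing is uncovered.\<close>

lemma optimal_independent_set:
  obtains S0 where "independent G S0" "cost S0 = q"
    "uncovered S0 \<noteq> {} \<or> (\<exists>x0\<in>S0. degree G x0 \<le> k_family \<M>)"
proof -
  obtain F S where F: "F \<in> \<M>" "bipartite F" "independent_covering F S" "card S = q"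
    using \<S>_family_nonempty by metis
  then have "(F, S) \<in> S_family \<M>" by (simp add: S_family_def)
  moreover obtain x where "x \<in> S" using F(4) q_pos by fastforce
  moreover obtain d where "degree F x = d" by blast
  ultimately have "\<exists>(F, S)\<in>S_family \<M>. \<exists>x\<in>S. degree F x = d" by blast
  then have "\<exists>(F, S)\<in>S_family \<M>. \<exists>x\<in>S. degree F x = k_family \<M>"
    unfolding k_family_def
    by (rule LeastI)
  then obtain F S x where FS: "(F, S) \<in> S_family \<M>" "x \<in> S" "degree F x = k_family \<M>" by blast
  then have F: "F \<in> \<M>" "independent_covering F S" "card S = q" by (simp_all add: S_family_def)
  obtain S0 where S0: "independent G S0" "cost S0 \<le> card S"
    "cost S0 = card S \<longrightarrow> uncovered S0 = {} \<longrightarrow> (\<forall>x\<in>S. \<exists>x0\<in>S0. degree G x0 \<le> degree F x)"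
    by (rule covering_pullback[OF \<M>_simple[OF F(1)] \<M>_decomposes[OF F(1)] F(2)])
  have "cost S0 = q" using S0(2) q_le_cost[OF S0(1)] F(3) by simp
  moreover have "uncovered S0 \<noteq> {} \<or> (\<exists>x0\<in>S0. degree G x0 \<le> k_family \<M>)"
    using S0(3) FS(2,3) F(3) calculation by metis
  ultimately show thesis by (rule that[OF S0(1)])
qed

end

section \<open>Large complete multipartite subgraphs\<close>

lemma sum_card_swap:
  assumes "finite A" "finite B"
  shows "(\<Sum>x\<in>A. card {y \<in> B. Q x y}) = (\<Sum>y\<in>B. card {x \<in> A. Q x y})"
proof -
  have "(\<Sum>x\<in>A. card {y \<in> B. Q x y}) = (\<Sum>x\<in>A. \<Sum>y\<in>B. if Q x y then 1 else 0)"
    using assms by (intro sum.cong refl) (simp add: sum.If_cases Int_def)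
  also have "\<dots> = (\<Sum>y\<in>B. \<Sum>x\<in>A. if Q x y then 1 else 0)" by (rule sum.swap)
  also have "\<dots> = (\<Sum>y\<in>B. card {x \<in> A. Q x y})"
    using assms by (intro sum.cong refl) (simp add: sum.If_cases Int_def)
  finally show ?thesis .
qed

text \<open>The minimum degree version of the Erdos-Stone theorem: the vertices outside a complete
  \<open>r\<close>-partite graph with parts of size \<open>2pt\<close> that have \<open>t\<close> neighbours in every part are so many that
  \<open>t\<close> of them have the same neighbourhood in it.\<close>

lemma ex_complete_parts:
  fixes p r t :: nat
  assumes p: "p \<ge> 1" and "r \<le> p"
  shows "\<exists>n0. \<forall>L :: 'b graph. simple_graph L \<and> n0 \<le> card (verts L) \<and>
      (\<forall>x\<in>verts L. p * card (verts L - neighbours L x) \<le> card (verts L) + p) \<longrightarrow>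
      (\<exists>B. complete_parts L r B \<and> (\<forall>i<r. card (B i) = t))"
  using assms(2)
proof (induction r arbitrary: t)
  case 0
  then show ?case by (auto simp: complete_parts_def)
next
  case (Suc r)
  show ?case
  proof (cases "t = 0")
    case True
    have "complete_parts L (Suc r) (\<lambda>_. {})" for L :: "'b graph" by (simp add: complete_parts_def)
    then show ?thesis using True by (intro exI[of _ 0]) (metis card.empty)
  next
    case False
    \<comment> \<open>With this size, a vertex with fewer than t neighbours in some part misses at
      least (2p - 1)t vertices of \<open>K\<close>, whereas double counting allows a total of at
      most (2p - 2)t(n + p) missing pairs on n vertices.\<close>
    define T where "T = 2 * p * t"
    obtain n1 where n1: "\<And>L :: 'b graph. simple_graph L \<Longrightarrow> n1 \<le> card (verts L) \<Longrightarrow>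
        (\<forall>x\<in>verts L. p * card (verts L - neighbours L x) \<le> card (verts L) + p) \<Longrightarrow>
        \<exists>B. complete_parts L r B \<and> (\<forall>i<r. card (B i) = T)"
      using Suc.IH[of T] Suc.prems by auto
    \<comment> \<open>There are at most 2^(rT) possible neighbourhoods in \<open>K\<close>, so more
      than \<open>w0\<close> vertices include t with the same one.\<close>
    define w0 where "w0 = t * 2 ^ (r * T)"
    define n0 where "n0 = n1 + 2 * p * (r * T + w0) + 2 * p * p + 1"
    have "\<exists>B. complete_parts L (Suc r) B \<and> (\<forall>i<Suc r. card (B i) = t)"
      if L: "simple_graph L" and n: "n0 \<le> card (verts L)"
        and deg: "\<forall>x\<in>verts L. p * card (verts L - neighbours L x) \<le> card (verts L) + p"
      for L :: "'b graph"
    proof -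
      obtain B where B: "complete_parts L r B" "\<And>i. i < r \<Longrightarrow> card (B i) = T"
        using n1[OF L _ deg] n by (auto simp: n0_def)
      have finV: "finite (verts L)" using simple_graphD(1)[OF L] .
      have BV: "B i \<subseteq> verts L" if "i < r" for i using B(1) that by (simp add: complete_parts_def)
      have finB: "finite (B i)" if "i < r" for i using BV[OF that] finV finite_subset by blast
      define K where "K = (\<Union>i<r. B i)"
      have KV: "K \<subseteq> verts L" using BV by (auto simp: K_def)
      have finK: "finite K" using KV finV finite_subset by blast
      have cK: "card K = r * T"
        unfolding K_def using finB B complete_parts_disjoint[OF L B(1)]
        by (subst card_UN_disjoint) auto
      define U where "U = verts L - K"
      define W where "W = {x \<in> U. \<forall>i<r. t \<le> card (neighbours L x \<inter> B i)}"
      have finU: "finite U" and WU: "W \<subseteq> U" using finV by (auto simp: U_def W_def)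
      have finW: "finite W" using finU WU finite_subset by blast
      have cU: "card U = card (verts L) - r * T"
        using KV finK cK by (simp add: U_def card_Diff_subset)
      have large: "w0 < card W"
      proof (rule ccontr)
        assume "\<not> w0 < card W"
        then have w: "card W \<le> w0" by simp
        have miss: "T - t \<le> card {y \<in> K. {x, y} \<notin> edges L}" if x: "x \<in> U - W" for x
        proof -
          obtain i where i: "i < r" "card (neighbours L x \<inter> B i) < t"
            using x by (auto simp: W_def not_le)
          have "card (B i) = card (neighbours L x \<inter> B i) + card {y \<in> B i. {x, y} \<notin> edges L}"
          proof -
            have "B i = (neighbours L x \<inter> B i) \<union> {y \<in> B i. {x, y} \<notin> edges L}"
              by (auto simp: neighbours_def)
            moreover have "card ((neighbours L x \<inter> B i) \<union> {y \<in> B i. {x, y} \<notin> edges L}) =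
                card (neighbours L x \<inter> B i) + card {y \<in> B i. {x, y} \<notin> edges L}"
              using finB[OF i(1)] by (intro card_Un_disjoint) (auto simp: neighbours_def)
            ultimately show ?thesis by simp
          qed
          moreover have "card {y \<in> B i. {x, y} \<notin> edges L} \<le> card {y \<in> K. {x, y} \<notin> edges L}"
            using i finK by (intro card_mono) (auto simp: K_def)
          ultimately show ?thesis using B(2)[OF i(1)] i(2) by linarith
        qed
        have "(card U - card W) * (T - t) = (\<Sum>x\<in>U - W. T - t)"
          using finW WU by (simp add: card_Diff_subset)
        also have "\<dots> \<le> (\<Sum>x\<in>U - W. card {y \<in> K. {x, y} \<notin> edges L})"
          using miss by (intro sum_mono) auto
        also have "\<dots> \<le> (\<Sum>x\<in>U. card {y \<in> K. {x, y} \<notin> edges L})"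
          using finU by (intro sum_mono2) auto
        also have "\<dots> = (\<Sum>y\<in>K. card {x \<in> U. {x, y} \<notin> edges L})"
          by (rule sum_card_swap[OF finU finK])
        finally have "p * ((card U - card W) * (T - t)) \<le> (\<Sum>y\<in>K. p * card {x \<in> U. {x, y} \<notin> edges L})"
          by (simp add: sum_distrib_left[symmetric])
        also have "\<dots> \<le> (\<Sum>y\<in>K. card (verts L) + p)"
        proof (rule sum_mono)
          fix y assume y: "y \<in> K"
          have "card {x \<in> U. {x, y} \<notin> edges L} \<le> card (verts L - neighbours L y)"
            using finV by (intro card_mono) (auto simp: U_def neighbours_def insert_commute)
          then have "p * card {x \<in> U. {x, y} \<notin> edges L} \<le> p * card (verts L - neighbours L y)" by simp
          also have "\<dots> \<le> card (verts L) + p" using deg y KV by blast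
          finally show "p * card {x \<in> U. {x, y} \<notin> edges L} \<le> card (verts L) + p" .
        qed
        also have "\<dots> = r * T * (card (verts L) + p)" using cK by simp
        finally have main: "p * ((card U - card W) * (T - t)) \<le> r * T * (card (verts L) + p)" .
        define n where "n = card (verts L)"
        define u where "u = card U - card W"
        have "T - t = (2 * p - 1) * t" by (simp add: T_def diff_mult_distrib)
        then have "p * (u * ((2 * p - 1) * t)) \<le> r * T * (n + p)" using main by (simp add: n_def u_def)
        also have "\<dots> \<le> (p - 1) * T * (n + p)" using Suc.prems by (intro mult_le_mono1) simp
        also have "p * (u * ((2 * p - 1) * t)) = (p * t) * ((2 * p - 1) * u)" by (simp only: mult_ac)
        also have "(p - 1) * T * (n + p) = (p * t) * ((2 * (p - 1)) * (n + p))"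
          by (simp only: T_def mult_ac)
        also have "2 * (p - 1) = 2 * p - 2" by simp
        finally have "(p * t) * ((2 * p - 1) * u) \<le> (p * t) * ((2 * p - 2) * (n + p))" .
        \<comment> \<open>After cancelling \<open>p * t\<close> the coefficients differ by one, and
          this difference bounds the number of vertices.\<close>
        then have le: "(2 * p - 1) * u \<le> (2 * p - 2) * (n + p)" using False p by simp
        have "2 * p - 1 = Suc (2 * p - 2)" using p by simp
        then have le2: "u + (2 * p - 2) * u \<le> (2 * p - 2) * n + (2 * p - 2) * p"
          using le by (simp add: add_mult_distrib2)
        have nu: "n \<le> u + (r * T + w0)" using cU w by (simp add: n_def u_def)
        then have "(2 * p - 2) * n \<le> (2 * p - 2) * (u + (r * T + w0))" by (rule mult_le_mono2)
        then have "(2 * p - 2) * n \<le> (2 * p - 2) * u + (2 * p - 2) * (r * T + w0)"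
          by (simp only: add_mult_distrib2)
        then have "u \<le> (2 * p - 2) * (r * T + w0) + (2 * p - 2) * p" using le2 by linarith
        then have "n \<le> (2 * p - 2) * (r * T + w0) + (2 * p - 2) * p + (r * T + w0)" using nu by linarith
        also have "\<dots> \<le> 2 * p * (r * T + w0) + 2 * p * p"
        proof -
          have "(2 * p - 2) * (r * T + w0) + (r * T + w0) = (2 * p - 1) * (r * T + w0)"
            using \<open>2 * p - 1 = Suc (2 * p - 2)\<close> by simp
          also have "\<dots> \<le> 2 * p * (r * T + w0)" by (rule mult_le_mono1) simp
          finally have "(2 * p - 2) * (r * T + w0) + (r * T + w0) \<le> 2 * p * (r * T + w0)" .
          moreover have "(2 * p - 2) * p \<le> 2 * p * p" by (rule mult_le_mono1) simp
          ultimately show ?thesis by linarith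
        qed
        finally show False using n by (simp add: n_def n0_def)
      qed
      have "\<exists>A\<in>Pow K. t \<le> card {x \<in> W. neighbours L x \<inter> K = A}"
      proof (rule ccontr)
        assume no: "\<not> (\<exists>A\<in>Pow K. t \<le> card {x \<in> W. neighbours L x \<inter> K = A})"
        define F where "F A = {x \<in> W. neighbours L x \<inter> K = A}" for A
        have "x \<in> F (neighbours L x \<inter> K)" if "x \<in> W" for x using that by (simp add: F_def)
        then have "W \<subseteq> (\<Union>A\<in>Pow K. F A)" by blast
        moreover have "finite (F A)" for A using finW by (simp add: F_def)
        ultimately have "card W \<le> card (\<Union>A\<in>Pow K. F A)" using finK by (intro card_mono) auto
        also have "\<dots> \<le> (\<Sum>A\<in>Pow K. card (F A))" using finK by (intro card_UN_le) simp
        also have "\<dots> \<le> (\<Sum>A\<in>Pow K. t)"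
        proof (rule sum_mono)
          fix A assume "A \<in> Pow K"
          then have "\<not> t \<le> card (F A)" using no by (auto simp: F_def)
          then show "card (F A) \<le> t" by simp
        qed
        also have "\<dots> = w0" using finK cK by (simp add: w0_def card_Pow)
        finally show False using large by simp
      qed
      then obtain A where A: "A \<subseteq> K" "t \<le> card {x \<in> W. neighbours L x \<inter> K = A}" by blast
      obtain X where X: "X \<subseteq> {x \<in> W. neighbours L x \<inter> K = A}" "card X = t"
        using A(2) by (meson obtain_subset_with_card_n)
      then obtain x0 where x0: "x0 \<in> X" using False by fastforce
      have "\<exists>C. C \<subseteq> A \<inter> B i \<and> card C = t" if i: "i < r" for i
      proof -
        have "A \<inter> B i = neighbours L x0 \<inter> B i" using x0 X(1) i by (auto simp: K_def)
        moreover have "x0 \<in> W" using x0 X(1) by blast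
        ultimately have "t \<le> card (A \<inter> B i)" using i by (simp add: W_def)
        then show ?thesis by (meson obtain_subset_with_card_n)
      qed
      then obtain C where C: "\<And>i. i < r \<Longrightarrow> C i \<subseteq> A \<inter> B i \<and> card (C i) = t" by metis
      define B' where "B' i = (if i = r then X else C i)" for i
      have adjX: "{x, y} \<in> edges L" if "x \<in> X" "y \<in> C i" "i < r" for x y i
      proof -
        have "y \<in> neighbours L x" using that C[of i] X(1) by blast
        then show ?thesis by (simp add: neighbours_def)
      qed
      have "complete_parts L (Suc r) B'"
        unfolding complete_parts_def
      proof (intro conjI allI impI ballI)
        fix i assume i: "i < Suc r"
        show "B' i \<subseteq> verts L"
        proof (cases "i = r")
          case True
          have "X \<subseteq> verts L" using X(1) by (auto simp: W_def U_def)
          then show ?thesis using True by (simp add: B'_def)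
        next
          case False
          then show ?thesis using C[of i] BV[of i] i by (auto simp: B'_def)
        qed
      next
        fix i j x y assume ij: "i < Suc r" "j < Suc r" "i \<noteq> j" "x \<in> B' i" "y \<in> B' j"
        consider "i = r" "j < r" | "j = r" "i < r" | "i < r" "j < r" using ij by linarith
        then show "{x, y} \<in> edges L"
        proof cases
          case 1 then show ?thesis using adjX[of x y j] ij by (simp add: B'_def)
        next
          case 2
          then show ?thesis using adjX[of y x i] ij by (simp add: B'_def insert_commute)
        next
          case 3
          then have "x \<in> B i" "y \<in> B j" using ij C[of i] C[of j] by (auto simp: B'_def)
          then show ?thesis using B(1) 3 ij(3) by (simp add: complete_parts_def)
        qed
      qed
      moreover have "card (B' i) = t" if "i < Suc r" for i
        using that X(2) C[of i] by (simp add: B'_def)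
      ultimately show ?thesis by blast
    qed
    then show ?thesis by blast
  qed
qed

text \<open>Turns a bound on matchings into a bounded set of vertices meeting every edge: an edge
  avoiding \<open>\<Union> W\<close> would enlarge the matching. The comparison of sizes is recorded
  too, because other matchings will be measured against \<open>W\<close>.\<close>

lemma ex_maximal_matching_cover:
  assumes fin: "finite \<E>" and two: "\<And>e. e \<in> \<E> \<Longrightarrow> card e = 2"
  obtains W where "W \<subseteq> \<E>" "pairwise disjnt W" "\<forall>e\<in>\<E>. e \<inter> \<Union> W \<noteq> {}"
    "\<forall>W'. W' \<subseteq> \<E> \<and> pairwise disjnt W' \<longrightarrow> card W' \<le> card W"
proof -
  let ?P = "\<lambda>W. W \<subseteq> \<E> \<and> pairwise disjnt W"
  have P: "?P {}" by (simp add: pairwise_def)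
  have bound: "\<forall>W. ?P W \<longrightarrow> card W < Suc (card \<E>)" using card_mono[OF fin] by (auto simp: less_Suc_eq_le)
  obtain W where W: "?P W" and max: "\<And>W'. ?P W' \<Longrightarrow> card W' \<le> card W"
    using ex_has_greatest_nat[of ?P, OF P bound] by blast
  have finW: "finite W" using W fin finite_subset by blast
  have "e \<inter> \<Union> W \<noteq> {}" if e: "e \<in> \<E>" for e
  proof
    assume dis: "e \<inter> \<Union> W = {}"
    have "e \<noteq> {}" using two[OF e] by auto
    then have "e \<notin> W" using dis by blast
    moreover have "?P (insert e W)"
      using W e dis by (auto simp: pairwise_insert disjnt_def)
    ultimately show False using max[of "insert e W"] finW by simp
  qed
  then show thesis using that[of W] W max by blast
qed

lemma card_Int_UN_parts:
  fixes p :: nat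
  assumes "\<And>i. i < p \<Longrightarrow> finite (B i)" "\<And>i j. i < p \<Longrightarrow> j < p \<Longrightarrow> i \<noteq> j \<Longrightarrow> B i \<inter> B j = {}"
  shows "card (A \<inter> (\<Union>i<p. B i)) = (\<Sum>i<p. card (A \<inter> B i))"
proof -
  have "A \<inter> (\<Union>i<p. B i) = (\<Union>i<p. A \<inter> B i)" by blast
  moreover have "card (\<Union>i<p. A \<inter> B i) = (\<Sum>i<p. card (A \<inter> B i))"
  proof (rule card_UN_disjoint)
    show "\<forall>i\<in>{..<p}. finite (A \<inter> B i)" using assms(1) by simp
    show "\<forall>i\<in>{..<p}. \<forall>j\<in>{..<p}. i \<noteq> j \<longrightarrow> A \<inter> B i \<inter> (A \<inter> B j) = {}" using assms(2) by blast
  qed simp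
  ultimately show ?thesis by simp
qed

lemma card_edges_remove:
  assumes L: "simple_graph L" and X: "X \<subseteq> verts L"
  shows "card (edges L) =
    edges_within L (verts L - X) + edges_within L X + (\<Sum>x\<in>verts L - X. card (neighbours L x \<inter> X))"
proof -
  have fin: "finite X" "finite (verts L - X)" using simple_graphD(1)[OF L] X finite_subset by auto
  have "X \<union> (verts L - X) = verts L" using X by blast
  then show ?thesis
    using edges_within_Un[OF L fin] edges_within_verts[OF L] by simp
qed

section \<open>Progressive induction\<close>

text \<open>Every step lowers \<open>n\<close> by at most \<open>c\<close> and raises \<phi> by at
  least one. Below \<open>start\<close> the values of \<phi> are at most some D, so a descent has at
  most D - \<phi>(n) steps before it gets there, which bounds \<open>n\<close>.\<close>

lemma progressive_induction:
  fixes \<phi> :: "nat \<Rightarrow> int" and bad :: "nat \<Rightarrow> bool"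
  assumes step: "\<And>n. start \<le> n \<Longrightarrow> bad n \<Longrightarrow> \<exists>n'<n. n \<le> n' + c \<and> bad n' \<and> \<phi> n + 1 \<le> \<phi> n'"
    and nonneg: "\<And>n. bad n \<Longrightarrow> 0 \<le> \<phi> n"
  shows "\<exists>N. \<forall>n\<ge>N. \<not> bad n"
proof -
  obtain D where D: "\<And>n. n < start \<Longrightarrow> \<phi> n \<le> D"
  proof -
    have "\<phi> n \<le> Max (insert 0 (\<phi> ` {..<start}))" if "n < start" for n using that by (intro Max_ge) auto
    then show thesis by (rule that)
  qed
  \<comment> \<open>The bound is linear in \<phi>, so a gain of one in \<phi> pays for a decrease of
    at most \<open>c\<close> in \<open>n\<close>.\<close>
  have bound: "int n \<le> int start + int c * (D - \<phi> n)" if "bad n" for n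
    using that
  proof (induction n rule: less_induct)
    case (less n)
    show ?case
    proof (cases "n < start")
      case True
      then have "0 \<le> int c * (D - \<phi> n)" using D by simp
      then show ?thesis using True by linarith
    next
      case False
      then obtain n' where n': "n' < n" "n \<le> n' + c" "bad n'" "\<phi> n + 1 \<le> \<phi> n'"
        using step[of n] less.prems by auto
      have "int n' \<le> int start + int c * (D - \<phi> n')" by (rule less.IH[OF n'(1,3)])
      also have "\<dots> \<le> int start + int c * (D - \<phi> n - 1)"
        using n'(4) by (intro add_left_mono mult_left_mono) auto
      finally have "int n' \<le> int start + int c * (D - \<phi> n - 1)" .
      moreover have "int c * (D - \<phi> n - 1) = int c * (D - \<phi> n) - int c" by (simp add: algebra_simps)
      ultimately show ?thesis using n'(2) by linarith
    qed
  qed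
  have "\<not> bad n" if n: "nat (int start + int c * \<bar>D\<bar>) < n" for n
  proof
    assume bn: "bad n"
    have "int c * (D - \<phi> n) \<le> int c * \<bar>D\<bar>" using nonneg[OF bn] by (intro mult_left_mono) auto
    then show False using bound[OF bn] n by linarith
  qed
  then show ?thesis by (metis Suc_le_lessD)
qed

section \<open>The comparison function and its increments\<close>

context edge_blowup_setting
begin

text \<open>A closed form that equals \<open>h'_edges n p q\<close> for q \<le> n; its increments
  are compared with the edges lost by a deletion.\<close>

definition \<tau> :: "nat \<Rightarrow> nat" where
  "\<tau> n = turan_number p (n - q + 1) + (q - 1) * (n - q + 1)"

lemma \<tau>_Suc:
  assumes "n \<ge> q" shows "\<tau> (Suc n) = \<tau> n + (n - (n - q + 1) div p)"
proof -
  define m where "m = n - q + 1"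
  have n: "n = m + (q - 1)" using assms q_pos by (simp add: m_def)
  have 1: "\<tau> n = turan_number p m + (q - 1) * m" by (simp add: \<tau>_def m_def)
  have "Suc n - q + 1 = Suc m" using assms by (simp add: m_def Suc_diff_le)
  then have 2: "\<tau> (Suc n) = turan_number p m + (m - m div p) + ((q - 1) * m + (q - 1))"
    by (simp add: \<tau>_def turan_number_Suc)
  have "m div p \<le> m" by (rule div_le_dividend)
  then show ?thesis unfolding 1 2 m_def[symmetric] using n by linarith
qed

text \<open>When every part grows by \<open>N\<close>, an old vertex in a part gains (p - 1)N
  neighbours and an apex gains pN. This is written as (p - 1)N for all \<open>n\<close> old vertices
  and \<open>N\<close> more for each of the q - 1 apices.\<close>

lemma \<tau>_add:
  assumes "n \<ge> q"
  shows "\<tau> (n + p * N) = \<tau> n + turan_number p (p * N) + (p - 1) * N * n + (q - 1) * N"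
proof -
  define m where "m = n - q + 1"
  have n: "n = m + (q - 1)" using assms q_pos by (simp add: m_def)
  have 1: "\<tau> n = turan_number p m + (q - 1) * m" by (simp add: \<tau>_def m_def)
  have "n + p * N - q + 1 = m + p * N" using assms by (simp add: m_def)
  then have 2: "\<tau> (n + p * N) =
      turan_number p m + turan_number p (p * N) + (p - 1) * N * m + (q - 1) * (m + p * N)"
    using turan_number_add[of p m N] p by (simp add: \<tau>_def)
  have 3: "(q - 1) * (p * N) = (p - 1) * N * (q - 1) + (q - 1) * N"
  proof -
    have "k * (Suc r * N) = r * N * k + k * N" for k r :: nat by (simp add: algebra_simps)
    moreover have "Suc (p - 1) = p" using p by simp
    ultimately show ?thesis by metis
  qed
  have 4: "(p - 1) * N * n = (p - 1) * N * m + (p - 1) * N * (q - 1)"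
    by (simp only: n add_mult_distrib2)
  have 5: "(q - 1) * (m + p * N) = (q - 1) * m + (q - 1) * (p * N)" by (simp only: add_mult_distrib2)
  show ?thesis unfolding 1 2 4 5 3 by (simp only: add_ac)
qed

text \<open>Core size kept when \<open>j\<close> apices are known. Every further apex divides it by
  the base, which is the ratio of \<open>N\<close> to \<open>\<theta>\<close> in
  \<open>reducible_configuration\<close>; even with \<open>q\<close> apices the cores still admit an
  embedding.\<close>

definition part_size :: "nat \<Rightarrow> nat" where
  "part_size j = ((2 * card (edges G) + 2) * (2 * p * card (edges G) + 3) + 1) ^ (q - j) *
     (size_bound + 2 * card (edges G) + 1)"

text \<open>No exceptional vertex is left: the coloured set is the whole complement of the q - 1
  apices. The multiple of \<open>l\<close> provides for the ends of as many edges as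
  \<open>G\<close> has, and for one centre.\<close>

definition structured :: "'b graph \<Rightarrow> bool" where
  "structured L \<longleftrightarrow> (\<exists>E B \<kappa> N l. configuration L p E B (verts L - E) \<kappa> N l \<and> card E = q - 1 \<and>
     size_bound + (2 * card (edges G) + 1) * l < N)"

text \<open>Deleting \<open>X\<close> destroys fewer edges than \<tau> loses; the additive form
  avoids truncated subtraction of edge numbers.\<close>

definition reducible :: "nat \<Rightarrow> 'b graph \<Rightarrow> bool" where
  "reducible c L \<longleftrightarrow> (\<exists>X\<subseteq>verts L. X \<noteq> {} \<and> card X \<le> c \<and>
     card (edges L) + \<tau> (card (verts L) - card X) < edges_within L (verts L - X) + \<tau> (card (verts L)))"

text \<open>The increment of \<tau> is roughly n - n/p, and a vertex with too many non-neighbours,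
  itself among them, has a smaller degree. The summand \<open>p\<close> absorbs the
  rounding.\<close>

lemma reducible_low_degree:
  assumes L: "simple_graph L" and n: "q < card (verts L)" and v: "v \<in> verts L"
    and low: "p * card (verts L - neighbours L v) > card (verts L) + p"
  shows "reducible 1 L"
proof -
  define n where "n = card (verts L) - 1"
  have cn: "card (verts L) = Suc n" using n by (simp add: n_def)
  have fin: "finite (verts L)" using simple_graphD(1)[OF L] .
  have nv: "neighbours L v \<subseteq> verts L - {v}" by (rule neighbours_subset[OF L])
  have fnv: "finite (neighbours L v)" by (rule finite_neighbours[OF L])
  have cd: "card (verts L - neighbours L v) = Suc n - card (neighbours L v)"
    using nv fnv cn by (subst card_Diff_subset) auto
  have le: "card (neighbours L v) \<le> Suc n"
    using nv fin cn card_mono[of "verts L" "neighbours L v"] by auto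
  have e0: "edges_within L {v} = 0"
  proof -
    have "e \<notin> edges L" if "e \<subseteq> {v}" for e
      using simple_graphD(3)[OF L, of e] that by (auto simp: subset_singleton_iff)
    then have "{e \<in> edges L. e \<subseteq> {v}} = {}" by blast
    then show ?thesis by (simp only: edges_within_def card.empty)
  qed
  have "verts L = (verts L - {v}) \<union> {v}" using v by blast
  then have "card (edges L) = edges_within L ((verts L - {v}) \<union> {v})"
    using edges_within_verts[OF L] by simp
  also have "\<dots> = edges_within L (verts L - {v}) + edges_within L {v} +
      (\<Sum>x\<in>{v}. card (neighbours L x \<inter> (verts L - {v})))"
    using fin by (intro edges_within_Un[OF L]) auto
  also have "neighbours L v \<inter> (verts L - {v}) = neighbours L v" using nv by blast
  then have "(\<Sum>x\<in>{v}. card (neighbours L x \<inter> (verts L - {v}))) = card (neighbours L v)" by simp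
  finally have e: "card (edges L) = edges_within L (verts L - {v}) + card (neighbours L v)"
    using e0 by simp
  have qn: "q \<le> n" using n cn by simp
  define d where "d = (n - q + 1) div p"
  have "p * d \<le> n - q + 1" unfolding d_def by (rule times_div_less_eq_dividend)
  then have pd: "p * d \<le> n" using q_pos qn by linarith
  have "Suc d < Suc n - card (neighbours L v)"
  proof (rule ccontr)
    assume "\<not> ?thesis"
    then have "p * (Suc n - card (neighbours L v)) \<le> p * Suc d" by (intro mult_le_mono2) simp
    then show False using low pd unfolding cd cn by simp
  qed
  then have "card (neighbours L v) < n - d" by linarith
  then have "card (edges L) + \<tau> n < edges_within L (verts L - {v}) + \<tau> (Suc n)"
    using e \<tau>_Suc[OF qn] by (simp add: d_def)
  then show ?thesis
    unfolding reducible_def using v cn by (intro exI[of _ "{v}"]) simp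
qed

section \<open>Excluded configurations and reducible graphs\<close>

lemma independent_empty: "independent G {}"
proof -
  have "{} \<notin> edges G" using simple_graphD(3)[OF G, of "{}"] by auto
  then show ?thesis by (auto simp: independent_def)
qed

text \<open>The empty independent set leaves every edge of \<open>G\<close> uncovered, and each one
  can be served by its own edge of the matching, whatever the number of apices.\<close>

lemma no_monochromatic_matching:
  assumes C: "configuration L p E B R \<kappa> N l" and free: "\<not> embeds H L"
    and N: "size_bound + 2 * card (edges G) * l \<le> N"
    and W: "finite W" "W \<subseteq> edges L" "pairwise disjnt W"
    and Wi: "\<And>d. d \<in> W \<Longrightarrow> d \<subseteq> R \<and> \<kappa> ` d \<subseteq> {i}" and i: "i < p"
  shows "card W < card (edges G)"
proof (rule ccontr)
  assume "\<not> card W < card (edges G)"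
  then have cards: "card {} + card {e \<in> edges G. e \<inter> {} = {}} \<le> card E + card W" by simp
  have "card (verts G) + card (edges G) + 2 * card (edges G) * l \<le> N"
    using N by (simp add: size_bound_def)
  then have "embeds H L"
    using configuration.embed_matching[OF C G bip p independent_empty _ W Wi i cards] by simp
  then show False using free by blast
qed

text \<open>With \<open>q\<close> apices an optimal independent set is paid for by apices alone,
  which is why the search for apices ends at q - 1.\<close>

lemma no_full_apex:
  assumes L: "simple_graph L" and free: "\<not> embeds H L"
    and E: "E \<subseteq> verts L" "card E = q"
    and B: "complete_parts L p B" "\<And>i. i < p \<Longrightarrow> size_bound + 2 * card (edges G) \<le> card (B i)"
    and EB: "\<And>i x y. i < p \<Longrightarrow> x \<in> E \<Longrightarrow> y \<in> B i \<Longrightarrow> {x, y} \<in> edges L"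
  shows False
proof -
  define R where "R = (\<Union>i<p. B i)"
  define \<kappa> where "\<kappa> x = (THE i. i < p \<and> x \<in> B i)" for x
  have \<kappa>: "\<kappa> x = i" if xi: "i < p" "x \<in> B i" for x i
    unfolding \<kappa>_def
  proof (rule the_equality)
    show "i < p \<and> x \<in> B i" using xi by simp
    fix j assume j: "j < p \<and> x \<in> B j"
    show "j = i"
    proof (rule ccontr)
      assume "j \<noteq> i"
      then have "B j \<inter> B i = {}" using complete_parts_disjoint[OF L B(1)] j xi(1) by simp
      then show False using j xi(2) by blast
    qed
  qed
  have C: "configuration L p E B R \<kappa> (size_bound + 2 * card (edges G)) 1"
  proof
    show "R \<subseteq> verts L" using B(1) by (auto simp: R_def complete_parts_def)
    have "x \<notin> B i" if "x \<in> E" "i < p" for x i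
      using EB[OF that(2,1), of x] simple_graph_adj(1)[OF L, of x x] by blast
    then show "E \<inter> R = {}" by (auto simp: R_def)
    show "\<kappa> ` R \<subseteq> {..<p}" using \<kappa> by (auto simp: R_def)
    show "B i \<subseteq> R" if "i < p" for i using that by (auto simp: R_def)
    show "card (B j - neighbours L x) \<le> 1" if xj: "x \<in> R" "j < p" "j \<noteq> \<kappa> x" for x j
    proof -
      obtain i where i: "i < p" "x \<in> B i" using xj(1) by (auto simp: R_def)
      then have "i \<noteq> j" using \<kappa> xj(3) by blast
      then have "B j \<subseteq> neighbours L x"
        using B(1) i xj(2) by (auto simp: neighbours_def complete_parts_def)
      then have "B j - neighbours L x = {}" by blast
      then show ?thesis by (simp only: card.empty zero_le)
    qed
    show "simple_graph L" "E \<subseteq> verts L" "complete_parts L p B" by fact+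
    show "\<kappa> x = i" if "i < p" "x \<in> B i" for i x by (rule \<kappa>[OF that])
    show "size_bound + 2 * card (edges G) \<le> card (B i)" if "i < p" for i by (rule B(2)[OF that])
    show "{x, y} \<in> edges L" if "i < p" "x \<in> E" "y \<in> B i" for i x y by (rule EB[OF that])
  qed simp
  obtain S0 where S0: "independent G S0" "cost S0 = q" using optimal_independent_set by metis
  have "embeds H L"
  proof (rule configuration.embed_matching[OF C G bip p S0(1), where W = "{}" and i = 0])
    show "card S0 \<le> card E" "card S0 + card {e \<in> edges G. e \<inter> S0 = {}} \<le> card E + card {}"
      using S0(2) E(2) by (simp_all add: cost_def uncovered_def)
    show "card (verts G) + card (edges G) + 2 * card (edges G) * 1 \<le> size_bound + 2 * card (edges G)"
      by (simp add: size_bound_def)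
  qed (use p in auto)
  then show False using free by blast
qed

text \<open>Counting the edges that meet a balanced complete \<open>p\<close>-partite subgraph \<open>\<Union>i<p. B' i\<close> which
  avoids the vertices of maximal matchings inside the colour classes: every missing apex costs \<open>N'\<close>
  edges and every vertex outside \<open>E \<union> R\<close> costs \<open>l - 2m - \<theta>\<close> edges, while the colour classes
  contribute at most \<open>2pm\<theta>\<close> edges.\<close>

lemma reducible_configuration:
  assumes C: "configuration L p E B R \<kappa> N l" and free: "\<not> embeds H L"
    and EB: "card E \<le> q - 1" and B: "\<And>i. i < p \<Longrightarrow> card (B i) = N"
    and few: "\<And>x. x \<in> verts L - E \<Longrightarrow> \<exists>i<p. card (neighbours L x \<inter> B i) < \<theta>"
    and R: "\<And>x i. x \<in> verts L - E \<Longrightarrow> i < p \<Longrightarrow> card (neighbours L x \<inter> B i) < \<theta> \<Longrightarrow>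
        \<forall>j<p. j \<noteq> i \<longrightarrow> card (B j - neighbours L x) \<le> l \<Longrightarrow> x \<in> R"
    and R\<kappa>: "\<And>x. x \<in> R \<Longrightarrow> card (neighbours L x \<inter> B (\<kappa> x)) < \<theta>"
    and m: "m = card (edges G)" and \<theta>: "size_bound + 2 * m < \<theta>" and l: "l = (2 * p * m + 3) * \<theta>"
    and N: "N = ((2 * m + 2) * (2 * p * m + 3) + 1) * \<theta>"
    and n: "p * N + q \<le> card (verts L)"
    and bad: "card E < q - 1 \<or> R \<noteq> verts L - E"
  shows "reducible (p * N) L"
proof -
  interpret conf: configuration L p E B R \<kappa> N l by (rule C)
  note L = conf.L
  \<comment> \<open>Three scales: \<theta> bounds degrees into the own core, \<open>l\<close>
    exceeds the total surplus 2pm\<theta> by 3\<theta>, and \<open>N\<close> exceeds the multiples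
    of \<open>l\<close> that an embedding spends.\<close>
  have Neq: "N = (2 * m + 2) * l + \<theta>" unfolding N l by (simp add: algebra_simps)
  have fV: "finite (verts L)" using simple_graphD(1)[OF L] .
  have matching: "card W < m"
    if "finite W" "W \<subseteq> edges L" "pairwise disjnt W" "\<And>d. d \<in> W \<Longrightarrow> d \<subseteq> R \<and> \<kappa> ` d \<subseteq> {i}" "i < p" for W i
  proof -
    have "2 * m * l \<le> (2 * m + 2) * l" by simp
    then have "size_bound + 2 * m * l \<le> N" unfolding Neq using \<theta> by linarith
    then show ?thesis
      unfolding m using no_monochromatic_matching[OF C free _ that] by (simp add: m)
  qed
  \<comment> \<open>The edges inside class \<open>i\<close> need not be bounded in number, but at
    most 2m vertices meet them all.\<close>
  have "\<exists>Y. Y \<subseteq> R \<and> card Y \<le> 2 * m \<and> \<kappa> ` Y \<subseteq> {i} \<and>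
      (\<forall>e\<in>edges L. e \<subseteq> R \<longrightarrow> \<kappa> ` e \<subseteq> {i} \<longrightarrow> e \<inter> Y \<noteq> {})" if i: "i < p" for i
  proof -
    let ?\<E> = "{e \<in> edges L. e \<subseteq> R \<and> \<kappa> ` e \<subseteq> {i}}"
    have "finite ?\<E>" using finite_edges[OF L] by simp
    moreover have "card e = 2" if "e \<in> ?\<E>" for e using simple_graphD(3)[OF L] that by simp
    ultimately obtain W where W: "W \<subseteq> ?\<E>" "pairwise disjnt W" "\<forall>e\<in>?\<E>. e \<inter> \<Union> W \<noteq> {}"
      by (rule ex_maximal_matching_cover)
    have fW: "finite W" using \<open>finite ?\<E>\<close> W(1) finite_subset by blast
    have WL: "W \<subseteq> edges L" "\<And>d. d \<in> W \<Longrightarrow> d \<subseteq> R \<and> \<kappa> ` d \<subseteq> {i}" using W(1) by auto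
    have "card W < m" using matching[OF fW WL(1) W(2) WL(2) i] by blast
    moreover have "card (\<Union> W) \<le> (\<Sum>d\<in>W. card d)" using fW card_UN_le[of W id] by simp
    moreover have "(\<Sum>d\<in>W. card d) = (\<Sum>d\<in>W. 2)"
      using WL(1) simple_graphD(3)[OF L] by (intro sum.cong) auto
    ultimately have "card (\<Union> W) \<le> 2 * m" by simp
    moreover have "\<Union> W \<subseteq> R" "\<kappa> ` \<Union> W \<subseteq> {i}" using WL(2) by blast+
    ultimately show ?thesis using W(3) by (intro exI[of _ "\<Union> W"]) auto
  qed
  then obtain Y where Y: "\<And>i. i < p \<Longrightarrow> Y i \<subseteq> R \<and> card (Y i) \<le> 2 * m \<and> \<kappa> ` Y i \<subseteq> {i} \<and>
      (\<forall>e\<in>edges L. e \<subseteq> R \<longrightarrow> \<kappa> ` e \<subseteq> {i} \<longrightarrow> e \<inter> Y i \<noteq> {})" by metis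
  have fY: "finite (Y i)" if "i < p" for i using Y[OF that] conf.finite_sets finite_subset by blast
  \<comment> \<open>Without \<open>Y i\<close> a core contains no edge; trimming all cores to one
    size makes the deleted set exactly balanced, as \<open>\<tau>_add\<close> requires.\<close>
  define N' where "N' = N - 2 * m"
  have "\<exists>C. C \<subseteq> B i - Y i \<and> card C = N'" if i: "i < p" for i
  proof -
    have "N' \<le> card (B i - Y i)"
    proof -
      have "card (Y i) \<le> 2 * m" using Y[OF i] by blast
      then show ?thesis
        using diff_card_le_card_Diff[OF fY[OF i], of "B i"] B[OF i] unfolding N'_def by linarith
    qed
    then show ?thesis by (meson obtain_subset_with_card_n)
  qed
  then obtain B' where B': "\<And>i. i < p \<Longrightarrow> B' i \<subseteq> B i - Y i \<and> card (B' i) = N'" by metis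
  have B'B: "B' i \<subseteq> B i" if "i < p" for i using B'[OF that] by blast
  have fB': "finite (B' i)" if "i < p" for i using B'B[OF that] conf.finite_parts[OF that] finite_subset by blast
  have disB': "B' i \<inter> B' j = {}" if "i < p" "j < p" "i \<noteq> j" for i j
    using complete_parts_disjoint[OF L conf.complete that] B'B that by blast
  define X where "X = (\<Union>i<p. B' i)"
  have XR: "X \<subseteq> R" using B'B conf.B(1) by (fastforce simp: X_def)
  have XV: "X \<subseteq> verts L" using XR conf.R by blast
  have fX: "finite X" using XV fV finite_subset by blast
  have cX: "card X = p * N'"
    unfolding X_def using fB' disB' B' by (subst card_UN_disjoint) auto
  have X\<kappa>: "x \<in> B' (\<kappa> x) \<and> \<kappa> x < p" if x: "x \<in> X" for x
  proof -
    obtain i where i: "i < p" "x \<in> B' i" using x by (auto simp: X_def)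
    then have "\<kappa> x = i" using B'B conf.B(2) by blast
    then show ?thesis using i by simp
  qed
  have nX: "card (neighbours L x \<inter> X) = (\<Sum>i<p. card (neighbours L x \<inter> B' i))" for x
    unfolding X_def by (rule card_Int_UN_parts[OF fB' disB'])
  have nB: "card (neighbours L x \<inter> B' i) \<le> N'" if "i < p" for x i
    using B'[OF that] fB'[OF that] card_mono[of "B' i" "neighbours L x \<inter> B' i"] by simp
  have nBB: "card (neighbours L x \<inter> B' i) \<le> card (neighbours L x \<inter> B i)" if "i < p" for x i
    using B'B[OF that] conf.finite_parts[OF that] by (intro card_mono) auto
  have inX: "edges_within L X \<le> turan_number p (p * N')"
  proof -
    have "{e \<in> edges L. e \<subseteq> X} \<subseteq> cross_pairs \<kappa> X"
    proof
      fix e assume e: "e \<in> {e \<in> edges L. e \<subseteq> X}"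
      then have "e \<in> edges L" by simp
      then obtain x y where xy: "e = {x, y}" using simple_graph_edgeE[OF L] by metis
      have "\<kappa> x \<noteq> \<kappa> y"
      proof
        assume eq: "\<kappa> x = \<kappa> y"
        have "x \<in> B' (\<kappa> x)" "y \<in> B' (\<kappa> x)" "\<kappa> x < p"
          using X\<kappa>[of x] X\<kappa>[of y] e xy eq by simp_all
        moreover have "e \<subseteq> R" "\<kappa> ` e \<subseteq> {\<kappa> x}" "e \<in> edges L" using e xy eq XR by auto
        then have "e \<inter> Y (\<kappa> x) \<noteq> {}" using Y[OF calculation(3)] by blast
        ultimately show False using B'[of "\<kappa> x"] xy by blast
      qed
      moreover have "x \<in> X" "y \<in> X" using e xy by auto
      ultimately show "e \<in> cross_pairs \<kappa> X" unfolding cross_pairs_def xy by blast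
    qed
    then have "edges_within L X \<le> card (cross_pairs \<kappa> X)"
      unfolding edges_within_def by (intro card_mono finite_cross_pairs fX)
    also have "\<dots> \<le> turan_number p (card X)"
    proof (rule card_cross_pairs_le)
      show "\<kappa> ` X \<subseteq> {..<p}" using X\<kappa> by blast
    qed (use p fX in simp_all)
    finally show ?thesis by (simp add: cX)
  qed
  have sum_but: "(\<Sum>i<p. g i) \<le> (p - 1) * N' + g i0"
    if "i0 < p" "\<And>i. i < p \<Longrightarrow> g i \<le> N'" for i0 and g :: "nat \<Rightarrow> nat"
  proof -
    have "(\<Sum>i<p. g i) = g i0 + (\<Sum>i\<in>{..<p} - {i0}. g i)" using that(1) by (simp add: sum.remove)
    also have "(\<Sum>i\<in>{..<p} - {i0}. g i) \<le> (\<Sum>i\<in>{..<p} - {i0}. N')" using that(2) by (intro sum_mono) auto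
    also have "\<dots> = (p - 1) * N'" using that(1) by simp
    finally show ?thesis by simp
  qed
  define YY where "YY = (\<Union>i<p. Y i)"
  define D where "D = verts L - E - R"
  \<comment> \<open>The deficit of a vertex in \<open>D\<close>: it misses more than
    \<open>l\<close> vertices of some core, at most 2m of them outside \<open>X\<close>, and has
    fewer than \<theta> neighbours in another core.\<close>
  define \<delta> where "\<delta> = l - 2 * m - \<theta>"
  have cYY: "card YY \<le> p * (2 * m)" and fYY: "finite YY"
  proof -
    have "card YY \<le> (\<Sum>i<p. card (Y i))" unfolding YY_def by (rule card_UN_le) simp
    also have "\<dots> \<le> (\<Sum>i<p. 2 * m)" using Y by (intro sum_mono) auto
    finally show "card YY \<le> p * (2 * m)" by simp
    show "finite YY" using fY by (auto simp: YY_def)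
  qed
  have \<delta>: "2 * p * m * \<theta> < \<delta>" "2 * p * m * \<theta> < N'" "0 < N'"
  proof -
    have l3: "l = 2 * p * m * \<theta> + 3 * \<theta>" unfolding l by (simp add: algebra_simps)
    then show 1: "2 * p * m * \<theta> < \<delta>" using \<theta> by (simp add: \<delta>_def)
    have "l \<le> (2 * m + 2) * l" by simp
    then have "l \<le> N" unfolding Neq by linarith
    then show 2: "2 * p * m * \<theta> < N'" "0 < N'" using l3 \<theta> by (simp_all add: N'_def)
  qed
  \<comment> \<open>The benchmark is (p - 1)N' neighbours in \<open>X\<close>. An apex may exceed it
    by N', a vertex of \<open>YY\<close> by \<theta>, and a vertex of \<open>D\<close> stays below
    it by at least \<delta>.\<close>
  have vertex: "card (neighbours L x \<inter> X) + (if x \<in> D then \<delta> else 0) \<le>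
      (p - 1) * N' + (if x \<in> E then N' else 0) + (if x \<in> YY then \<theta> else 0)"
    if x: "x \<in> verts L - X" for x
  proof -
    consider "x \<in> E" | "x \<in> R" | "x \<in> D" using x by (auto simp: D_def)
    then show ?thesis
    proof cases
      case 1
      then have "x \<notin> D" by (simp add: D_def)
      have "card (neighbours L x \<inter> X) \<le> (p - 1) * N' + card (neighbours L x \<inter> B' 0)"
        unfolding nX using p nB by (intro sum_but) auto
      also have "\<dots> \<le> (p - 1) * N' + N'" using nB[of 0 x] p by simp
      finally show ?thesis using 1 \<open>x \<notin> D\<close> by simp
    next
      case 2
      have \<kappa>x: "\<kappa> x < p" using 2 conf.\<kappa> by auto
      have "x \<notin> D" using 2 by (simp add: D_def)
      have "card (neighbours L x \<inter> X) \<le> (p - 1) * N' + card (neighbours L x \<inter> B' (\<kappa> x))"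
        unfolding nX using nB \<kappa>x by (intro sum_but) auto
      moreover have "card (neighbours L x \<inter> B' (\<kappa> x)) \<le> (if x \<in> YY then \<theta> else 0)"
      proof (cases "x \<in> YY")
        case True
        then show ?thesis using nBB[OF \<kappa>x, of x] R\<kappa>[OF 2] by simp
      next
        case False
        have "neighbours L x \<inter> B' (\<kappa> x) = {}"
        proof (rule equals0I)
          fix y assume y: "y \<in> neighbours L x \<inter> B' (\<kappa> x)"
          then have yB: "y \<in> B (\<kappa> x)" using B'B[OF \<kappa>x] by blast
          then have "y \<in> R" "\<kappa> y = \<kappa> x"
            using conf.B(1,2)[OF \<kappa>x] by blast+
          then have "{x, y} \<inter> Y (\<kappa> x) \<noteq> {}"
            using Y[OF \<kappa>x] y 2 by (auto simp: neighbours_def)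
          moreover have "y \<notin> Y (\<kappa> x)" using B'[OF \<kappa>x] y by blast
          moreover have "x \<notin> Y (\<kappa> x)" using False \<kappa>x by (auto simp: YY_def)
          ultimately show False by blast
        qed
        then show ?thesis by simp
      qed
      ultimately show ?thesis using \<open>x \<notin> D\<close> by simp
    next
      case 3
      then have xVE: "x \<in> verts L - E" "x \<notin> R" "x \<notin> E" by (auto simp: D_def)
      obtain i where i: "i < p" "card (neighbours L x \<inter> B i) < \<theta>" using few[OF xVE(1)] by blast
      then obtain j where j: "j < p" "j \<noteq> i" "l < card (B j - neighbours L x)"
        using R[OF xVE(1) i] xVE(2) by (meson not_le)
      have "(\<Sum>k<p. card (neighbours L x \<inter> B' k)) =
          card (neighbours L x \<inter> B' i) + (\<Sum>k\<in>{..<p} - {i}. card (neighbours L x \<inter> B' k))"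
        using i(1) by (simp add: sum.remove)
      also have "(\<Sum>k\<in>{..<p} - {i}. card (neighbours L x \<inter> B' k)) =
          card (neighbours L x \<inter> B' j) + (\<Sum>k\<in>{..<p} - {i} - {j}. card (neighbours L x \<inter> B' k))"
        using j(1,2) by (intro sum.remove) auto
      also have "(\<Sum>k\<in>{..<p} - {i} - {j}. card (neighbours L x \<inter> B' k)) \<le> (\<Sum>k\<in>{..<p} - {i} - {j}. N')"
        using nB by (intro sum_mono) auto
      also have "\<dots> = (p - 2) * N'" using i(1) j(1,2) by (simp add: numeral_2_eq_2)
      finally have s: "card (neighbours L x \<inter> X) \<le>
          card (neighbours L x \<inter> B' i) + (card (neighbours L x \<inter> B' j) + (p - 2) * N')"
        unfolding nX by simp
      have "card (B j - neighbours L x) \<le> card ((B' j - neighbours L x) \<union> (B j - B' j))"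
        using conf.finite_parts[OF j(1)] fB'[OF j(1)] by (intro card_mono) auto
      also have "\<dots> \<le> card (B' j - neighbours L x) + card (B j - B' j)" by (rule card_Un_le)
      also have "card (B j - B' j) = N - N'"
        using B[OF j(1)] B'[OF j(1)] B'B[OF j(1)] fB'[OF j(1)] by (simp add: card_Diff_subset)
      also have "N - N' \<le> 2 * m" by (simp add: N'_def)
      finally have "l < card (B' j - neighbours L x) + 2 * m" using j(3) by linarith
      moreover have "card (B' j - neighbours L x) + card (neighbours L x \<inter> B' j) = N'"
      proof -
        have "card (B' j - neighbours L x) = N' - card (neighbours L x \<inter> B' j)"
          using B'[OF j(1)] fB'[OF j(1)] by (metis card_Diff_subset_Int finite_Int Int_commute)
        then show ?thesis using nB[OF j(1), of x] by simp
      qed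
      moreover have "card (neighbours L x \<inter> B' i) < \<theta>" using nBB[OF i(1), of x] i(2) by linarith
      moreover have "(p - 1) * N' = N' + (p - 2) * N'"
      proof -
        have "p - 1 = Suc (p - 2)" using p by simp
        then show ?thesis by simp
      qed
      moreover have "2 * m + \<theta> \<le> l" using \<delta>(1) by (simp add: \<delta>_def)
      ultimately have "card (neighbours L x \<inter> X) + \<delta> \<le> (p - 1) * N'"
        using s unfolding \<delta>_def by linarith
      then show ?thesis using 3 xVE by simp
    qed
  qed
  define V where "V = verts L - X"
  have fVX: "finite V" using fV by (simp add: V_def)
  have cV: "card V = card (verts L) - p * N'" using XV fX cX by (simp add: V_def card_Diff_subset)
  have "(\<Sum>x\<in>V. card (neighbours L x \<inter> X)) + (\<Sum>x\<in>V. if x \<in> D then \<delta> else 0) \<le>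
      (\<Sum>x\<in>V. (p - 1) * N') + (\<Sum>x\<in>V. if x \<in> E then N' else 0) + (\<Sum>x\<in>V. if x \<in> YY then \<theta> else 0)"
    unfolding sum.distrib[symmetric] using vertex by (intro sum_mono) (simp add: V_def)
  moreover have DV: "V \<inter> D = D" using XR by (auto simp: V_def D_def)
  have "(\<Sum>x\<in>V. if x \<in> D then \<delta> else 0) = card D * \<delta>"
    using fVX DV by (simp add: sum.If_cases)
  moreover have "(\<Sum>x\<in>V. if x \<in> E then N' else 0) \<le> card E * N'"
  proof -
    have "card (V \<inter> E) \<le> card E" using conf.finite_sets by (intro card_mono) auto
    then show ?thesis using fVX by (simp add: sum.If_cases)
  qed
  moreover have "(\<Sum>x\<in>V. if x \<in> YY then \<theta> else 0) \<le> 2 * p * m * \<theta>"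
  proof -
    have "card (V \<inter> YY) \<le> card YY" using fYY by (intro card_mono) auto
    then have "card (V \<inter> YY) * \<theta> \<le> p * (2 * m) * \<theta>" using cYY by (intro mult_le_mono1) linarith
    then show ?thesis using fVX by (simp add: sum.If_cases mult_ac)
  qed
  ultimately have total: "(\<Sum>x\<in>V. card (neighbours L x \<inter> X)) + card D * \<delta> \<le>
      card V * ((p - 1) * N') + card E * N' + 2 * p * m * \<theta>" by simp
  have strict: "(\<Sum>x\<in>V. card (neighbours L x \<inter> X)) < card V * ((p - 1) * N') + (q - 1) * N'"
  proof (cases "card E < q - 1")
    case True
    then have "Suc (card E) * N' \<le> (q - 1) * N'" by (intro mult_le_mono1) simp
    then show ?thesis using total \<delta>(2) by simp
  next
    case False
    then have cE: "card E = q - 1" using EB by simp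
    then have "D \<noteq> {}" using bad conf.R conf.ER by (auto simp: D_def)
    moreover have "finite D" using fV by (simp add: D_def)
    ultimately have "1 \<le> card D" by (simp add: Suc_leI card_gt_0_iff)
    then have "1 * \<delta> \<le> card D * \<delta>" by (rule mult_le_mono1)
    then have "\<delta> \<le> card D * \<delta>" by (simp only: mult_1)
    then show ?thesis using total[unfolded cE] \<delta>(1) by linarith
  qed
  define n' where "n' = card (verts L) - p * N'"
  have NN: "p * N' \<le> p * N" by (simp add: N'_def)
  then have nn: "card (verts L) = n' + p * N'" "q \<le> n'"
    using n unfolding n'_def by linarith+
  have "card (edges L) = edges_within L V + edges_within L X + (\<Sum>x\<in>V. card (neighbours L x \<inter> X))"
    unfolding V_def by (rule card_edges_remove[OF L XV])
  also have "\<dots> < edges_within L V + turan_number p (p * N') + (n' * ((p - 1) * N') + (q - 1) * N')"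
    using strict inX cV by (simp add: n'_def)
  finally have "card (edges L) + \<tau> n' < edges_within L V + \<tau> (n' + p * N')"
    using \<tau>_add[OF nn(2), of N'] by (simp add: mult_ac)
  then have "card (edges L) + \<tau> (card (verts L) - card X) < edges_within L (verts L - X) + \<tau> (card (verts L))"
    using nn cX by (simp add: V_def)
  moreover have "X \<noteq> {}" using cX \<delta>(3) p by auto
  ultimately show ?thesis
    unfolding reducible_def using XV cX NN by (intro exI[of _ X]) simp
qed

lemma reducible_mono: "reducible c L \<Longrightarrow> c \<le> c' \<Longrightarrow> reducible c' L"
  unfolding reducible_def using le_trans by metis

text \<open>Apices are collected while the cores shrink along \<open>part_size\<close>. At the last
  stage that succeeds, no further vertex has \<theta> neighbours in every core, and this failure is
  the property \<open>few\<close> on which the colouring rests.\<close>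

lemma reducible_or_structured:
  "\<exists>n0 c. \<forall>L :: 'b graph. simple_graph L \<and> \<not> embeds H L \<and> n0 \<le> card (verts L) \<longrightarrow>
     reducible c L \<or> structured L"
proof -
  define m where "m = card (edges G)"
  define Z where "Z = size_bound + 2 * m + 1"
  define b where "b = (2 * m + 2) * (2 * p * m + 3) + 1"
  have ps: "part_size j = b ^ (q - j) * Z" for j by (simp add: part_size_def b_def m_def Z_def)
  have ps_Suc: "part_size j = b * part_size (Suc j)" if "j < q" for j
  proof -
    have "q - j = Suc (q - Suc j)" using that by simp
    then show ?thesis unfolding ps by simp
  qed
  have b1: "1 \<le> b" by (simp add: b_def)
  have psZ: "Z \<le> part_size j" for j unfolding ps using b1 by simp
  have ps0: "part_size j \<le> part_size 0" for j
    unfolding ps using b1 by (intro mult_le_mono1 power_increasing) auto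
  obtain n1 where n1: "\<And>L :: 'b graph. simple_graph L \<and> n1 \<le> card (verts L) \<and>
      (\<forall>x\<in>verts L. p * card (verts L - neighbours L x) \<le> card (verts L) + p) \<Longrightarrow>
      \<exists>B. complete_parts L p B \<and> (\<forall>i<p. card (B i) = part_size 0)"
    using ex_complete_parts[of p p "part_size 0"] p by auto
  define n0 where "n0 = n1 + q + 1 + p * part_size 0 + q"
  have "reducible (p * part_size 0) L \<or> structured L"
    if L: "simple_graph L" and free: "\<not> embeds H L" and n: "n0 \<le> card (verts L)" for L :: "'b graph"
  proof (rule disjCI)
    assume nstr: "\<not> structured L"
    show "reducible (p * part_size 0) L"
    proof (cases "\<exists>v\<in>verts L. p * card (verts L - neighbours L v) > card (verts L) + p")
      case True
      then obtain v where "v \<in> verts L" "p * card (verts L - neighbours L v) > card (verts L) + p"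
        by blast
      then have "reducible 1 L" using reducible_low_degree[OF L] n by (simp add: n0_def)
      moreover have "1 \<le> p * part_size 0" using psZ[of 0] p by (simp add: Z_def)
      ultimately show ?thesis by (rule reducible_mono)
    next
      case False
      define P where "P s \<longleftrightarrow> (\<exists>E B. E \<subseteq> verts L \<and> card E = s \<and> complete_parts L p B \<and>
          (\<forall>i<p. card (B i) = part_size s) \<and> (\<forall>i<p. \<forall>x\<in>E. \<forall>y\<in>B i. {x, y} \<in> edges L))" for s
      obtain B where "complete_parts L p B" "\<forall>i<p. card (B i) = part_size 0"
        using n1[of L] L n False by (auto simp: n0_def not_less)
      then have "P 0" unfolding P_def by (intro exI[of _ "{}"] exI[of _ B]) simp
      moreover have "\<not> P q"
      proof
        assume "P q"
        then obtain E B where EB: "E \<subseteq> verts L" "card E = q" "complete_parts L p B"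
          "\<forall>i<p. card (B i) = part_size q" "\<forall>i<p. \<forall>x\<in>E. \<forall>y\<in>B i. {x, y} \<in> edges L"
          unfolding P_def by blast
        have "size_bound + 2 * card (edges G) \<le> card (B i)" if "i < p" for i
          using EB(4) psZ[of q] that by (simp add: Z_def m_def)
        then show False using no_full_apex[OF L free EB(1-3)] EB(5) by blast
      qed
      ultimately obtain s where s: "s < q" "P s" "\<not> P (Suc s)"
        using ex_least_nat_less[of "\<lambda>s. \<not> P s" q] by auto
      from s(2) obtain E B where EB0: "E \<subseteq> verts L \<and> card E = s \<and> complete_parts L p B \<and>
          (\<forall>i<p. card (B i) = part_size s) \<and> (\<forall>i<p. \<forall>x\<in>E. \<forall>y\<in>B i. {x, y} \<in> edges L)"
        unfolding P_def by (elim exE)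
      then have EB: "E \<subseteq> verts L" "card E = s" "complete_parts L p B"
        "\<And>i. i < p \<Longrightarrow> card (B i) = part_size s" by simp_all
      have EBadj: "{x, y} \<in> edges L" if "i < p" "x \<in> E" "y \<in> B i" for i x y
        using EB0 that by blast
      define \<theta> where "\<theta> = part_size (Suc s)"
      define l where "l = (2 * p * m + 3) * \<theta>"
      define N where "N = part_size s"
      have N: "N = b * \<theta>" using ps_Suc[OF s(1)] by (simp add: N_def \<theta>_def)
      have Neq: "N = (2 * m + 2) * l + \<theta>" unfolding N b_def l_def by (simp add: algebra_simps)
      have \<theta>: "size_bound + 2 * m < \<theta>" using psZ[of "Suc s"] by (simp add: \<theta>_def Z_def)
      have fB: "finite (B i)" if "i < p" for i
        using EB(3) that simple_graphD(1)[OF L] finite_subset by (auto simp: complete_parts_def)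
      have fE: "finite E" using EB(1) simple_graphD(1)[OF L] finite_subset by blast
      have few: "\<exists>i<p. card (neighbours L x \<inter> B i) < \<theta>" if x: "x \<in> verts L - E" for x
      proof (rule ccontr)
        assume "\<not> (\<exists>i<p. card (neighbours L x \<inter> B i) < \<theta>)"
        then have "\<exists>C. C \<subseteq> neighbours L x \<inter> B i \<and> card C = \<theta>" if "i < p" for i
          using that by (meson not_less obtain_subset_with_card_n)
        then obtain C where C: "\<And>i. i < p \<Longrightarrow> C i \<subseteq> neighbours L x \<inter> B i \<and> card (C i) = \<theta>" by metis
        have CB: "C i \<subseteq> B i" if "i < p" for i using C[OF that] by blast
        have "complete_parts L p C" using EB(3) CB unfolding complete_parts_def by blast
        moreover have "{z, y} \<in> edges L" if "i < p" "z \<in> insert x E" "y \<in> C i" for i z y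
          using that C[OF that(1)] CB[OF that(1)] EBadj[OF that(1)] by (auto simp: neighbours_def)
        moreover have "card (insert x E) = Suc s" using x fE EB(2) by simp
        moreover have "insert x E \<subseteq> verts L" using x EB(1) by blast
        ultimately have "P (Suc s)"
          unfolding P_def using C \<theta>_def by (intro exI[of _ "insert x E"] exI[of _ C]) blast
        then show False using s(3) by blast
      qed
      \<comment> \<open>A colour suits \<open>x\<close> if \<open>x\<close> is sparse to that core
        and nearly complete to all others; vertices with no suitable colour are the exceptional
        ones.\<close>
      define good where "good x i \<longleftrightarrow> i < p \<and> card (neighbours L x \<inter> B i) < \<theta> \<and>
          (\<forall>j<p. j \<noteq> i \<longrightarrow> card (B j - neighbours L x) \<le> l)" for x i
      define R where "R = {x \<in> verts L - E. \<exists>i. good x i}"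
      define \<kappa> where "\<kappa> x = (SOME i. good x i)" for x
      have \<kappa>: "good x (\<kappa> x)" if "x \<in> R" for x using that someI_ex[of "good x"] by (simp add: R_def \<kappa>_def)
      have EBdis: "x \<notin> B i" if "x \<in> E" "i < p" for x i
        using EBadj[OF that(2,1), of x] simple_graph_adj(1)[OF L, of x x] by blast
      have BV: "B i \<subseteq> verts L - E" if "i < p" for i
        using EB(3) EBdis that by (auto simp: complete_parts_def)
      have Bgood: "good x i \<and> (\<forall>i'. good x i' \<longrightarrow> i' = i)" if x: "i < p" "x \<in> B i" for x i
      proof -
        have Bj: "B j \<subseteq> neighbours L x" if "j < p" "j \<noteq> i" for j
          using EB(3) x that by (auto simp: complete_parts_def neighbours_def)
        \<comment> \<open>A core vertex sees all of every foreign core, hence at least \<theta>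
          vertices there, so no foreign colour suits it and \<open>few\<close> must refer to its own
          core.\<close>
        have uniq: "i' = i" if "i' < p" "card (neighbours L x \<inter> B i') < \<theta>" for i'
        proof (rule ccontr)
          assume "i' \<noteq> i"
          then have "neighbours L x \<inter> B i' = B i'" using Bj[of i'] that(1) by blast
          then have "b * \<theta> < \<theta>" using that EB(4)[of i'] N by (simp add: N_def)
          then show False using b1 by simp
        qed
        obtain i' where "i' < p" "card (neighbours L x \<inter> B i') < \<theta>" using few[of x] BV x by blast
        then have "card (neighbours L x \<inter> B i) < \<theta>" using uniq by blast
        moreover have "card (B j - neighbours L x) \<le> l" if "j < p" "j \<noteq> i" for j
        proof -
          have "B j - neighbours L x = {}" using Bj[OF that] by blast
          then show ?thesis by (simp only: card.empty zero_le)
        qed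
        ultimately have "good x i" using x(1) by (simp add: good_def)
        then show ?thesis using uniq by (auto simp: good_def)
      qed
      have C: "configuration L p E B R \<kappa> N l"
      proof
        show "E \<inter> R = {}" "R \<subseteq> verts L" by (auto simp: R_def)
        show "\<kappa> ` R \<subseteq> {..<p}" using \<kappa> by (auto simp: good_def)
        show BR: "B i \<subseteq> R" if "i < p" for i using BV[OF that] Bgood[OF that] by (auto simp: R_def)
        show "\<kappa> x = i" if "i < p" "x \<in> B i" for i x
          using Bgood[OF that] \<kappa>[of x] BR[OF that(1)] that(2) by blast
        show "N \<le> card (B i)" if "i < p" for i using EB(4)[OF that] by (simp add: N_def)
        show "card (B j - neighbours L x) \<le> l" if "x \<in> R" "j < p" "j \<noteq> \<kappa> x" for x j
          using \<kappa>[OF that(1)] that(2,3) by (simp add: good_def)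
        show "1 \<le> l" using \<theta> by (simp add: l_def)
      show "simple_graph L" "E \<subseteq> verts L" "complete_parts L p B" by fact+
        show "{x, y} \<in> edges L" if "i < p" "x \<in> E" "y \<in> B i" for i x y by (rule EBadj[OF that])
      qed
      have bad: "card E < q - 1 \<or> R \<noteq> verts L - E"
      proof (rule ccontr)
        assume "\<not> ?thesis"
        then have "card E = q - 1" "R = verts L - E" using s(1) EB(2) by auto
        moreover have "size_bound + (2 * card (edges G) + 1) * l < N"
        proof -
          have "(2 * m + 1) * l \<le> (2 * m + 2) * l" by simp
          then show ?thesis unfolding Neq m_def[symmetric] using \<theta> by linarith
        qed
        ultimately have "structured L" using C unfolding structured_def by blast
        then show False using nstr by blast
      qed
      have "reducible (p * N) L"
      proof (rule reducible_configuration[OF C free _ _ few _ _ m_def \<theta> l_def])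
        show "card E \<le> q - 1" using EB(2) s(1) by simp
        show "card (B i) = N" if "i < p" for i using EB(4)[OF that] by (simp add: N_def)
        show "x \<in> R" if "x \<in> verts L - E" "i < p" "card (neighbours L x \<inter> B i) < \<theta>"
          "\<forall>j<p. j \<noteq> i \<longrightarrow> card (B j - neighbours L x) \<le> l" for x i
          using that by (auto simp: R_def good_def)
        show "card (neighbours L x \<inter> B (\<kappa> x)) < \<theta>" if "x \<in> R" for x
          using \<kappa>[OF that] by (simp add: good_def)
        show "N = ((2 * m + 2) * (2 * p * m + 3) + 1) * \<theta>" using N by (simp add: b_def)
        have "p * N \<le> p * part_size 0" using ps0[of s] by (simp add: N_def)
        then show "p * N + q \<le> card (verts L)" using n unfolding n0_def by linarith
      qed (use bad in simp_all)
      moreover have "p * N \<le> p * part_size 0" using ps0[of s] by (simp add: N_def)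
      ultimately show ?thesis by (rule reducible_mono)
    qed
  qed
  then show ?thesis by blast
qed

end

section \<open>Graphs of bounded degree and matching number\<close>

lemma finite_matchings: "simple_graph L \<Longrightarrow> finite {card W | W. matching L W}"
proof -
  assume "simple_graph L"
  then have "finite (Pow (edges L))" by (simp add: finite_edges)
  then have "finite (card ` Pow (edges L))" by (rule finite_imageI)
  then show ?thesis by (rule rev_finite_subset) (auto simp: matching_def)
qed

lemma card_matching_le: "simple_graph L \<Longrightarrow> matching L W \<Longrightarrow> card W \<le> matching_number L"
  unfolding matching_number_def by (rule Max_ge[OF finite_matchings]) auto

lemma matching_number_le:
  assumes "simple_graph L" "\<And>W. matching L W \<Longrightarrow> card W \<le> \<nu>" shows "matching_number L \<le> \<nu>"
proof -
  have "matching L {}" by (simp add: matching_def pairwise_def)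
  then have "{card W | W. matching L W} \<noteq> {}" by blast
  then show ?thesis
    unfolding matching_number_def using finite_matchings[OF assms(1)] assms(2) by (subst Max_le_iff) auto
qed

definition bounded_graphs :: "nat \<Rightarrow> nat \<Rightarrow> nat graph set" where
  "bounded_graphs \<nu> \<Delta> =
     {L. simple_graph L \<and> matching_number L \<le> \<nu> \<and> (\<forall>x\<in>verts L. degree L x \<le> \<Delta>)}"

lemma f_edges_eq: "f_edges \<nu> \<Delta> = Max ((\<lambda>L. card (edges L)) ` bounded_graphs \<nu> \<Delta>)"
  unfolding f_edges_def bounded_graphs_def by (rule arg_cong[of _ _ Max]) blast

text \<open>The at most 2\<nu> vertices of a maximum matching meet all edges; this makes the set
  under the \<open>Max\<close> of \<open>f_edges\<close> finite.\<close>

lemma card_edges_bounded: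
  assumes "L \<in> bounded_graphs \<nu> \<Delta>" shows "card (edges L) \<le> 2 * \<nu> * \<Delta>"
proof -
  have L: "simple_graph L" "matching_number L \<le> \<nu>" "\<And>x. x \<in> verts L \<Longrightarrow> degree L x \<le> \<Delta>"
    using assms by (auto simp: bounded_graphs_def)
  have fE: "finite (edges L)" by (rule finite_edges[OF L(1)])
  obtain W where W: "W \<subseteq> edges L" "pairwise disjnt W" "\<forall>e\<in>edges L. e \<inter> \<Union> W \<noteq> {}"
    by (rule ex_maximal_matching_cover[OF fE simple_graphD(3)[OF L(1)]])
  have fW: "finite W" using W(1) fE finite_subset by blast
  have cW: "card W \<le> \<nu>" using card_matching_le[OF L(1), of W] W L(2) by (simp add: matching_def)
  have WV: "\<Union> W \<subseteq> verts L" using W(1) simple_graphD(2)[OF L(1)] by blast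
  have "card (\<Union> W) \<le> (\<Sum>d\<in>W. card d)" using fW card_UN_le[of W id] by simp
  also have "\<dots> = (\<Sum>d\<in>W. 2)" using W(1) simple_graphD(3)[OF L(1)] by (intro sum.cong) auto
  finally have cUW: "card (\<Union> W) \<le> 2 * \<nu>" using cW by simp
  have fUW: "finite (\<Union> W)" using WV simple_graphD(1)[OF L(1)] finite_subset by blast
  have "edges L \<subseteq> (\<Union>x\<in>\<Union> W. {e \<in> edges L. x \<in> e})" using W(3) by blast
  then have "card (edges L) \<le> card (\<Union>x\<in>\<Union> W. {e \<in> edges L. x \<in> e})"
    using fE by (intro card_mono finite_UN_I[OF fUW]) simp_all
  also have "\<dots> \<le> (\<Sum>x\<in>\<Union> W. card {e \<in> edges L. x \<in> e})" by (rule card_UN_le[OF fUW])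
  also have "\<dots> \<le> (\<Sum>x\<in>\<Union> W. \<Delta>)"
    using L(3) WV unfolding degree_def by (intro sum_mono) blast
  also have "\<dots> \<le> 2 * \<nu> * \<Delta>" using cUW by simp
  finally show ?thesis .
qed

lemma finite_bounded_counts: "finite ((\<lambda>L. card (edges L)) ` bounded_graphs \<nu> \<Delta>)"
  by (rule finite_subset[of _ "{..2 * \<nu> * \<Delta>}"]) (use card_edges_bounded in auto)

lemma f_edges_ge: "L \<in> bounded_graphs \<nu> \<Delta> \<Longrightarrow> card (edges L) \<le> f_edges \<nu> \<Delta>"
  unfolding f_edges_eq by (rule Max_ge[OF finite_bounded_counts]) blast

lemma f_edges_attained: obtains L where "L \<in> bounded_graphs \<nu> \<Delta>" "card (edges L) = f_edges \<nu> \<Delta>"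
proof -
  let ?L = "Graph {} {} :: nat graph"
  have s: "simple_graph ?L" by (simp add: simple_graph_def)
  have "matching_number ?L \<le> \<nu>" by (rule matching_number_le[OF s]) (simp add: matching_def)
  then have "?L \<in> bounded_graphs \<nu> \<Delta>" using s by (simp add: bounded_graphs_def)
  then have "f_edges \<nu> \<Delta> \<in> (\<lambda>L. card (edges L)) ` bounded_graphs \<nu> \<Delta>"
    unfolding f_edges_eq using finite_bounded_counts by (intro Max_in) auto
  then show thesis using that by auto
qed

text \<open>A disjoint star with \<Delta> leaves adds \<Delta> edges and raises the matching number
  by at most one.\<close>

lemma f_edges_Suc: "f_edges \<nu> \<Delta> + \<Delta> \<le> f_edges (Suc \<nu>) \<Delta>"
proof -
  obtain L where L: "L \<in> bounded_graphs \<nu> \<Delta>" "card (edges L) = f_edges \<nu> \<Delta>"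
    by (rule f_edges_attained)
  have sL: "simple_graph L" "matching_number L \<le> \<nu>" "\<And>x. x \<in> verts L \<Longrightarrow> degree L x \<le> \<Delta>"
    using L(1) by (auto simp: bounded_graphs_def)
  \<comment> \<open>A number above all vertices makes room in \<open>nat\<close> for the star on v,
    ..., v + \<Delta>.\<close>
  obtain v where "\<forall>x\<in>verts L. x < v"
    using iffD1[OF finite_nat_set_iff_bounded simple_graphD(1)[OF sL(1)]] by blast
  then have v: "x < v" if "x \<in> verts L" for x using that by blast
  define T where "T = (\<lambda>u. {v, u}) ` {v<..v + \<Delta>}"
  define L' where "L' = Graph (verts L \<union> {v..v + \<Delta>}) (edges L \<union> T)"
  have sel: "verts L' = verts L \<union> {v..v + \<Delta>}" "edges L' = edges L \<union> T" by (simp_all add: L'_def)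
  have inj: "inj_on (\<lambda>u. {v, u}) {v<..v + \<Delta>}" by (auto simp: inj_on_def doubleton_eq_iff)
  have Tv: "v \<in> e" if "e \<in> T" for e using that by (auto simp: T_def)
  have Lv: "v \<notin> e" if "e \<in> edges L" for e using v simple_graphD(2)[OF sL(1) that] by blast
  have TL: "edges L \<inter> T = {}" using Tv Lv by blast
  have "card T = \<Delta>" unfolding T_def using inj by (simp add: card_image)
  moreover have "finite T" by (simp add: T_def)
  ultimately have c: "card (edges L') = f_edges \<nu> \<Delta> + \<Delta>"
    using TL finite_edges[OF sL(1)] L(2) by (simp add: sel card_Un_disjoint)
  have sL': "simple_graph L'"
    unfolding simple_graph_def sel
  proof (intro conjI ballI)
    show "finite (verts L \<union> {v..v + \<Delta>})" using simple_graphD(1)[OF sL(1)] by simp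
    fix e assume "e \<in> edges L \<union> T"
    then show "e \<subseteq> verts L \<union> {v..v + \<Delta>}" "card e = 2"
      using simple_graphD(2,3)[OF sL(1), of e] by (auto simp: T_def)
  qed
  have "matching_number L' \<le> Suc \<nu>"
  proof (rule matching_number_le[OF sL'])
    fix W assume "matching L' W"
    then have W: "W \<subseteq> edges L \<union> T" "pairwise disjnt W" by (simp_all add: matching_def sel)
    have fW: "finite W" using W(1) finite_edges[OF sL'] finite_subset unfolding sel by blast
    have "matching L (W \<inter> edges L)" using W(2) by (auto simp: matching_def pairwise_def)
    then have 1: "card (W \<inter> edges L) \<le> \<nu>" using card_matching_le[OF sL(1)] sL(2) le_trans by blast
    have "e = e'" if "e \<in> W \<inter> T" "e' \<in> W \<inter> T" for e e'
      using W(2) Tv[of e] Tv[of e'] that by (auto simp: pairwise_def disjnt_def)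
    then have 2: "card (W \<inter> T) \<le> 1" using fW by (simp add: card_le_Suc0_iff_eq)
    have "W = (W \<inter> edges L) \<union> (W \<inter> T)" using W(1) by blast
    then have "card W \<le> card (W \<inter> edges L) + card (W \<inter> T)" by (metis card_Un_le)
    then show "card W \<le> Suc \<nu>" using 1 2 by simp
  qed
  moreover have "degree L' x \<le> \<Delta>" if x: "x \<in> verts L'" for x
  proof -
    consider "x \<in> verts L" | "x = v" | "v < x" "x \<le> v + \<Delta>" using x by (fastforce simp: sel)
    then show ?thesis
    proof cases
      case 1
      then have "{e \<in> edges L'. x \<in> e} = {e \<in> edges L. x \<in> e}" using v[OF 1] by (auto simp: sel T_def)
      then show ?thesis using sL(3)[OF 1] by (simp add: degree_def)
    next
      case 2
      then have "{e \<in> edges L'. x \<in> e} = T" using Lv Tv by (auto simp: sel)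
      then show ?thesis using \<open>card T = \<Delta>\<close> by (simp add: degree_def)
    next
      case 3
      have "x \<notin> verts L" using v[of x] 3 by auto
      then have "x \<notin> e" if "e \<in> edges L" for e using simple_graphD(2)[OF sL(1) that] by blast
      then have "{e \<in> edges L'. x \<in> e} \<subseteq> {{v, x}}" using 3 by (auto simp: sel T_def)
      then have "degree L' x \<le> card {{v, x}}" unfolding degree_def by (intro card_mono) auto
      then show ?thesis using 3 by simp
    qed
  qed
  ultimately have "L' \<in> bounded_graphs (Suc \<nu>) \<Delta>" using sL' by (simp add: bounded_graphs_def)
  then show ?thesis using f_edges_ge c by metis
qed

lemma f_edges_add: "f_edges \<nu> \<Delta> + j * \<Delta> \<le> f_edges (\<nu> + j) \<Delta>"
proof (induction j)
  case (Suc j)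
  then show ?case using f_edges_Suc[of "\<nu> + j" \<Delta>] by simp
qed simp

text \<open>A variant of a lemma of Chen, Gould, Pfender and Wei. The colour class with the smallest
  share of a maximum matching of monochromatic edges is removed: its edges are covered by the at most
  \<open>K\<close> vertices of its matching, and each of these has at most \<open>K - c\<close> more neighbours in its class
  than it has missing neighbours in the other classes, where \<open>c\<close> is the matching number of the rest.\<close>

lemma monochromatic_edges_le:
  fixes L :: "nat graph"
  assumes L: "simple_graph L" and R: "R \<subseteq> verts L" and p: "p \<ge> 3" and \<kappa>: "\<kappa> ` R \<subseteq> {..<p}"
    and star: "\<And>y Z W. y \<in> R \<Longrightarrow> finite Z \<Longrightarrow> \<forall>z\<in>Z. z \<in> R \<and> \<kappa> z = \<kappa> y \<and> {y, z} \<in> edges L \<Longrightarrow>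
        finite W \<Longrightarrow> W \<subseteq> edges L \<Longrightarrow> pairwise disjnt W \<Longrightarrow>
        \<forall>d\<in>W. d \<subseteq> R \<and> (\<exists>j. j \<noteq> \<kappa> y \<and> \<kappa> ` d \<subseteq> {j}) \<Longrightarrow> \<forall>d\<in>W. \<forall>u\<in>d. {y, u} \<in> edges L \<Longrightarrow>
        card Z + card W \<le> K"
    and avoid: "\<And>i W. i < p \<Longrightarrow> finite W \<Longrightarrow> W \<subseteq> edges L \<Longrightarrow> pairwise disjnt W \<Longrightarrow>
        \<forall>d\<in>W. d \<subseteq> R \<and> (\<exists>j. j \<noteq> i \<and> \<kappa> ` d \<subseteq> {j}) \<Longrightarrow> card W \<le> K"
  shows "card {e \<in> edges L. e \<subseteq> R \<and> (\<exists>i. \<kappa> ` e \<subseteq> {i})} \<le>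
    card (cross_pairs \<kappa> R - edges L) + f_edges K K"
proof -
  define Mo where "Mo = {e \<in> edges L. e \<subseteq> R \<and> (\<exists>i. \<kappa> ` e \<subseteq> {i})}"
  have fR: "finite R" using R simple_graphD(1)[OF L] finite_subset by blast
  have fE: "finite (edges L)" by (rule finite_edges[OF L])
  have fMo: "finite Mo" using fE by (simp add: Mo_def)
  have two: "card e = 2" if "e \<in> Mo" for e using that simple_graphD(3)[OF L] by (simp add: Mo_def)
  obtain W where W: "W \<subseteq> Mo" "pairwise disjnt W" "\<forall>e\<in>Mo. e \<inter> \<Union> W \<noteq> {}"
    "\<forall>W'. W' \<subseteq> Mo \<and> pairwise disjnt W' \<longrightarrow> card W' \<le> card W"
    by (rule ex_maximal_matching_cover[OF fMo two])
  have fW: "finite W" using W(1) fMo finite_subset by blast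
  define Wc where "Wc i = {d \<in> W. \<kappa> ` d \<subseteq> {i}}" for i
  have fWc: "finite (Wc i)" for i using fW by (simp add: Wc_def)
  have ne: "e \<noteq> {}" if "e \<in> Mo" for e using two[OF that] by auto
  have same: "i = j" if "e \<in> Mo" "\<kappa> ` e \<subseteq> {i}" "\<kappa> ` e \<subseteq> {j}" for e i j using ne[OF that(1)] that by blast
  have colour: "\<exists>i<p. \<kappa> ` e \<subseteq> {i}" if e: "e \<in> Mo" for e
  proof -
    obtain i where i: "\<kappa> ` e \<subseteq> {i}" "e \<subseteq> R" using e by (auto simp: Mo_def)
    obtain x where "x \<in> e" using ne[OF e] by blast
    then have "i < p" using i \<kappa> by blast
    then show ?thesis using i by blast
  qed
  have disWc: "Wc i \<inter> Wc j = {}" if ij: "i \<noteq> j" for i j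
  proof (rule equals0I)
    fix d assume "d \<in> Wc i \<inter> Wc j"
    then have "d \<in> Mo" "\<kappa> ` d \<subseteq> {i}" "\<kappa> ` d \<subseteq> {j}" using W(1) by (auto simp: Wc_def)
    then show False using same ij by metis
  qed
  have "W = (\<Union>i<p. Wc i)"
  proof (intro equalityI subsetI)
    fix d assume d: "d \<in> W"
    then obtain i where "i < p" "\<kappa> ` d \<subseteq> {i}" using colour W(1) by blast
    then show "d \<in> (\<Union>i<p. Wc i)" using d by (auto simp: Wc_def)
  qed (auto simp: Wc_def)
  moreover have "card (\<Union>i<p. Wc i) = (\<Sum>i<p. card (Wc i))"
    using fWc disWc by (intro card_UN_disjoint) auto
  ultimately have cW: "card W = (\<Sum>i<p. card (Wc i))" by simp
  obtain i0 where i0: "i0 < p" "\<And>i. i < p \<Longrightarrow> card (Wc i0) \<le> card (Wc i)"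
    using ex_has_least_nat[of "\<lambda>i. i < p" 0 "\<lambda>i. card (Wc i)"] p by auto
  define Wr where "Wr = W - Wc i0"
  define c where "c = card Wr"
  have cWr: "card W = c + card (Wc i0)"
  proof -
    have "Wc i0 \<subseteq> W" by (auto simp: Wc_def)
    then show ?thesis using fW fWc[of i0] card_mono[of W "Wc i0"]
      by (simp add: c_def Wr_def card_Diff_subset)
  qed
  have c_sum: "c = (\<Sum>i\<in>{..<p} - {i0}. card (Wc i))"
    using cW cWr i0(1) by (simp add: sum.remove)
  \<comment> \<open>At least two other classes have a share no smaller than this one. The factor two
    ensures that the vertex set \<open>Y\<close> of the smallest share has at most \<open>c\<close>
    elements.\<close>
  have "2 * card (Wc i0) \<le> (p - 1) * card (Wc i0)" using p by (intro mult_le_mono1) simp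
  also have "\<dots> = (\<Sum>i\<in>{..<p} - {i0}. card (Wc i0))" using i0(1) by simp
  also have "\<dots> \<le> c" unfolding c_sum using i0(2) by (intro sum_mono) auto
  finally have small: "2 * card (Wc i0) \<le> c" .
  have Wr: "finite Wr" "Wr \<subseteq> edges L" "pairwise disjnt Wr" "Wr \<subseteq> Mo"
    using fW W(1,2) by (auto simp: Wr_def Mo_def pairwise_def)
  have Wrc: "d \<subseteq> R \<and> (\<exists>j. j \<noteq> i0 \<and> \<kappa> ` d \<subseteq> {j})" if d: "d \<in> Wr" for d
  proof -
    obtain j where j: "\<kappa> ` d \<subseteq> {j}" "d \<subseteq> R" using d Wr(4) by (auto simp: Mo_def)
    then have "j \<noteq> i0" using d by (auto simp: Wr_def Wc_def)
    then show ?thesis using j by blast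
  qed
  have cK: "c \<le> K" unfolding c_def using avoid[OF i0(1) Wr(1-3)] Wrc by blast
  define Mo0 where "Mo0 = {e \<in> Mo. \<kappa> ` e \<subseteq> {i0}}"
  define Y where "Y = \<Union> (Wc i0)"
  have YR: "Y \<subseteq> R" and Y\<kappa>: "\<And>x. x \<in> Y \<Longrightarrow> \<kappa> x = i0"
    using W(1) by (auto simp: Y_def Wc_def Mo_def)
  have fY: "finite Y" using YR fR finite_subset by blast
  have cY: "card Y \<le> c"
  proof -
    have "card Y \<le> (\<Sum>d\<in>Wc i0. card d)" unfolding Y_def using fWc card_UN_le[of "Wc i0" id] by simp
    also have "\<dots> = (\<Sum>d\<in>Wc i0. 2)" using W(1) two by (intro sum.cong) (auto simp: Wc_def)
    finally show ?thesis using small by simp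
  qed
  define Nz where "Nz x = {z \<in> R. \<kappa> z = \<kappa> x \<and> {x, z} \<in> edges L}" for x
  define bad where "bad x = {z \<in> R. \<kappa> z \<noteq> i0 \<and> {x, z} \<notin> edges L}" for x
  have fN: "finite (Nz x)" "finite (bad x)" for x using fR by (simp_all add: Nz_def bad_def)
  have "Mo0 \<subseteq> (\<Union>x\<in>Y. (\<lambda>z. {x, z}) ` Nz x)"
  proof
    fix e assume e: "e \<in> Mo0"
    then have eM: "e \<in> Mo" "\<kappa> ` e \<subseteq> {i0}" by (simp_all add: Mo0_def)
    obtain x d where x: "x \<in> e" "d \<in> W" "x \<in> d" using bspec[OF W(3) eM(1)] by blast
    have "d \<in> Mo" using x(2) W(1) by blast
    then obtain j where "\<kappa> ` d \<subseteq> {j}" by (auto simp: Mo_def)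
    moreover have "\<kappa> x = i0" using x(1) eM(2) by blast
    ultimately have "d \<in> Wc i0" using x by (auto simp: Wc_def)
    then have "x \<in> Y" using x(3) by (auto simp: Y_def)
    have eL: "e \<in> edges L" "e \<subseteq> R" using eM(1) by (simp_all add: Mo_def)
    obtain a b where "e = {a, b}" using simple_graph_edgeE[OF L eL(1)] by metis
    then obtain z where z: "e = {x, z}" using x(1) by blast
    then have "z \<in> Nz x" using eL eM(2) by (auto simp: Nz_def)
    then show "e \<in> (\<Union>x\<in>Y. (\<lambda>z. {x, z}) ` Nz x)" using z \<open>x \<in> Y\<close> by blast
  qed
  then have "card Mo0 \<le> card (\<Union>x\<in>Y. (\<lambda>z. {x, z}) ` Nz x)" using fY fN by (intro card_mono) auto
  also have "\<dots> \<le> (\<Sum>x\<in>Y. card ((\<lambda>z. {x, z}) ` Nz x))" by (rule card_UN_le[OF fY])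
  also have "\<dots> \<le> (\<Sum>x\<in>Y. card (Nz x))" using fN by (intro sum_mono card_image_le)
  finally have cMo0: "card Mo0 \<le> (\<Sum>x\<in>Y. card (Nz x))" .
  have net: "card (Nz x) \<le> (K - c) + card (bad x)" if x: "x \<in> Y" for x
  proof -
    \<comment> \<open>Matching edges completely joined to \<open>x\<close> count in the star bound;
      each of the others contains a non-neighbour of \<open>x\<close>, and these are distinct
      because the edges are disjoint.\<close>
    define Wx where "Wx = {d \<in> Wr. \<forall>u\<in>d. {x, u} \<in> edges L}"
    have "\<exists>u. u \<in> d \<and> u \<in> bad x" if d: "d \<in> Wr - Wx" for d
    proof -
      obtain u where "u \<in> d" "{x, u} \<notin> edges L" using d by (auto simp: Wx_def)
      moreover have "u \<in> R" "\<kappa> u \<noteq> i0" using Wrc[of d] d \<open>u \<in> d\<close> by auto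
      ultimately show ?thesis by (auto simp: bad_def)
    qed
    then obtain u where u: "\<And>d. d \<in> Wr - Wx \<Longrightarrow> u d \<in> d \<and> u d \<in> bad x" by metis
    have "inj_on u (Wr - Wx)"
    proof (rule inj_onI, rule ccontr)
      fix d d' assume d: "d \<in> Wr - Wx" "d' \<in> Wr - Wx" "u d = u d'" "d \<noteq> d'"
      then have "disjnt d d'" using Wr(3) by (simp add: pairwise_def)
      then show False using u[OF d(1)] u[OF d(2)] d(3) by (auto simp: disjnt_def)
    qed
    then have "card (Wr - Wx) \<le> card (bad x)" using u fN(2) by (intro card_inj_on_le[of u]) auto
    moreover have "card (Wr - Wx) = c - card Wx"
      using Wr(1) by (simp add: c_def Wx_def card_Diff_subset)
    moreover have "card (Nz x) + card Wx \<le> K"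
    proof (rule star)
      show "x \<in> R" using x YR by blast
      show "finite (Nz x)" by (rule fN)
      show "\<forall>z\<in>Nz x. z \<in> R \<and> \<kappa> z = \<kappa> x \<and> {x, z} \<in> edges L" by (simp add: Nz_def)
      show "finite Wx" "Wx \<subseteq> edges L" "pairwise disjnt Wx"
        using Wr by (auto simp: Wx_def pairwise_def)
      show "\<forall>d\<in>Wx. d \<subseteq> R \<and> (\<exists>j. j \<noteq> \<kappa> x \<and> \<kappa> ` d \<subseteq> {j})"
        using Wrc Y\<kappa>[OF x] by (simp add: Wx_def)
      show "\<forall>d\<in>Wx. \<forall>u\<in>d. {x, u} \<in> edges L" by (simp add: Wx_def)
    qed
    ultimately show ?thesis using cK by linarith
  qed
  have "(\<Sum>x\<in>Y. card (Nz x)) \<le> (\<Sum>x\<in>Y. (K - c) + card (bad x))" by (rule sum_mono) (rule net)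
  also have "\<dots> = card Y * (K - c) + (\<Sum>x\<in>Y. card (bad x))" by (simp add: sum.distrib)
  \<comment> \<open>Each counted pair has exactly one end of colour \<open>i0\<close>, so no missing
    pair is counted for two vertices of \<open>Y\<close>.\<close>
  also have "(\<Sum>x\<in>Y. card (bad x)) \<le> card (cross_pairs \<kappa> R - edges L)"
  proof -
    let ?P = "SIGMA x:Y. bad x"
    have "inj_on (\<lambda>(x, z). {x, z}) ?P"
      using Y\<kappa> by (auto simp: inj_on_def bad_def doubleton_eq_iff)
    moreover have "(\<lambda>(x, z). {x, z}) ` ?P \<subseteq> cross_pairs \<kappa> R - edges L"
    proof
      fix e assume "e \<in> (\<lambda>(x, z). {x, z}) ` ?P"
      then obtain x z where e: "e = {x, z}" "x \<in> Y" "z \<in> bad x" by auto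
      then have "x \<in> R" "z \<in> R" "\<kappa> x \<noteq> \<kappa> z" "{x, z} \<notin> edges L"
        using YR Y\<kappa>[of x] by (auto simp: bad_def)
      then show "e \<in> cross_pairs \<kappa> R - edges L" unfolding e(1) cross_pairs_def by blast
    qed
    ultimately have "card ?P \<le> card (cross_pairs \<kappa> R - edges L)"
      using finite_cross_pairs[OF fR] by (intro card_inj_on_le[of "\<lambda>(x, z). {x, z}"]) auto
    then show ?thesis using fY fN by simp
  qed
  also have "card Y * (K - c) \<le> (K - c) * K" using cY cK by (simp add: mult.commute)
  finally have b0: "card Mo0 \<le> (K - c) * K + card (cross_pairs \<kappa> R - edges L)" using cMo0 by linarith
  \<comment> \<open>The monochromatic edges of the remaining classes. A matching among them together
    with \<open>Wc i0\<close> is again a monochromatic matching, which limits it to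
    \<open>c\<close>; the star bound without matching edges limits the degrees to
    \<open>K\<close>.\<close>
  define Lr where "Lr = Graph (verts L) (Mo - Mo0)"
  have sel: "verts Lr = verts L" "edges Lr = Mo - Mo0" by (simp_all add: Lr_def)
  have sLr: "simple_graph Lr" using L by (auto simp: simple_graph_def sel Mo_def)
  have "matching_number Lr \<le> c"
  proof (rule matching_number_le[OF sLr])
    fix V assume "matching Lr V"
    then have V: "V \<subseteq> Mo - Mo0" "pairwise disjnt V" by (simp_all add: matching_def sel)
    have fV: "finite V" using V(1) fMo finite_subset by blast
    have dis: "disjnt d e" if d: "d \<in> V" and e: "e \<in> Wc i0" for d e
    proof -
      have "d \<in> Mo" "\<not> \<kappa> ` d \<subseteq> {i0}" using d V(1) by (auto simp: Mo0_def)
      then obtain j where "\<kappa> ` d \<subseteq> {j}" "j \<noteq> i0" by (auto simp: Mo_def)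
      moreover have "\<kappa> ` e \<subseteq> {i0}" using e by (simp add: Wc_def)
      ultimately show ?thesis by (auto simp: disjnt_def)
    qed
    have "pairwise disjnt (V \<union> Wc i0)"
    proof (rule pairwiseI)
      fix d e assume de: "d \<in> V \<union> Wc i0" "e \<in> V \<union> Wc i0" "d \<noteq> e"
      consider "d \<in> V" "e \<in> V" | "d \<in> Wc i0" "e \<in> Wc i0" | "d \<in> V" "e \<in> Wc i0" | "e \<in> V" "d \<in> Wc i0"
        using de by blast
      then show "disjnt d e"
      proof cases
        case 1 then show ?thesis using V(2) de(3) by (simp add: pairwise_def)
      next
        case 2 then show ?thesis using W(2) de(3) by (simp add: pairwise_def Wc_def)
      next
        case 3 then show ?thesis by (rule dis)
      next
        case 4 then show ?thesis using dis disjnt_sym by blast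
      qed
    qed
    moreover have "V \<union> Wc i0 \<subseteq> Mo" using V(1) W(1) by (auto simp: Wc_def)
    ultimately have "card (V \<union> Wc i0) \<le> card W" using W(4) by blast
    moreover have "V \<inter> Wc i0 = {}" using V(1) W(1) by (auto simp: Wc_def Mo0_def)
    ultimately show "card V \<le> c" using fV fWc[of i0] cWr by (simp add: card_Un_disjoint)
  qed
  moreover have "degree Lr x \<le> K" for x
  proof (cases "x \<in> R")
    case True
    have "{e \<in> Mo - Mo0. x \<in> e} \<subseteq> (\<lambda>z. {x, z}) ` Nz x"
    proof
      fix e assume "e \<in> {e \<in> Mo - Mo0. x \<in> e}"
      then have e: "e \<in> edges L" "e \<subseteq> R" "x \<in> e" "\<exists>i. \<kappa> ` e \<subseteq> {i}" by (auto simp: Mo_def)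
      obtain a b where "e = {a, b}" using simple_graph_edgeE[OF L e(1)] by metis
      then obtain z where z: "e = {x, z}" using e(3) by blast
      then have "z \<in> Nz x" using e by (auto simp: Nz_def)
      then show "e \<in> (\<lambda>z. {x, z}) ` Nz x" using z by blast
    qed
    then have "degree Lr x \<le> card ((\<lambda>z. {x, z}) ` Nz x)"
      unfolding degree_def sel using fN by (intro card_mono) auto
    also have "\<dots> \<le> card (Nz x)" using fN by (intro card_image_le)
    also have "card (Nz x) + card ({} :: nat set set) \<le> K"
      using True fN by (intro star[of x]) (auto simp: Nz_def)
    then have "card (Nz x) \<le> K" by simp
    finally show ?thesis .
  next
    case False
    then have "{e \<in> Mo - Mo0. x \<in> e} = {}" by (auto simp: Mo_def)
    then show ?thesis unfolding degree_def sel by (simp only: card.empty zero_le)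
  qed
  ultimately have "Lr \<in> bounded_graphs c K" using sLr by (simp add: bounded_graphs_def)
  then have "card (Mo - Mo0) \<le> f_edges c K" using f_edges_ge sel(2) by metis
  \<comment> \<open>The (K - c)K edges charged to class \<open>i0\<close> are as many as those of K
    - c disjoint stars with K leaves.\<close>
  moreover have "f_edges c K + (K - c) * K \<le> f_edges K K" using f_edges_add[of c K "K - c"] cK by simp
  moreover have "card Mo = card Mo0 + card (Mo - Mo0)"
  proof -
    have "Mo0 \<subseteq> Mo" by (auto simp: Mo0_def)
    then show ?thesis using fMo finite_subset[of Mo0 Mo] card_mono[of Mo Mo0] by (simp add: card_Diff_subset)
  qed
  ultimately show ?thesis using b0 unfolding Mo_def[symmetric] by linarith
qed

section \<open>Lower bounds\<close>

lemma verts_join: "verts (join Q T) = verts Q <+> verts T"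
  by (simp add: join_def)

lemma edges_join: "edges (join Q T) =
    ((\<lambda>e. Inl ` e) ` edges Q \<union> (\<lambda>e. Inr ` e) ` edges T) \<union> (\<lambda>(x, y). {Inl x, Inr y}) ` (verts Q \<times> verts T)"
  unfolding join_def disjoint_union_def graph.sel by (rule arg_cong2[of _ _ _ _ "(\<union>)"]) auto

lemma edges_join_cases:
  assumes "d \<in> edges (join Q T)"
  obtains e where "e \<in> edges Q" "d = Inl ` e" | e where "e \<in> edges T" "d = Inr ` e"
    | x y where "x \<in> verts Q" "y \<in> verts T" "d = {Inl x, Inr y}"
  using assms unfolding edges_join by auto

lemma edges_joinI:
  "e \<in> edges Q \<Longrightarrow> Inl ` e \<in> edges (join Q T)"
  "d \<in> edges T \<Longrightarrow> Inr ` d \<in> edges (join Q T)"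
  "x \<in> verts Q \<Longrightarrow> y \<in> verts T \<Longrightarrow> {Inl x, Inr y} \<in> edges (join Q T)"
  unfolding edges_join by blast+

lemma simple_join:
  assumes "simple_graph Q" "simple_graph T" shows "simple_graph (join Q T)"
  unfolding simple_graph_def
proof (intro conjI ballI)
  show "finite (verts (join Q T))" using assms by (simp add: verts_join simple_graph_def)
  fix d assume "d \<in> edges (join Q T)"
  then have "d \<subseteq> verts (join Q T) \<and> card d = 2"
  proof (cases rule: edges_join_cases)
    case (1 e)
    then show ?thesis
      using simple_graphD(2,3)[OF assms(1) 1(1)] by (auto simp: verts_join card_image)
  next
    case (2 e)
    then show ?thesis
      using simple_graphD(2,3)[OF assms(2) 2(1)] by (auto simp: verts_join card_image)
  next
    case (3 x y) then show ?thesis by (auto simp: verts_join)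
  qed
  then show "d \<subseteq> verts (join Q T)" "card d = 2" by simp_all
qed

lemma card_edges_join:
  fixes Q :: "'b graph" and T :: "'c graph"
  assumes Q: "simple_graph Q" and T: "simple_graph T"
  shows "card (edges (join Q T)) = card (edges Q) + card (edges T) + card (verts Q) * card (verts T)"
proof -
  let ?A = "(\<lambda>e. Inl ` e) ` edges Q :: ('b + 'c) set set"
  let ?B = "(\<lambda>e. Inr ` e) ` edges T :: ('b + 'c) set set"
  let ?C = "(\<lambda>(x, y). {Inl x, Inr y}) ` (verts Q \<times> verts T) :: ('b + 'c) set set"
  have "inj_on (\<lambda>e. Inl ` e) (edges Q)" by (simp add: inj_on_def inj_image_eq_iff)
  then have a: "card ?A = card (edges Q)" by (rule card_image)
  have "inj_on (\<lambda>e. Inr ` e) (edges T)" by (simp add: inj_on_def inj_image_eq_iff)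
  then have b: "card ?B = card (edges T)" by (rule card_image)
  have "inj_on (\<lambda>(x, y). {Inl x, Inr y}) (verts Q \<times> verts T)"
    by (auto simp: inj_on_def doubleton_eq_iff)
  then have c: "card ?C = card (verts Q) * card (verts T)"
    by (simp add: card_image card_cartesian_product)
  have fin: "finite ?A" "finite ?B" "finite ?C"
    using finite_edges[OF Q] finite_edges[OF T] simple_graphD(1)[OF Q] simple_graphD(1)[OF T] by simp_all
  have AB: "?A \<inter> ?B = {}"
  proof (rule equals0I)
    fix d assume "d \<in> ?A \<inter> ?B"
    then obtain e e' where e: "e \<in> edges Q" "d = Inl ` e" "d = Inr ` e'" by blast
    then have "e = {}" by blast
    then show False using simple_graphD(3)[OF Q e(1)] by simp
  qed
  have ABC: "(?A \<union> ?B) \<inter> ?C = {}"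
  proof (rule equals0I)
    fix d assume "d \<in> (?A \<union> ?B) \<inter> ?C"
    then obtain x y where d: "d = {Inl x, Inr y}" "d \<in> ?A \<or> d \<in> ?B" by auto
    have "Inr y \<notin> Inl ` e" "Inl x \<notin> Inr ` e'" for e e' by auto
    then show False using d by blast
  qed
  have "card (edges (join Q T)) = card (?A \<union> ?B) + card ?C"
    unfolding edges_join by (rule card_Un_disjoint[OF finite_UnI[OF fin(1,2)] fin(3) ABC])
  also have "card (?A \<union> ?B) = card ?A + card ?B" by (rule card_Un_disjoint[OF fin(1,2) AB])
  finally show ?thesis by (simp only: a b c)
qed

lemma simple_turan: "simple_graph (turan_graph p n)"
proof -
  have "card {i, j} = 2" if "i mod p \<noteq> j mod p" for i j
    using that by (metis card_2_iff)
  then show ?thesis unfolding simple_graph_def turan_graph_def by auto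
qed

lemma verts_turan: "verts (turan_graph p n) = {..<n}"
  by (simp add: turan_graph_def)

lemma simple_complete: "simple_graph (complete_graph m)"
  by (auto simp: simple_graph_def complete_graph_def)

lemma simple_edgeless: "simple_graph (edgeless_graph m)"
  by (auto simp: simple_graph_def edgeless_graph_def)

text \<open>One part of the Turan graph is absorbed into the left operand of the join.\<close>

lemma embeds_join_turan:
  fixes Q :: "'b graph"
  assumes p: "p \<ge> 2"
  shows "embeds (join Q (turan_graph p n))
    (join (disjoint_union (join Q (edgeless_graph n)) (edgeless_graph n)) (turan_graph (p - 1) ((p - 1) * n)))"
    (is "embeds ?J (join (disjoint_union ?F ?K) ?T)")
proof -
  \<comment> \<open>Residue class 0 is the absorbed part. The residues 1, ..., p - 1 modulo p are
    shifted to 0, ..., p - 2 modulo p - 1, with the quotient kept.\<close>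
  define r where "r j = (p - 1) * (j div p) + (j mod p - 1)" for j
  define \<psi> :: "'b + nat \<Rightarrow> (('b + nat) + nat) + nat" where
    "\<psi> v = (case v of Inl x \<Rightarrow> Inl (Inl (Inl x))
      | Inr j \<Rightarrow> if j mod p = 0 then Inl (Inl (Inr j)) else Inr (r j))" for v
  have modp: "j mod p < p" for j using p by simp
  have rmod: "r j mod (p - 1) = j mod p - 1" if "j mod p \<noteq> 0" for j
  proof -
    have "j mod p - 1 < p - 1" using that modp[of j] by linarith
    then show ?thesis by (simp only: r_def mod_mult_self4 mod_less)
  qed
  have rdiv: "r j div (p - 1) = j div p" if "j mod p \<noteq> 0" for j
  proof -
    have "j mod p - 1 < p - 1" using that modp[of j] by linarith
    then show ?thesis by (simp add: r_def)
  qed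
  have rlt: "r j < (p - 1) * n" if "j mod p \<noteq> 0" "j < n" for j
  proof -
    have "j div p < n" using that(2) by (meson div_le_dividend le_less_trans)
    then have "(p - 1) * Suc (j div p) \<le> (p - 1) * n" by (intro mult_le_mono2) simp
    moreover have "j mod p - 1 < p - 1" using that(1) modp[of j] by linarith
    ultimately show ?thesis by (simp add: r_def)
  qed
  have rinj: "i = j" if "r i = r j" "i mod p \<noteq> 0" "j mod p \<noteq> 0" for i j
  proof -
    have "i div p = j div p" using rdiv that by metis
    moreover have "i mod p - 1 = j mod p - 1" using rmod that by metis
    then have "i mod p = j mod p" using that(2,3) by linarith
    ultimately show ?thesis by (metis mult_div_mod_eq)
  qed
  have inj: "inj_on \<psi> (verts ?J)"
  proof (rule inj_onI)
    fix u v assume "\<psi> u = \<psi> v"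
    then show "u = v"
      by (cases u; cases v) (auto simp: \<psi>_def rinj split: if_splits)
  qed
  have sub: "\<psi> v \<in> verts (join (disjoint_union ?F ?K) ?T)" if v: "v \<in> verts ?J" for v
  proof (cases v)
    case (Inl x)
    then have "x \<in> verts Q" using v by (auto simp: verts_join)
    then show ?thesis
      using Inl by (auto simp: \<psi>_def verts_join disjoint_union_def)
  next
    case (Inr j)
    then have "j < n" using v by (auto simp: verts_join verts_turan)
    then show ?thesis
      using Inr rlt[of j] by (auto simp: \<psi>_def verts_join disjoint_union_def edgeless_graph_def turan_graph_def)
  qed
  have zero: "Inl (Inr j) \<in> verts ?F <+> verts ?K" if "j < n" for j
    using that by (auto simp: verts_join edgeless_graph_def)
  have cross: "{Inl (Inl (Inr i)), Inr (r j)} \<in> edges (join (disjoint_union ?F ?K) ?T)"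
    if "i < n" "j < n" "j mod p \<noteq> 0" for i j
  proof (rule join_disjoint_union_edgesI(3)[OF zero[OF that(1)]])
    show "r j \<in> verts ?T" using rlt[OF that(3,2)] by (simp add: verts_turan)
  qed
  have edge: "\<psi> ` d \<in> edges (join (disjoint_union ?F ?K) ?T)" if d: "d \<in> edges ?J" for d
    using d
  proof (cases rule: edges_join_cases)
    case (1 e)
    then have "\<psi> ` d = Inl ` Inl ` Inl ` e" by (simp add: image_image \<psi>_def)
    moreover have "Inl ` e \<in> edges ?F" by (rule edges_joinI(1)[OF 1(1)])
    ultimately show ?thesis using join_disjoint_union_edgesI(1) by metis
  next
    case (2 e)
    then obtain i j where ij: "e = {i, j}" "i < n" "j < n" "i mod p \<noteq> j mod p"
      by (auto simp: turan_graph_def)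
    have im: "\<psi> ` d = {\<psi> (Inr i), \<psi> (Inr j)}" using 2 ij by simp
    consider "i mod p = 0" "j mod p \<noteq> 0" | "j mod p = 0" "i mod p \<noteq> 0"
      | "i mod p \<noteq> 0" "j mod p \<noteq> 0" using ij by linarith
    then show ?thesis
    proof cases
      case 1 then show ?thesis unfolding im using cross[of i j] ij by (simp add: \<psi>_def)
    next
      case 2
      then show ?thesis unfolding im using cross[of j i] ij by (simp add: \<psi>_def insert_commute)
    next
      case 3
      then have "r i mod (p - 1) \<noteq> r j mod (p - 1)" using rmod ij(4) by (metis Suc_pred neq0_conv One_nat_def)
      then have "{r i, r j} \<in> edges ?T"
        using rlt[of i] rlt[of j] ij 3 unfolding turan_graph_def graph.sel by blast
      then have "Inr ` {r i, r j} \<in> edges (join (disjoint_union ?F ?K) ?T)"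
        by (rule join_disjoint_union_edgesI(2))
      then show ?thesis unfolding im using 3 by (simp add: \<psi>_def)
    qed
  next
    case (3 x j)
    then have j: "j < n" by (simp add: verts_turan)
    have im: "\<psi> ` d = {Inl (Inl (Inl x)), \<psi> (Inr j)}" using 3 by (simp add: \<psi>_def)
    show ?thesis
    proof (cases "j mod p = 0")
      case True
      have "{Inl x, Inr j} \<in> edges ?F" using 3 j by (intro edges_joinI(3)) (simp_all add: edgeless_graph_def)
      then have "Inl ` Inl ` {Inl x, Inr j} \<in> edges (join (disjoint_union ?F ?K) ?T)"
        by (rule join_disjoint_union_edgesI(1))
      then show ?thesis unfolding im using True by (simp add: \<psi>_def)
    next
      case False
      have "{Inl (Inl (Inl x)), Inr (r j)} \<in> edges (join (disjoint_union ?F ?K) ?T)"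
        using 3 rlt[OF False j] by (intro join_disjoint_union_edgesI(3)) (auto simp: verts_join verts_turan)
      then show ?thesis unfolding im using False by (simp add: \<psi>_def)
    qed
  qed
  show ?thesis unfolding embeds_def using inj sub edge by (intro exI[of _ \<psi>]) blast
qed

section \<open>The joins with a Turan graph and the lower bound\<close>

context edge_blowup_setting
begin

abbreviation \<B> where "\<B> \<equiv> B_family \<M>"

definition small_coverings :: "(nat graph \<times> nat set) set" where
  "small_coverings = {(F, U). F \<in> \<M> \<and> covering F U \<and> card U \<le> q - 1}"

lemma \<B>_eq: "\<B> = (if small_coverings = {} then {complete_graph q}
    else {remove_isolated (induced_subgraph F U) | F U. (F, U) \<in> small_coverings})"
  unfolding B_family_def small_coverings_def Let_def by (rule refl)

text \<open>By minimality of \<open>q\<close>, a covering with fewer than \<open>q\<close> vertices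
  is not independent. Hence the graphs of \<open>\<B>\<close> that come from such coverings have
  edges.\<close>

lemma small_covering_edge:
  assumes "(F, U) \<in> small_coverings" shows "\<exists>e\<in>edges F. e \<subseteq> U"
proof (rule ccontr)
  assume no: "\<not> (\<exists>e\<in>edges F. e \<subseteq> U)"
  have F: "F \<in> \<M>" "covering F U" "card U \<le> q - 1" using assms by (auto simp: small_coverings_def)
  then have "independent_covering F U"
    using no by (auto simp: independent_covering_def independent_def covering_def)
  then have "q \<le> card U" by (rule q_family_le[OF F(1)])
  then show False using F(3) q_pos by linarith
qed

text \<open>Makes \<open>ex_num (q - 1) \<B>\<close> a maximum over a nonempty set. In the default
  case the number of vertices of K_q decides, which also settles q = 1, where K_q has no
  edge.\<close>

lemma edgeless_free: "edgeless_graph (q - 1) \<in> free_graphs (q - 1) \<B>"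
proof -
  have "\<not> embeds F (edgeless_graph (q - 1))" if F: "F \<in> \<B>" for F
  proof
    assume "embeds F (edgeless_graph (q - 1))"
    then obtain f where f: "inj_on f (verts F)" "f ` verts F \<subseteq> {..<q - 1}" "\<forall>e\<in>edges F. f ` e \<in> {}"
      by (auto simp: embeds_def edgeless_graph_def)
    show False
    proof (cases "small_coverings = {}")
      case True
      then have "F = complete_graph q" using F unfolding \<B>_eq by simp
      then have "card {..<q} \<le> card {..<q - 1}"
        using f(1,2) by (intro card_inj_on_le[of f]) (simp_all add: complete_graph_def)
      then show False using q_pos by simp
    next
      case False
      then obtain F' U where FU: "(F', U) \<in> small_coverings" "F = remove_isolated (induced_subgraph F' U)"
        using F unfolding \<B>_eq by auto
      obtain e where "e \<in> edges F'" "e \<subseteq> U" using small_covering_edge[OF FU(1)] by blast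
      then have "e \<in> edges F" by (simp add: FU(2) remove_isolated_def induced_subgraph_def)
      then show False using f(3) by blast
    qed
  qed
  then show ?thesis by (simp add: free_graphs_def simple_edgeless) (simp add: edgeless_graph_def)
qed

text \<open>Absorbing one Turan part turns \<open>Q\<close> joined to an edgeless graph into a
  decomposing graph. A member of the family inside it is covered by its at most q - 1 vertices in
  \<open>Q\<close>, so \<open>Q\<close> would contain the graph of \<open>\<B>\<close> induced by
  this covering.\<close>

lemma join_turan_free:
  assumes Q: "Q \<in> free_graphs (q - 1) \<B>" shows "\<not> embeds H (join Q (turan_graph p n))"
proof
  assume emb: "embeds H (join Q (turan_graph p n))"
  have sQ: "simple_graph Q" "card (verts Q) = q - 1" and Qfree: "\<And>F. F \<in> \<B> \<Longrightarrow> \<not> embeds F Q"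
    using Q by (auto simp: free_graphs_def)
  let ?F = "join Q (edgeless_graph n)"
  have p2: "2 \<le> p" using p by simp
  have "decomposes p H ?F"
    unfolding decomposes_def
    using embeds_trans[OF emb embeds_join_turan[OF p2] simple_graphD(2)[OF H]] by blast
  then obtain F where F: "F \<in> \<M>" "embeds F ?F"
    by (rule decomposition_family_below[OF H simple_join[OF sQ(1) simple_edgeless]])
  obtain f where f: "inj_on f (verts F)" "f ` verts F \<subseteq> verts ?F" "\<forall>e\<in>edges F. f ` e \<in> edges ?F"
    using F(2) by (auto simp: embeds_def)
  have sF: "simple_graph F" by (rule \<M>_simple[OF F(1)])
  define U where "U = {u \<in> verts F. \<exists>x. f u = Inl x}"
  have fU: "f u = Inl (projl (f u))" if "u \<in> U" for u using that by (auto simp: U_def)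
  have cov: "covering F U"
  proof -
    have "e \<inter> U \<noteq> {}" if e: "e \<in> edges F" for e
    proof -
      have "f ` e \<in> edges ?F" using f(3) e by blast
      then have "\<exists>x. Inl x \<in> f ` e"
      proof (cases rule: edges_join_cases)
        case (1 d)
        then have "d \<noteq> {}" using simple_graphD(3)[OF sQ(1) 1(1)] by auto
        then show ?thesis using 1 by auto
      next
        case (2 d) then show ?thesis by (simp add: edgeless_graph_def)
      next
        case (3 x y) then show ?thesis by auto
      qed
      then obtain x where "Inl x \<in> f ` e" by blast
      then obtain u where "u \<in> e" "f u = Inl x" by (metis imageE)
      then have "u \<in> e \<inter> U" using simple_graphD(2)[OF sF e] by (auto simp: U_def)
      then show ?thesis by blast
    qed
    then show ?thesis by (auto simp: covering_def U_def)
  qed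
  define g where "g u = projl (f u)" for u
  have gV: "g u \<in> verts Q" if u: "u \<in> U" for u
  proof -
    have "u \<in> verts F" using u by (simp add: U_def)
    then have "f u \<in> verts ?F" using f(2) by blast
    then show ?thesis using fU[OF u] by (auto simp: g_def verts_join)
  qed
  have ginj: "inj_on g U"
  proof (rule inj_onI)
    fix u v assume uv: "u \<in> U" "v \<in> U" "g u = g v"
    then have "f u = f v" using fU by (metis g_def)
    then show "u = v" using f(1) uv by (auto simp: inj_on_def U_def)
  qed
  have "card U \<le> card (verts Q)"
    using ginj gV simple_graphD(1)[OF sQ(1)] by (intro card_inj_on_le[of g]) auto
  then have FU: "(F, U) \<in> small_coverings" using F(1) cov sQ(2) by (simp add: small_coverings_def)
  have "g ` e \<in> edges Q" if e: "e \<in> edges F" "e \<subseteq> U" for e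
  proof -
    have "f ` e \<in> edges ?F" using f(3) e(1) by blast
    then show ?thesis
    proof (cases rule: edges_join_cases)
      case (1 d)
      have "g ` e = projl ` f ` e" by (simp add: g_def image_image)
      also have "\<dots> = d" using 1 by (simp add: image_image)
      finally show ?thesis using 1 by simp
    next
      case (2 d) then show ?thesis by (simp add: edgeless_graph_def)
    next
      case (3 x y)
      then obtain u where "u \<in> e" "f u = Inr y" by (metis imageE insertI1 insert_commute)
      then show ?thesis using fU[of u] e(2) by auto
    qed
  qed
  moreover have "\<Union> {e \<in> edges F. e \<subseteq> U} \<subseteq> U" by blast
  ultimately have "embeds (remove_isolated (induced_subgraph F U)) Q"
    unfolding embeds_def remove_isolated_def induced_subgraph_def graph.sel
    using ginj gV by (intro exI[of _ g]) (auto intro: inj_on_subset)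
  moreover have "remove_isolated (induced_subgraph F U) \<in> \<B>" using FU unfolding \<B>_eq by auto
  ultimately show False using Qfree by blast
qed

lemma join_turan_counts:
  assumes Q: "simple_graph Q" "card (verts Q) = q - 1" and n: "q \<le> n"
  shows "card (verts (join Q (turan_graph p (n - q + 1)))) = n"
    "card (edges (join Q (turan_graph p (n - q + 1)))) = \<tau> n + card (edges Q)"
proof -
  show "card (verts (join Q (turan_graph p (n - q + 1)))) = n"
    using Q n q_pos simple_graphD(1)[OF Q(1)] by (simp add: verts_join verts_turan card_Plus)
  have "card (edges (turan_graph p (n - q + 1))) = turan_number p (n - q + 1)"
    using p by (intro card_turan_graph) simp
  then show "card (edges (join Q (turan_graph p (n - q + 1)))) = \<tau> n + card (edges Q)"
    using card_edges_join[OF Q(1) simple_turan, of p "n - q + 1"] Q(2) by (simp add: \<tau>_def verts_turan)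
qed

lemma h'_edges_eq: "q \<le> n \<Longrightarrow> h'_edges n p q = \<tau> n"
  using join_turan_counts(2)[of "edgeless_graph (q - 1)" n] simple_edgeless[of "q - 1"]
  by (simp add: h'_edges_def edgeless_graph_def)

lemma h_edges_eq: "q \<le> n \<Longrightarrow> h_edges n p q = \<tau> n + card (edges (complete_graph (q - 1)))"
  using join_turan_counts(2)[of "complete_graph (q - 1)" n] simple_complete[of "q - 1"]
  by (simp add: h_edges_def complete_graph_def)

lemma ex_num_lower:
  assumes "q \<le> n" shows "\<tau> n + ex_num (q - 1) \<B> \<le> ex_num n {H}"
proof -
  have "free_graphs (q - 1) \<B> \<noteq> {}" using edgeless_free by blast
  then obtain Q where Q: "Q \<in> extremal_graphs (q - 1) \<B>" by (rule ex_num_attained)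
  then have Qf: "Q \<in> free_graphs (q - 1) \<B>" "card (edges Q) = ex_num (q - 1) \<B>"
    by (simp_all add: extremal_graphs_def)
  then have sQ: "simple_graph Q" "card (verts Q) = q - 1" by (simp_all add: free_graphs_def)
  show ?thesis
    using card_edges_le_ex_num[OF simple_join[OF sQ(1) simple_turan] join_turan_free[OF Qf(1)]
        simple_graphD(2)[OF H], of "n - q + 1"] join_turan_counts[OF sQ assms] Qf(2)
    by simp
qed

lemma free_graph_exists: "free_graphs n {H} \<noteq> {}"
proof -
  have "\<not> embeds H (edgeless_graph n)"
  proof
    assume "embeds H (edgeless_graph n)"
    then have "edges H = {}" by (auto simp: embeds_def edgeless_graph_def)
    moreover obtain e where e: "e \<in> edges G" using ne by blast
    have "Inl ` e \<in> edges H"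
    proof -
      have "card (Inl ` e :: ('a + 'a set \<times> nat) set) = 2"
        using simple_graphD(3)[OF G e] by (simp add: card_image)
      then show ?thesis using e by (auto simp: edge_blowup_def blowup_clique_def)
    qed
    ultimately show False by blast
  qed
  then have "edgeless_graph n \<in> free_graphs n {H}"
    by (simp add: free_graphs_def simple_edgeless) (simp add: edgeless_graph_def)
  then show ?thesis by blast
qed

section \<open>The structured graphs\<close>

text \<open>A copy of a graph of \<open>\<B>\<close> among the apices extends to the whole covering
  from which that graph arose, and then \<open>embed_decomposition\<close> produces
  \<open>H\<close>.\<close>

lemma structured_core_free:
  fixes L :: "nat graph"
  assumes C: "configuration L p E B R \<kappa> N l" and cE: "card E = q - 1" and N: "size_bound \<le> N"
    and free: "\<not> embeds H L"
  shows "induced_subgraph L E \<in> free_graphs (q - 1) \<B>"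
proof -
  interpret conf: configuration L p E B R \<kappa> N l by (rule C)
  have sI: "simple_graph (induced_subgraph L E)" by (rule simple_induced[OF conf.L conf.E])
  have "\<not> embeds F (induced_subgraph L E)" if F: "F \<in> \<B>" for F
  proof
    assume "embeds F (induced_subgraph L E)"
    then obtain f where f: "inj_on f (verts F)" "f ` verts F \<subseteq> E" "\<forall>e\<in>edges F. f ` e \<in> edges L"
      by (auto simp: embeds_def induced_subgraph_def)
    show False
    proof (cases "small_coverings = {}")
      case True
      then have "F = complete_graph q" using F unfolding \<B>_eq by simp
      then have "card {..<q} \<le> card E"
        using f(1,2) conf.finite_sets by (intro card_inj_on_le[of f]) (simp_all add: complete_graph_def)
      then show False using q_pos cE by simp
    next
      case False
      then obtain F' U where FU: "(F', U) \<in> small_coverings" "F = remove_isolated (induced_subgraph F' U)"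
        using F unfolding \<B>_eq by auto
      have F': "F' \<in> \<M>" "covering F' U" "card U \<le> q - 1" using FU(1) by (auto simp: small_coverings_def)
      have sF': "simple_graph F'" by (rule \<M>_simple[OF F'(1)])
      have fU: "finite U" using F'(2) simple_graphD(1)[OF sF'] finite_subset by (auto simp: covering_def)
      have VF: "verts F = \<Union> {e \<in> edges F'. e \<subseteq> U}" "edges F = {e \<in> edges F'. e \<subseteq> U}"
        by (simp_all add: FU(2) remove_isolated_def induced_subgraph_def)
      have VU: "verts F \<subseteq> U" unfolding VF by blast
      have fVF: "finite (verts F)" using VU fU finite_subset by blast
      \<comment> \<open>\<open>F\<close> has lost the vertices of \<open>U\<close> without
        neighbours in \<open>U\<close>; since \<open>U\<close> is no larger than \<open>E\<close>,
        enough apices remain to place them injectively.\<close>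
      have "card (U - verts F) \<le> card (E - f ` verts F)"
        using F'(3) cE VU f conf.finite_sets fVF
        by (simp add: card_Diff_subset card_image)
      then obtain g where g: "inj_on g (U - verts F)" "g ` (U - verts F) \<subseteq> E - f ` verts F"
        using card_le_inj[of "U - verts F" "E - f ` verts F"] fU conf.finite_sets by auto
      define \<psi> where "\<psi> u = (if u \<in> verts F then f u else g u)" for u
      have "inj_on \<psi> U"
      proof (rule inj_onI)
        fix u v assume uv: "u \<in> U" "v \<in> U" "\<psi> u = \<psi> v"
        have no: False if "u \<in> verts F" "v \<in> U - verts F" "f u = g v" for u v
          using g(2) that by (metis DiffD2 image_eqI subsetD)
        consider "u \<in> verts F" "v \<in> verts F" | "u \<notin> verts F" "v \<notin> verts F"
          | "u \<in> verts F" "v \<notin> verts F" | "u \<notin> verts F" "v \<in> verts F" by blast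
        then show "u = v"
        proof cases
          case 1 then show ?thesis using uv f(1) by (simp add: \<psi>_def inj_on_eq_iff)
        next
          case 2 then show ?thesis using uv g(1) by (simp add: \<psi>_def inj_on_eq_iff)
        next
          case 3 then show ?thesis using no[of u v] uv by (simp add: \<psi>_def)
        next
          case 4 then show ?thesis using no[of v u] uv by (simp add: \<psi>_def)
        qed
      qed
      moreover have "\<psi> ` U \<subseteq> E"
      proof
        fix x assume "x \<in> \<psi> ` U"
        then obtain u where u: "u \<in> U" "x = \<psi> u" by blast
        show "x \<in> E"
        proof (cases "u \<in> verts F")
          case True then show ?thesis using u f(2) by (auto simp: \<psi>_def)
        next
          case False
          then have "g u \<in> E" using u(1) g(2) by blast
          then show ?thesis using u False by (simp add: \<psi>_def)
        qed
      qed
      moreover have "\<psi> ` e \<in> edges L" if e: "e \<in> edges F'" "e \<subseteq> U" for e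
      proof -
        have "e \<in> edges F" "e \<subseteq> verts F" using e unfolding VF by blast+
        then have "\<psi> ` e = f ` e" by (intro image_cong) (auto simp: \<psi>_def)
        then show ?thesis using f(3) \<open>e \<in> edges F\<close> by simp
      qed
      moreover have "card (verts H) \<le> N" using N by (simp add: size_bound_def)
      moreover have "2 \<le> p" using p by simp
      ultimately have "embeds H L"
        using conf.embed_decomposition[OF H _ \<M>_decomposes[OF F'(1)] F'(2)] by blast
      then show False using free by blast
    qed
  qed
  then show ?thesis using sI cE by (simp add: free_graphs_def) (simp add: induced_subgraph_def)
qed

text \<open>The summands of the edge count with their estimates, in additive form for linear
  arithmetic. Together they bound the excess over \<tau> by the edges inside \<open>E\<close> plus
  the monochromatic edges minus the missing cross pairs.\<close>

lemma structured_edges: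
  assumes C: "configuration L p E B (verts L - E) \<kappa> N l" and cE: "card E = q - 1"
    and n: "q \<le> card (verts L)"
  shows "card (verts L - E) = card (verts L) - q + 1"
    "card (edges L) = edges_within L E + edges_within L (verts L - E) +
      (\<Sum>x\<in>verts L - E. card (neighbours L x \<inter> E))"
    "(\<Sum>x\<in>verts L - E. card (neighbours L x \<inter> E)) \<le> (q - 1) * (card (verts L) - q + 1)"
    "edges_within L (verts L - E) + card (cross_pairs \<kappa> (verts L - E) - edges L) =
      card {e \<in> edges L. e \<subseteq> verts L - E \<and> (\<exists>i. \<kappa> ` e \<subseteq> {i})} + card (cross_pairs \<kappa> (verts L - E))"
    "card (cross_pairs \<kappa> (verts L - E)) \<le> turan_number p (card (verts L) - q + 1)"
proof -
  interpret conf: configuration L p E B "verts L - E" \<kappa> N l by (rule C)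
  let ?R = "verts L - E"
  have fin: "finite E" "finite ?R" by (rule conf.finite_sets)+
  show cR: "card ?R = card (verts L) - q + 1"
    using conf.E fin(1) cE n q_pos by (simp add: card_Diff_subset)
  have "verts L = E \<union> ?R" using conf.E by blast
  then have "card (edges L) = edges_within L (E \<union> ?R)" using edges_within_verts[OF conf.L] by simp
  then show "card (edges L) = edges_within L E + edges_within L ?R + (\<Sum>x\<in>?R. card (neighbours L x \<inter> E))"
    using edges_within_Un[OF conf.L fin] by simp
  have "(\<Sum>x\<in>?R. card (neighbours L x \<inter> E)) \<le> (\<Sum>x\<in>?R. q - 1)"
  proof (rule sum_mono)
    show "card (neighbours L x \<inter> E) \<le> q - 1" for x
      unfolding cE[symmetric] using fin(1) by (intro card_mono) auto
  qed
  then show "(\<Sum>x\<in>?R. card (neighbours L x \<inter> E)) \<le> (q - 1) * (card (verts L) - q + 1)"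
    by (simp add: cR mult.commute)
  let ?M = "{e \<in> edges L. e \<subseteq> ?R \<and> (\<exists>i. \<kappa> ` e \<subseteq> {i})}" and ?C = "cross_pairs \<kappa> ?R"
  have fC: "finite ?C" by (rule finite_cross_pairs[OF fin(2)])
  have notC: "e \<notin> ?C" if "e \<in> ?M" for e
  proof
    assume "e \<in> ?C"
    then obtain x y where "e = {x, y}" "\<kappa> x \<noteq> \<kappa> y" by (auto simp: cross_pairs_def)
    then show False using that by auto
  qed
  have "{e \<in> edges L. e \<subseteq> ?R} = ?M \<union> (?C \<inter> edges L)"
  proof (intro equalityI subsetI)
    fix e assume e: "e \<in> {e \<in> edges L. e \<subseteq> ?R}"
    then have "e \<in> edges L" by simp
    then obtain x y where xy: "e = {x, y}" using simple_graph_edgeE[OF conf.L] by metis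
    show "e \<in> ?M \<union> (?C \<inter> edges L)"
    proof (cases "\<kappa> x = \<kappa> y")
      case True
      then have "\<kappa> ` e \<subseteq> {\<kappa> x}" using xy by simp
      then show ?thesis using e by blast
    next
      case False
      moreover have "x \<in> ?R" "y \<in> ?R" using e xy by auto
      ultimately have "e \<in> ?C" unfolding cross_pairs_def xy by blast
      then show ?thesis using e by blast
    qed
  next
    fix e assume "e \<in> ?M \<union> (?C \<inter> edges L)"
    then show "e \<in> {e \<in> edges L. e \<subseteq> ?R}" by (auto simp: cross_pairs_def)
  qed
  moreover have "?M \<inter> (?C \<inter> edges L) = {}" using notC by blast
  ultimately have "edges_within L ?R = card ?M + card (?C \<inter> edges L)"
    unfolding edges_within_def using finite_edges[OF conf.L] fC by (simp add: card_Un_disjoint)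
  moreover have "card ?C = card (?C \<inter> edges L) + card (?C - edges L)"
    using fC by (metis card_Int_Diff)
  ultimately show "edges_within L ?R + card (?C - edges L) = card ?M + card ?C" by simp
  show "card ?C \<le> turan_number p (card (verts L) - q + 1)"
    using card_cross_pairs_le[of p ?R \<kappa>] conf.\<kappa> fin(2) p cR by simp
qed

text \<open>If \<open>S0\<close> leaves an edge uncovered, q - 1 units of its cost are paid by the
  apices and the last one by a single edge inside a class.\<close>

lemma no_monochromatic_edge:
  assumes C: "configuration L p E B R \<kappa> N l" and cE: "card E = q - 1"
    and N: "size_bound + 2 * card (edges G) * l \<le> N" and free: "\<not> embeds H L"
    and S0: "independent G S0" "cost S0 = q" "uncovered S0 \<noteq> {}"
  shows "{e \<in> edges L. e \<subseteq> R \<and> (\<exists>i. \<kappa> ` e \<subseteq> {i})} = {}"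
proof (rule equals0I)
  interpret conf: configuration L p E B R \<kappa> N l by (rule C)
  fix e assume "e \<in> {e \<in> edges L. e \<subseteq> R \<and> (\<exists>i. \<kappa> ` e \<subseteq> {i})}"
  then obtain i where e: "e \<in> edges L" "e \<subseteq> R" "\<kappa> ` e \<subseteq> {i}" by blast
  obtain x where "x \<in> e" using simple_graphD(3)[OF conf.L e(1)] by fastforce
  then have i: "i < p" using e conf.\<kappa> by blast
  have "card (uncovered S0) \<noteq> 0" using S0(3) finite_uncovered by simp
  then have "card S0 \<le> card E" "card S0 + card {e \<in> edges G. e \<inter> S0 = {}} \<le> card E + card {e}"
    using S0(2) cE by (simp_all add: cost_def uncovered_def)
  then have "embeds H L"
    using conf.embed_matching[OF G bip p S0(1), of "{e}" i] e i N
    by (simp add: size_bound_def)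
  then show False using free by blast
qed

text \<open>Supplies \<open>monochromatic_edges_le\<close> with K = k - 1: as the degree of
  \<open>x0\<close> is at most \<open>k\<close>, a violation of either hypothesis would allow
  \<open>embed_star\<close> at \<open>x0\<close>.\<close>

lemma monochromatic_edges_bound:
  fixes L :: "nat graph"
  assumes C: "configuration L p E B R \<kappa> N l" and cE: "card E = q - 1"
    and N: "size_bound + (2 * card (edges G) + 1) * l < N" and free: "\<not> embeds H L"
    and S0: "independent G S0" "cost S0 = q" "uncovered S0 = {}"
    and x0: "x0 \<in> S0" "degree G x0 \<le> k"
  shows "card {e \<in> edges L. e \<subseteq> R \<and> (\<exists>i. \<kappa> ` e \<subseteq> {i})} \<le>
    card (cross_pairs \<kappa> R - edges L) + f_edges (k - 1) (k - 1)"
proof -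
  interpret conf: configuration L p E B R \<kappa> N l by (rule C)
  have cov: "independent_covering G S0"
    using S0(1,3) by (auto simp: independent_covering_def covering_def uncovered_def independent_def)
  have cS0: "card S0 \<le> card E + 1" using S0(2,3) cE by (simp add: cost_def)
  have NG: "card (verts G) + card (edges G) + (2 * card (edges G) + 1) * l \<le> N"
    using N by (simp add: size_bound_def)
  have star: "card Z + card W \<le> k - 1"
    if y: "y \<in> R" and Z: "finite Z" "\<forall>z\<in>Z. z \<in> R \<and> \<kappa> z = \<kappa> y \<and> {y, z} \<in> edges L"
      and W: "finite W" "W \<subseteq> edges L" "pairwise disjnt W"
      and Wi: "\<forall>d\<in>W. d \<subseteq> R \<and> (\<exists>j. j \<noteq> \<kappa> y \<and> \<kappa> ` d \<subseteq> {j})"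
      and Wy: "\<forall>d\<in>W. \<forall>u\<in>d. {y, u} \<in> edges L" for y Z W
  proof (rule ccontr)
    assume "\<not> card Z + card W \<le> k - 1"
    then have deg: "degree G x0 \<le> card Z + card W" using x0(2) by linarith
    have "embeds H L"
      by (rule conf.embed_star[OF G p cov cS0 x0(1) y Z(1) _ W _ _ deg NG]) (use Z(2) Wi Wy in auto)
    then show False using free by blast
  qed
  have avoid: "card W \<le> k - 1"
    if i: "i < p" and W: "finite W" "W \<subseteq> edges L" "pairwise disjnt W"
      and Wi: "\<forall>d\<in>W. d \<subseteq> R \<and> (\<exists>j. j \<noteq> i \<and> \<kappa> ` d \<subseteq> {j})" for i W
  proof (rule ccontr)
    assume "\<not> card W \<le> k - 1"
    then have "degree G x0 \<le> card W" using x0(2) by linarith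
    \<comment> \<open>Only as many matching edges as the degree of \<open>x0\<close> are kept. Their
      number is then bounded in terms of \<open>G\<close>, so a vertex of core \<open>i\<close>
      joined to all their ends exists and can serve as the centre.\<close>
    then obtain V where V: "V \<subseteq> W" "card V = degree G x0" by (meson obtain_subset_with_card_n)
    have fV: "finite V" using V(1) W(1) finite_subset by blast
    define X where "X = \<Union> V"
    have XR: "X \<subseteq> R" using V(1) Wi by (auto simp: X_def)
    have "card X \<le> (\<Sum>d\<in>V. card d)" unfolding X_def using fV card_UN_le[of V id] by simp
    also have "\<dots> = (\<Sum>d\<in>V. 2)"
      using V(1) W(2) simple_graphD(3)[OF conf.L] by (intro sum.cong) auto
    also have "\<dots> = 2 * degree G x0" by (simp add: V(2))
    also have "\<dots> \<le> 2 * card (edges G)"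
      unfolding degree_def using finite_edges[OF G] by (intro mult_le_mono2 card_mono) auto
    finally have "card X * l \<le> 2 * card (edges G) * l" by (rule mult_le_mono1)
    moreover have "2 * card (edges G) * l \<le> (2 * card (edges G) + 1) * l" by simp
    ultimately have "card (conf.common X i) \<noteq> 0"
      using conf.card_common[OF XR i] N by linarith
    then have "conf.common X i \<noteq> {}" by (metis card.empty)
    then obtain y where y: "y \<in> conf.common X i" by blast
    then have yB: "y \<in> B i" using conf.common_subset by blast
    have yR: "y \<in> R" "\<kappa> y = i" using conf.B(1)[OF i] conf.B(2)[OF i yB] yB by auto
    have Vy: "{y, u} \<in> edges L" if "d \<in> V" "u \<in> d" for d u
    proof -
      have "u \<in> X" using that by (auto simp: X_def)
      moreover have "\<kappa> u \<noteq> i" using that V(1) Wi by blast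
      ultimately have "{u, y} \<in> edges L" using y by (simp add: conf.common_def)
      then show ?thesis by (simp add: insert_commute)
    qed
    have "embeds H L"
    proof (rule conf.embed_star[OF G p cov cS0 x0(1) yR(1) _ _ fV _ _ _ _ _ NG, where Z = "{}"])
      show "V \<subseteq> edges L" "pairwise disjnt V" using V(1) W pairwise_subset by blast+
      show "d \<subseteq> R \<and> (\<exists>j. j \<noteq> \<kappa> y \<and> \<kappa> ` d \<subseteq> {j})" if "d \<in> V" for d
        using that V(1) Wi yR(2) by blast
      show "{y, u} \<in> edges L" if "d \<in> V" "u \<in> d" for d u by (rule Vy[OF that])
      show "degree G x0 \<le> card {} + card V" using V(2) by simp
    qed simp_all
    then show False using free by blast
  qed
  show ?thesis by (rule monochromatic_edges_le[OF conf.L conf.R p conf.\<kappa> star avoid])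
qed

section \<open>Extremal graphs\<close>

text \<open>The function of the progressive induction is ex(n) - \<tau>(n) - b. A reduction
  increases it strictly from a value that \<open>small\<close> makes nonnegative, so at n' the
  excess is positive and by \<open>large\<close> the extremal graphs there are bad again. Leaving
  \<open>bad\<close> abstract serves both the upper bound, which concerns numbers, and the extremal
  structure, which concerns graphs.\<close>

lemma eventually_structured:
  fixes b :: nat
  assumes P: "\<And>n L. q \<le> n \<Longrightarrow> L \<in> extremal_graphs n {H} \<Longrightarrow> structured L \<Longrightarrow> \<not> bad n L"
    and large: "\<And>n L. q \<le> n \<Longrightarrow> L \<in> extremal_graphs n {H} \<Longrightarrow> \<tau> n + b < ex_num n {H} \<Longrightarrow> bad n L"
    and small: "\<And>n L. q \<le> n \<Longrightarrow> L \<in> extremal_graphs n {H} \<Longrightarrow> bad n L \<Longrightarrow> \<tau> n + b \<le> ex_num n {H}"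
  shows "\<exists>N. \<forall>n\<ge>N. \<forall>L\<in>extremal_graphs n {H}. \<not> bad n L"
proof -
  obtain n0 c where nc: "\<And>L :: nat graph. simple_graph L \<Longrightarrow> \<not> embeds H L \<Longrightarrow> n0 \<le> card (verts L) \<Longrightarrow>
      reducible c L \<or> structured L" using reducible_or_structured by metis
  define P' where "P' n \<longleftrightarrow> q \<le> n \<and> (\<exists>L\<in>extremal_graphs n {H}. bad n L)" for n
  have "\<exists>N. \<forall>n\<ge>N. \<not> P' n"
  proof (rule progressive_induction[where start = "n0 + q + c" and c = c and
        \<phi> = "\<lambda>n. int (ex_num n {H}) - int (\<tau> n + b)"])
    show "0 \<le> int (ex_num n {H}) - int (\<tau> n + b)" if "P' n" for n
      using small that unfolding P'_def by fastforce
    fix n assume n: "n0 + q + c \<le> n" and "P' n"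
    then obtain L where L: "L \<in> extremal_graphs n {H}" "bad n L" and qn: "q \<le> n" unfolding P'_def by blast
    have Lf: "simple_graph L" "card (verts L) = n" "\<not> embeds H L" "card (edges L) = ex_num n {H}"
      using L(1) by (auto simp: extremal_graphs_def free_graphs_def)
    have "\<not> structured L" using P[OF qn L(1)] L(2) by blast
    then have "reducible c L" using nc[OF Lf(1,3)] Lf(2) n by simp
    then obtain X where X: "X \<subseteq> verts L" "X \<noteq> {}" "card X \<le> c"
      "card (edges L) + \<tau> (n - card X) < edges_within L (verts L - X) + \<tau> n"
      unfolding reducible_def Lf(2) by blast
    have fX: "finite X" using X(1) simple_graphD(1)[OF Lf(1)] finite_subset by blast
    define n' where "n' = n - card X"
    let ?L = "induced_subgraph L (verts L - X)"
    have "card (verts ?L) = n'"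
      using X(1) fX Lf(2) by (simp add: n'_def induced_subgraph_def card_Diff_subset)
    moreover have "\<not> embeds H ?L"
      using embeds_trans[OF _ embeds_induced simple_graphD(2)[OF H]] Lf(3) by (metis Diff_subset)
    ultimately have ge: "edges_within L (verts L - X) \<le> ex_num n' {H}"
      using card_edges_le_ex_num[OF simple_induced[OF Lf(1) Diff_subset] _ simple_graphD(2)[OF H], of X]
      by (simp add: card_edges_induced)
    have qn': "q \<le> n'" using n X(3) unfolding n'_def by linarith
    have "card X \<noteq> 0" using X(2) fX by simp
    moreover have "card X \<le> n" using X(3) n by linarith
    ultimately have n': "n' < n" "n \<le> n' + c" using X(3) unfolding n'_def by linarith+
    have inc: "int (ex_num n {H}) - int (\<tau> n + b) + 1 \<le> int (ex_num n' {H}) - int (\<tau> n' + b)"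
      using X(4) ge Lf(4) unfolding n'_def[symmetric] by linarith
    moreover have "P' n'"
    proof -
      obtain L' where L': "L' \<in> extremal_graphs n' {H}" by (rule ex_num_attained[OF free_graph_exists])
      have "\<tau> n + b \<le> ex_num n {H}" by (rule small[OF qn L])
      then have "\<tau> n' + b < ex_num n' {H}" using inc by linarith
      then show ?thesis using large[OF qn' L'] qn' L' unfolding P'_def by blast
    qed
    ultimately show "\<exists>n'<n. n \<le> n' + c \<and> P' n' \<and>
        int (ex_num n {H}) - int (\<tau> n + b) + 1 \<le> int (ex_num n' {H}) - int (\<tau> n' + b)"
      using n' by blast
  qed
  then obtain N where "\<forall>n\<ge>N. \<not> P' n" by blast
  then show ?thesis unfolding P'_def by (intro exI[of _ "N + q"]) auto
qed

section \<open>The upper bound\<close>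

lemma upper_bound:
  "\<exists>N. \<forall>n\<ge>N. ex_num n {H} \<le> h_edges n p q + f_edges (k_family \<M> - 1) (k_family \<M> - 1)"
proof -
  let ?K = "k_family \<M> - 1"
  \<comment> \<open>The apices may span a complete graph, which separates \<open>h_edges\<close>
    from \<tau>; the second summand bounds the surplus of monochromatic edges over missing cross
    pairs.\<close>
  let ?b = "card (edges (complete_graph (q - 1))) + f_edges ?K ?K"
  have "\<exists>N. \<forall>n\<ge>N. \<forall>L\<in>extremal_graphs n {H}. \<not> \<tau> n + ?b < ex_num n {H}"
  proof (rule eventually_structured[where b = ?b and bad = "\<lambda>n L. \<tau> n + ?b < ex_num n {H}"])
    fix n and L :: "nat graph" assume n: "q \<le> n" and L: "L \<in> extremal_graphs n {H}" and "structured L"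
    then obtain E B \<kappa> N l where C: "configuration L p E B (verts L - E) \<kappa> N l" and cE: "card E = q - 1"
      and N: "size_bound + (2 * card (edges G) + 1) * l < N" unfolding structured_def by blast
    have Lf: "simple_graph L" "card (verts L) = n" "\<not> embeds H L" "card (edges L) = ex_num n {H}"
      using L by (auto simp: extremal_graphs_def free_graphs_def)
    let ?R = "verts L - E"
    have nL: "q \<le> card (verts L)" using n Lf(2) by simp
    have E: "E \<subseteq> verts L" using C by (simp add: configuration_def)
    have fE: "finite E" using E simple_graphD(1)[OF Lf(1)] finite_subset by blast
    have "edges_within L E \<le> card {e. e \<subseteq> E \<and> card e = 2}"
      unfolding edges_within_def using fE simple_graphD(3)[OF Lf(1)] by (intro card_mono) auto
    also have "\<dots> = card {e. e \<subseteq> {..<q - 1} \<and> card e = 2}"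
      using n_subsets[OF fE, of 2] n_subsets[of "{..<q - 1}" 2] cE by simp
    also have "\<dots> = card (edges (complete_graph (q - 1)))" by (simp add: complete_graph_def)
    finally have bE: "edges_within L E \<le> card (edges (complete_graph (q - 1)))" .
    obtain S0 where S0: "independent G S0" "cost S0 = q"
      "uncovered S0 \<noteq> {} \<or> (\<exists>x0\<in>S0. degree G x0 \<le> k_family \<M>)" by (rule optimal_independent_set)
    have mono: "card {e \<in> edges L. e \<subseteq> ?R \<and> (\<exists>i. \<kappa> ` e \<subseteq> {i})} \<le>
        card (cross_pairs \<kappa> ?R - edges L) + f_edges ?K ?K"
    proof (cases "uncovered S0 = {}")
      case True
      then obtain x0 where "x0 \<in> S0" "degree G x0 \<le> k_family \<M>" using S0(3) by blast
      then show ?thesis by (rule monochromatic_edges_bound[OF C cE N Lf(3) S0(1,2) True])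
    next
      case False
      have "size_bound + 2 * card (edges G) * l \<le> N" using N by simp
      then have "{e \<in> edges L. e \<subseteq> ?R \<and> (\<exists>i. \<kappa> ` e \<subseteq> {i})} = {}"
        by (rule no_monochromatic_edge[OF C cE _ Lf(3) S0(1,2) False])
      then show ?thesis by (simp only: card.empty zero_le)
    qed
    note se = structured_edges[OF C cE nL, unfolded Lf(2)]
    have "ex_num n {H} \<le> turan_number p (n - q + 1) + (q - 1) * (n - q + 1) + ?b"
      using se(2-5) mono bE Lf(4) by linarith
    then show "\<not> \<tau> n + ?b < ex_num n {H}" by (simp add: \<tau>_def)
  qed auto
  then obtain N where N: "\<forall>n\<ge>N. \<forall>L\<in>extremal_graphs n {H}. \<not> \<tau> n + ?b < ex_num n {H}" by blast
  have "ex_num n {H} \<le> h_edges n p q + f_edges ?K ?K" if n: "N + q \<le> n" for n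
  proof -
    obtain L where L: "L \<in> extremal_graphs n {H}" by (rule ex_num_attained[OF free_graph_exists])
    have "N \<le> n" using n by simp
    then have "\<not> \<tau> n + ?b < ex_num n {H}" using N L by blast
    then show ?thesis using h_edges_eq[of n] n by simp
  qed
  then show ?thesis by blast
qed

section \<open>The exact value and the extremal graphs\<close>

lemma iso_join_turan_extremal:
  assumes n: "q \<le> n" and ex: "ex_num n {H} = \<tau> n + ex_num (q - 1) \<B>"
    and Q: "Q \<in> extremal_graphs (q - 1) \<B>" and L: "simple_graph L"
    and iso: "graph_iso L (join Q (turan_graph p (n - q + 1)))"
  shows "L \<in> extremal_graphs n {H}"
proof -
  have Qf: "Q \<in> free_graphs (q - 1) \<B>" "card (edges Q) = ex_num (q - 1) \<B>"
    using Q by (simp_all add: extremal_graphs_def)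
  then have sQ: "simple_graph Q" "card (verts Q) = q - 1" by (simp_all add: free_graphs_def)
  note counts = join_turan_counts[OF sQ n]
  have "L \<in> free_graphs (card (verts (join Q (turan_graph p (n - q + 1))))) {H}"
    by (rule iso_free_graphs[OF simple_join[OF sQ(1) simple_turan] join_turan_free[OF Qf(1)]
          simple_graphD(2)[OF H] graph_iso_sym[OF L iso]])
  then show ?thesis
    using counts graph_iso_card(2)[OF L iso] ex Qf(2) by (simp add: extremal_graphs_def)
qed

text \<open>Without monochromatic edges the estimates of \<open>structured_edges\<close> add up to
  the lower bound, so each is an equality: the apices are joined to all other vertices, no cross
  pair is missing, and the number of cross pairs is the Turan number, which identifies the classes
  with those of the Turan graph.\<close>

lemma structured_extremal_iso:
  fixes L :: "nat graph"
  assumes n: "q \<le> n" and L: "L \<in> extremal_graphs n {H}" and str: "structured L"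
    and S0: "independent G S0" "cost S0 = q" "uncovered S0 \<noteq> {}"
  shows "ex_num n {H} = \<tau> n + ex_num (q - 1) \<B>"
    "\<exists>Q\<in>extremal_graphs (q - 1) \<B>. graph_iso L (join Q (turan_graph p (n - q + 1)))"
proof -
  obtain E B \<kappa> N l where C: "configuration L p E B (verts L - E) \<kappa> N l" and cE: "card E = q - 1"
    and N: "size_bound + (2 * card (edges G) + 1) * l < N" using str unfolding structured_def by blast
  have Lf: "simple_graph L" "card (verts L) = n" "\<not> embeds H L" "card (edges L) = ex_num n {H}"
    using L by (auto simp: extremal_graphs_def free_graphs_def)
  interpret conf: configuration L p E B "verts L - E" \<kappa> N l by (rule C)
  let ?R = "verts L - E" and ?m = "n - q + 1"
  have nL: "q \<le> card (verts L)" using n Lf(2) by simp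
  note se = structured_edges[OF C cE nL, unfolded Lf(2)]
  define Q where "Q = induced_subgraph L E"
  have "size_bound \<le> N" using N by simp
  then have Qf: "Q \<in> free_graphs (q - 1) \<B>"
    unfolding Q_def by (rule structured_core_free[OF C cE _ Lf(3)])
  have eQ: "card (edges Q) = edges_within L E" by (simp add: Q_def card_edges_induced)
  have bE: "edges_within L E \<le> ex_num (q - 1) \<B>" using ex_num_ge[OF Qf] eQ by simp
  have "size_bound + 2 * card (edges G) * l \<le> N" using N by simp
  then have noM: "{e \<in> edges L. e \<subseteq> ?R \<and> (\<exists>i. \<kappa> ` e \<subseteq> {i})} = {}"
    by (rule no_monochromatic_edge[OF C cE _ Lf(3) S0])
  then have cM: "card {e \<in> edges L. e \<subseteq> ?R \<and> (\<exists>i. \<kappa> ` e \<subseteq> {i})} = 0" by (simp only: card.empty)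
  have low: "turan_number p ?m + (q - 1) * ?m + ex_num (q - 1) \<B> \<le> ex_num n {H}"
    using ex_num_lower[OF n] by (simp add: \<tau>_def)
  have eqs: "edges_within L E = ex_num (q - 1) \<B>"
    "(\<Sum>x\<in>?R. card (neighbours L x \<inter> E)) = (q - 1) * ?m"
    "card (cross_pairs \<kappa> ?R) = turan_number p ?m" "card (cross_pairs \<kappa> ?R - edges L) = 0"
    using se(2-5) bE cM low Lf(4) by linarith+
  show "ex_num n {H} = \<tau> n + ex_num (q - 1) \<B>"
    using se(2-5) bE cM low Lf(4) unfolding \<tau>_def by linarith
  have fin: "finite E" "finite ?R" by (rule conf.finite_sets)+
  have Qe: "Q \<in> extremal_graphs (q - 1) \<B>" using Qf eQ eqs(1) by (simp add: extremal_graphs_def)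
  have full: "E \<subseteq> neighbours L x" if x: "x \<in> ?R" for x
  proof (rule ccontr)
    assume "\<not> E \<subseteq> neighbours L x"
    then have "neighbours L x \<inter> E \<subset> E" by blast
    then have "card (neighbours L x \<inter> E) < q - 1" using psubset_card_mono[OF fin(1)] cE by metis
    moreover have "card (neighbours L y \<inter> E) \<le> q - 1" for y
      unfolding cE[symmetric] using fin(1) by (intro card_mono) auto
    ultimately have "(\<Sum>x\<in>?R. card (neighbours L x \<inter> E)) < (\<Sum>x\<in>?R. q - 1)"
      using x fin(2) by (intro sum_strict_mono_ex1) auto
    then show False using eqs(2) se(1) by (simp add: mult.commute)
  qed
  have crossL: "cross_pairs \<kappa> ?R \<subseteq> edges L"
    using eqs(4) finite_cross_pairs[OF fin(2), of \<kappa>] by auto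
  obtain g where g: "bij_betw g ?R {..<card ?R}"
    "\<And>x y. x \<in> ?R \<Longrightarrow> y \<in> ?R \<Longrightarrow> g x mod p = g y mod p \<longleftrightarrow> \<kappa> x = \<kappa> y"
    using cross_pairs_maximum_turan[of p ?R \<kappa>] p fin(2) conf.\<kappa> eqs(3) se(1) by auto
  define J where "J = join Q (turan_graph p ?m)"
  define \<psi> where "\<psi> x = (if x \<in> E then Inl x else Inr (g x))" for x
  have gR: "g x < ?m" if "x \<in> ?R" for x using g(1) that se(1) by (auto simp: bij_betw_def)
  have "inj_on \<psi> (verts L)"
  proof (rule inj_onI)
    fix x y assume xy: "x \<in> verts L" "y \<in> verts L" "\<psi> x = \<psi> y"
    show "x = y"
    proof (cases "x \<in> E")
      case True then show ?thesis using xy(3) by (auto simp: \<psi>_def split: if_splits)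
    next
      case False
      then have "y \<notin> E" "g x = g y" using xy(3) by (auto simp: \<psi>_def split: if_splits)
      then show ?thesis using False xy g(1) by (auto simp: bij_betw_def inj_on_def)
    qed
  qed
  moreover have "\<psi> ` verts L = verts J"
  proof -
    have "verts L = E \<union> ?R" using conf.E by blast
    then have "\<psi> ` verts L = \<psi> ` E \<union> \<psi> ` ?R" by (metis image_Un)
    also have "\<psi> ` E = Inl ` E" by (intro image_cong) (auto simp: \<psi>_def)
    also have "\<psi> ` ?R = Inr ` g ` ?R" unfolding image_image by (intro image_cong) (auto simp: \<psi>_def)
    also have "g ` ?R = {..<?m}" using g(1) se(1) by (simp add: bij_betw_def)
    finally show ?thesis
      by (simp add: J_def verts_join verts_turan Plus_def Q_def induced_subgraph_def)
  qed
  ultimately have bij: "bij_betw \<psi> (verts L) (verts J)" by (simp add: bij_betw_def)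
  have sub: "(\<lambda>e. \<psi> ` e) ` edges L \<subseteq> edges J"
  proof
    fix d assume "d \<in> (\<lambda>e. \<psi> ` e) ` edges L"
    then obtain e where e: "e \<in> edges L" "d = \<psi> ` e" by blast
    obtain x y where xy: "e = {x, y}" "x \<in> verts L" "y \<in> verts L"
      using simple_graph_edgeE[OF Lf(1) e(1)] by metis
    have mixed: "{\<psi> x, \<psi> y} \<in> edges J" if "x \<in> E" "y \<in> ?R" for x y
    proof -
      have "{Inl x, Inr (g y)} \<in> edges J"
        unfolding J_def using that gR
        by (intro edges_joinI(3)) (simp_all add: Q_def induced_subgraph_def verts_turan)
      then show ?thesis using that by (simp add: \<psi>_def)
    qed
    consider "x \<in> E" "y \<in> E" | "x \<in> E" "y \<in> ?R" | "x \<in> ?R" "y \<in> E" | "x \<in> ?R" "y \<in> ?R"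
      using xy by blast
    then show "d \<in> edges J"
    proof cases
      case 1
      then have "e \<in> edges Q" using e(1) xy by (simp add: Q_def induced_subgraph_def)
      then have "Inl ` e \<in> edges J" unfolding J_def by (rule edges_joinI(1))
      moreover have "d = Inl ` e" using 1 xy e(2) by (simp add: \<psi>_def)
      ultimately show ?thesis by simp
    next
      case 2 then show ?thesis using mixed[of x y] xy e(2) by simp
    next
      case 3 then show ?thesis using mixed[of y x] xy e(2) by (simp add: insert_commute)
    next
      case 4
      have "\<kappa> x \<noteq> \<kappa> y"
      proof
        assume "\<kappa> x = \<kappa> y"
        then have "e \<subseteq> ?R \<and> (\<exists>i. \<kappa> ` e \<subseteq> {i})" using 4 xy(1) by auto
        then show False using noM e(1) by blast
      qed
      then have "g x mod p \<noteq> g y mod p" using g(2) 4 by blast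
      then have "{g x, g y} \<in> edges (turan_graph p ?m)"
        using gR 4 unfolding turan_graph_def graph.sel by blast
      then have "Inr ` {g x, g y} \<in> edges J" unfolding J_def by (rule edges_joinI(2))
      moreover have "d = Inr ` {g x, g y}" using 4 xy e(2) by (simp add: \<psi>_def)
      ultimately show ?thesis by simp
    qed
  qed
  have sQ: "simple_graph Q" "card (verts Q) = q - 1" using Qf by (simp_all add: free_graphs_def)
  have sJ: "simple_graph J" unfolding J_def by (rule simple_join[OF sQ(1) simple_turan])
  have inj_e: "inj_on (\<lambda>e. \<psi> ` e) (edges L)"
  proof (rule inj_onI)
    fix d e assume de: "d \<in> edges L" "e \<in> edges L" "\<psi> ` d = \<psi> ` e"
    have "d \<subseteq> verts L" "e \<subseteq> verts L" using simple_graphD(2)[OF Lf(1)] de by blast+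
    then show "d = e"
      using de(3) inj_on_image_eq_iff[of \<psi> "verts L" d e] bij by (simp add: bij_betw_def)
  qed
  \<comment> \<open>Edges are mapped injectively into the target and the numbers of edges agree,
    which replaces a proof of the reverse inclusion.\<close>
  have "card (edges J) = \<tau> n + card (edges Q)" unfolding J_def by (rule join_turan_counts(2)[OF sQ n])
  then have "card (edges J) = card (edges L)"
    using eQ eqs(1) Lf(4) \<open>ex_num n {H} = \<tau> n + ex_num (q - 1) \<B>\<close> by simp
  then have "card ((\<lambda>e. \<psi> ` e) ` edges L) = card (edges J)" using inj_e by (simp add: card_image)
  then have "(\<lambda>e. \<psi> ` e) ` edges L = edges J"
    using sub finite_edges[OF sJ] by (intro card_subset_eq)
  then have "graph_iso L J" using bij unfolding graph_iso_def by metis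
  then show "\<exists>Q\<in>extremal_graphs (q - 1) \<B>. graph_iso L (join Q (turan_graph p ?m))"
    using Qe unfolding J_def by blast
qed

text \<open>The surplus is now exactly that of the lower bound, so \<open>small\<close> holds for
  every extremal graph, and any failure of the value or of the structure can count as bad.\<close>

lemma exact_value:
  assumes S0: "independent G S0" "cost S0 = q" "uncovered S0 \<noteq> {}"
  shows "\<exists>N. \<forall>n\<ge>N. ex_num n {H} = h'_edges n p q + ex_num (q - 1) \<B> \<and>
    (\<forall>L :: nat graph. simple_graph L \<longrightarrow> (L \<in> extremal_graphs n {H} \<longleftrightarrow>
      (\<exists>Q\<in>extremal_graphs (q - 1) \<B>. graph_iso L (join Q (turan_graph p (n - q + 1))))))"
proof -
  let ?b = "ex_num (q - 1) \<B>"
  let ?bad = "\<lambda>n L. ex_num n {H} \<noteq> \<tau> n + ?b \<or>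
    \<not> (\<exists>Q\<in>extremal_graphs (q - 1) \<B>. graph_iso L (join Q (turan_graph p (n - q + 1))))"
  have "\<exists>N. \<forall>n\<ge>N. \<forall>L\<in>extremal_graphs n {H}. \<not> ?bad n L"
  proof (rule eventually_structured[where b = ?b and bad = ?bad])
    fix n and L :: "nat graph" assume "q \<le> n" "L \<in> extremal_graphs n {H}" "structured L"
    then show "\<not> ?bad n L" using structured_extremal_iso[OF _ _ _ S0] by blast
  next
    fix n and L :: "nat graph" assume "\<tau> n + ?b < ex_num n {H}"
    then show "?bad n L" by simp
  next
    fix n and L :: "nat graph" assume "q \<le> n"
    then show "\<tau> n + ?b \<le> ex_num n {H}" by (rule ex_num_lower)
  qed
  then obtain N where N: "\<And>n L. N \<le> n \<Longrightarrow> L \<in> extremal_graphs n {H} \<Longrightarrow> \<not> ?bad n L" by blast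
  have "ex_num n {H} = h'_edges n p q + ?b \<and>
    (\<forall>L :: nat graph. simple_graph L \<longrightarrow> (L \<in> extremal_graphs n {H} \<longleftrightarrow>
      (\<exists>Q\<in>extremal_graphs (q - 1) \<B>. graph_iso L (join Q (turan_graph p (n - q + 1))))))"
    if n: "N + q \<le> n" for n
  proof -
    obtain L where "L \<in> extremal_graphs n {H}" by (rule ex_num_attained[OF free_graph_exists])
    then have ex: "ex_num n {H} = \<tau> n + ?b" using N[of n L] n by auto
    have qn: "q \<le> n" using n by simp
    show ?thesis
    proof (intro conjI allI impI iffI)
      show "ex_num n {H} = h'_edges n p q + ?b" using ex h'_edges_eq[OF qn] by simp
      fix L :: "nat graph" assume L: "simple_graph L"
      show "\<exists>Q\<in>extremal_graphs (q - 1) \<B>. graph_iso L (join Q (turan_graph p (n - q + 1)))"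
        if "L \<in> extremal_graphs n {H}" using N[OF _ that] n by auto
      show "L \<in> extremal_graphs n {H}"
        if "\<exists>Q\<in>extremal_graphs (q - 1) \<B>. graph_iso L (join Q (turan_graph p (n - q + 1)))"
        using iso_join_turan_extremal[OF qn ex _ L] that by blast
    qed
  qed
  then show ?thesis by blast
qed

text \<open>If nothing were uncovered, the optimal set would be a colour class of \<open>G\<close>,
  and its size \<open>q\<close> would be at least \<open>card A\<close>.\<close>

lemma small_q_uncovered:
  assumes A: "smaller_color_class G A" and qA: "q < card A"
  obtains S0 where "independent G S0" "cost S0 = q" "uncovered S0 \<noteq> {}"
proof -
  obtain S0 where S0: "independent G S0" "cost S0 = q" by (rule optimal_independent_set)
  have "uncovered S0 \<noteq> {}"
  proof
    assume un: "uncovered S0 = {}"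
    then have "independent_covering G S0"
      using S0(1) by (auto simp: independent_covering_def covering_def uncovered_def independent_def)
    then have "bipartition G S0 (verts G - S0)" by (rule independent_covering_bipartition[OF G])
    then have "card A \<le> card S0" using A by (auto simp: smaller_color_class_def)
    then show False using qA S0(2) by (simp add: cost_def)
  qed
  then show thesis using that S0 by blast
qed

end

section \<open>Assembly of the bounds and the sharpness example\<close>

lemma bounds_for_bipartite:
  fixes G :: "'a graph"
  assumes p: "p \<ge> 3" and G: "simple_graph G" "bipartite G" "edges G \<noteq> {}"
    and A: "smaller_color_class G A"
  defines "\<M> \<equiv> decomposition_family p (edge_blowup G (p + 1))"
  shows "\<exists>N. \<forall>n\<ge>N.
      (q_family \<M> = card A \<longrightarrow>
        h'_edges n p (q_family \<M>) + ex_num (q_family \<M> - 1) (B_family \<M>) \<le> ex_num n {edge_blowup G (p + 1)} \<and>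
        ex_num n {edge_blowup G (p + 1)} \<le>
          h_edges n p (q_family \<M>) + f_edges (k_family \<M> - 1) (k_family \<M> - 1)) \<and>
      (q_family \<M> < card A \<longrightarrow>
        ex_num n {edge_blowup G (p + 1)} = h'_edges n p (q_family \<M>) + ex_num (q_family \<M> - 1) (B_family \<M>) \<and>
        (\<forall>L :: nat graph. simple_graph L \<longrightarrow>
          (L \<in> extremal_graphs n {edge_blowup G (p + 1)} \<longleftrightarrow>
          (\<exists>Q\<in>extremal_graphs (q_family \<M> - 1) (B_family \<M>).
            graph_iso L (join Q (turan_graph p (n - q_family \<M> + 1)))))))"
proof -
  obtain P P' where "bipartition G P P'" using G(2) by (auto simp: bipartite_def)
  then interpret S: edge_blowup_setting G P P' p by (unfold_locales) (use G p in auto)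
  obtain N1 where N1: "\<forall>n\<ge>N1. ex_num n {S.H} \<le> h_edges n p S.q + f_edges (k_family S.\<M> - 1) (k_family S.\<M> - 1)"
    using S.upper_bound by blast
  have "\<exists>N2. \<forall>n\<ge>N2. S.q < card A \<longrightarrow>
      ex_num n {S.H} = h'_edges n p S.q + ex_num (S.q - 1) S.\<B> \<and>
      (\<forall>L :: nat graph. simple_graph L \<longrightarrow> (L \<in> extremal_graphs n {S.H} \<longleftrightarrow>
        (\<exists>Q\<in>extremal_graphs (S.q - 1) S.\<B>. graph_iso L (join Q (turan_graph p (n - S.q + 1))))))"
  proof (cases "S.q < card A")
    case True
    obtain S0 where "independent G S0" "S.cost S0 = S.q" "S.uncovered S0 \<noteq> {}"
      by (rule S.small_q_uncovered[OF A True])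
    from S.exact_value[OF this] show ?thesis by blast
  qed auto
  then obtain N2 where N2: "\<forall>n\<ge>N2. S.q < card A \<longrightarrow>
      ex_num n {S.H} = h'_edges n p S.q + ex_num (S.q - 1) S.\<B> \<and>
      (\<forall>L :: nat graph. simple_graph L \<longrightarrow> (L \<in> extremal_graphs n {S.H} \<longleftrightarrow>
        (\<exists>Q\<in>extremal_graphs (S.q - 1) S.\<B>. graph_iso L (join Q (turan_graph p (n - S.q + 1))))))" by blast
  have low: "h'_edges n p S.q + ex_num (S.q - 1) S.\<B> \<le> ex_num n {S.H}" if "S.q \<le> n" for n
    using S.ex_num_lower[OF that] S.h'_edges_eq[OF that] by simp
  show ?thesis unfolding \<M>_def
  proof (intro exI[of _ "N1 + N2 + S.q"] allI impI conjI)
    fix n assume "N1 + N2 + S.q \<le> n"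
    then have n: "N1 \<le> n" "N2 \<le> n" "S.q \<le> n" by simp_all
    show "h'_edges n p S.q + ex_num (S.q - 1) S.\<B> \<le> ex_num n {S.H}" by (rule low[OF n(3)])
    show "ex_num n {S.H} \<le> h_edges n p S.q + f_edges (k_family S.\<M> - 1) (k_family S.\<M> - 1)"
      using N1 n(1) by blast
    assume "S.q < card A"
    with N2 n(2) have *: "ex_num n {S.H} = h'_edges n p S.q + ex_num (S.q - 1) S.\<B> \<and>
      (\<forall>L :: nat graph. simple_graph L \<longrightarrow> (L \<in> extremal_graphs n {S.H} \<longleftrightarrow>
        (\<exists>Q\<in>extremal_graphs (S.q - 1) S.\<B>. graph_iso L (join Q (turan_graph p (n - S.q + 1))))))"
      by blast
    then show "ex_num n {S.H} = h'_edges n p S.q + ex_num (S.q - 1) S.\<B>" by blast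
    fix L :: "nat graph" assume "simple_graph L"
    with * show "L \<in> extremal_graphs n {S.H} \<longleftrightarrow>
      (\<exists>Q\<in>extremal_graphs (S.q - 1) S.\<B>. graph_iso L (join Q (turan_graph p (n - S.q + 1))))" by blast
  qed
qed

text \<open>For \<open>G = K\<^sub>2\<close> both bounds equal the Turan number, which shows that they are best possible.\<close>

lemma single_edge_bounds:
  fixes p :: nat
  assumes p: "p \<ge> 3"
  defines "G \<equiv> Graph {0, 1} {{0, 1}} :: nat graph"
  defines "\<M> \<equiv> decomposition_family p (edge_blowup G (p + 1))"
  shows "simple_graph G" "bipartite G" "smaller_color_class G {0}" "q_family \<M> = 1"
    "\<And>n. 1 \<le> n \<Longrightarrow> h_edges n p (q_family \<M>) + f_edges (k_family \<M> - 1) (k_family \<M> - 1) =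
      h'_edges n p (q_family \<M>)"
proof -
  have sel: "verts G = {0, 1}" "edges G = {{0, 1}}" by (simp_all add: G_def)
  show G: "simple_graph G" by (simp add: simple_graph_def sel)
  have bip: "bipartition G {0} {1}" by (auto simp: bipartition_def independent_def sel)
  then show "bipartite G" by (auto simp: bipartite_def)
  have "card {0} \<le> card A'" if A': "bipartition G A' B'" for A' B'
  proof -
    have "A' \<union> B' = {0, 1}" "\<not> {0, 1} \<subseteq> B'"
      using A' by (auto simp: bipartition_def independent_def sel)
    then have "A' \<noteq> {}" "finite A'" using finite_subset[of A' "{0, 1}"] by auto
    then show ?thesis by (simp add: Suc_leI card_gt_0_iff)
  qed
  then show "smaller_color_class G {0}" using bip unfolding smaller_color_class_def by blast
  interpret S: edge_blowup_setting G "{0}" "{1}" p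
    by unfold_locales (use G bip p in \<open>auto simp: sel\<close>)
  \<comment> \<open>The empty set leaves the single edge uncovered, at a cost of one.\<close>
  have "S.cost {} = 1" by (simp add: S.cost_def S.uncovered_def sel)
  then have "S.q \<le> 1" using S.q_le_cost[OF S.independent_empty] by metis
  then have q1: "S.q = 1" using S.q_pos by (rule le_antisym)
  show "q_family \<M> = 1" unfolding \<M>_def by (rule q1)
  let ?L = "join (disjoint_union G (edgeless_graph 1)) (turan_graph (p - 1) ((p - 1) * 1))"
  \<comment> \<open>The clique consisting of the edge of \<open>G\<close> and one vertex from each
    of the p - 1 parts, which have size one here.\<close>
  define C where "C = (Inl ` Inl ` {0, 1} \<union> Inr ` {..<p - 1} :: ((nat + nat) + nat) set)"
  have "embeds S.H ?L"
  proof (rule blowup_embeds[OF G, where \<theta> = "\<lambda>v. Inl (Inl v)" and Q = "\<lambda>_. C"])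
    show "2 \<le> p + 1" using p by simp
    show "inj_on (\<lambda>v. Inl (Inl v)) (verts G)" by (simp add: inj_on_def)
    show "(\<lambda>v. Inl (Inl v)) ` verts G \<subseteq> verts ?L" by (auto simp: verts_join disjoint_union_def)
    fix e assume "e \<in> edges G"
    then have e: "e = {0, 1}" by (simp add: sel)
    have "card C = card (Inl ` Inl ` {0, 1 :: nat} :: ((nat + nat) + nat) set) + card (Inr ` {..<p - 1} :: ((nat + nat) + nat) set)"
      unfolding C_def by (rule card_Un_disjoint) auto
    also have "\<dots> = p + 1" using p by (simp add: card_image)
    finally have "card C = p + 1" .
    moreover have "C \<subseteq> verts ?L"
      by (auto simp: C_def verts_join disjoint_union_def sel verts_turan)
    moreover have "(\<lambda>v. Inl (Inl v)) ` e \<subseteq> C" by (auto simp: C_def e)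
    ultimately show "(\<lambda>v. Inl (Inl v)) ` e \<subseteq> C \<and> card C = p + 1 \<and> C \<subseteq> verts ?L" by blast
    show "C \<inter> (\<lambda>v. Inl (Inl v)) ` verts G \<subseteq> (\<lambda>v. Inl (Inl v)) ` e" by (simp add: e sel)
    show "C \<inter> C \<subseteq> (\<lambda>v. Inl (Inl v)) ` verts G" if "e' \<in> edges G" "e \<noteq> e'" for e'
      using that by (simp add: e sel)
    show "{x, y} \<in> edges ?L" if xy: "x \<in> C" "y \<in> C" "x \<noteq> y" for x y
    proof -
      have mixed: "{x, y} \<in> edges ?L" if xy: "x \<in> Inl ` Inl ` {0, 1}" "y \<in> Inr ` {..<p - 1}" for x y
      proof -
        obtain a b where ab: "x = Inl (Inl a)" "a \<in> {0, 1}" "y = Inr b" "b < p - 1" using xy by blast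
        show ?thesis unfolding ab(1,3)
          using ab by (intro join_disjoint_union_edgesI(3)) (auto simp: sel verts_turan)
      qed
      consider "x \<in> Inl ` Inl ` {0, 1}" "y \<in> Inl ` Inl ` {0, 1}" | "x \<in> Inl ` Inl ` {0, 1}" "y \<in> Inr ` {..<p - 1}"
        | "y \<in> Inl ` Inl ` {0, 1}" "x \<in> Inr ` {..<p - 1}" | "x \<in> Inr ` {..<p - 1}" "y \<in> Inr ` {..<p - 1}"
        using xy(1,2) unfolding C_def by blast
      then show ?thesis
      proof cases
        case 1
        then have "{x, y} = Inl ` Inl ` {0, 1}" using xy(3) by auto
        moreover have "{0, 1} \<in> edges G" by (simp add: sel)
        ultimately show ?thesis using join_disjoint_union_edgesI(1) by metis
      next
        case 2 then show ?thesis by (rule mixed)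
      next
        case 3 then show ?thesis using mixed[of y x] by (simp add: insert_commute)
      next
        case 4
        then obtain a b where ab: "x = Inr a" "y = Inr b" "a < p - 1" "b < p - 1" by blast
        then have "a mod (p - 1) \<noteq> b mod (p - 1)" using xy(3) by simp
        then have "{a, b} \<in> edges (turan_graph (p - 1) ((p - 1) * 1))"
          using ab(3,4) unfolding turan_graph_def graph.sel mult_1_right by blast
        then have "Inr ` {a, b} \<in> edges ?L" by (rule join_disjoint_union_edgesI(2))
        then show ?thesis using ab by simp
      qed
    qed
  qed
  then have "decomposes p S.H G" unfolding decomposes_def by blast
  then obtain F where F: "F \<in> S.\<M>" "embeds F G" by (rule decomposition_family_below[OF S.H G])
  obtain f where f: "inj_on f (verts F)" "\<forall>e\<in>edges F. f ` e \<in> edges G"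
    using F(2) by (auto simp: embeds_def)
  have sF: "simple_graph F" by (rule S.\<M>_simple[OF F(1)])
  have "edges F \<noteq> {}"
  proof
    assume "edges F = {}"
    then have "independent_covering F {}"
      by (simp add: independent_covering_def independent_def covering_def)
    then have "S.q \<le> card ({} :: nat set)" by (rule q_family_le[OF F(1)])
    then show False using q1 by simp
  qed
  then obtain d where d: "d \<in> edges F" by blast
  have "e = d" if e: "e \<in> edges F" for e
  proof -
    have "f ` e = f ` d" using f(2) e d by (simp add: sel)
    then show ?thesis
      using inj_on_image_eq_iff[OF f(1)] simple_graphD(2)[OF sF] e d by blast
  qed
  then have Fd: "edges F = {d}" using d by blast
  obtain a b where ab: "d = {a, b}" "a \<noteq> b" "a \<in> verts F" using simple_graph_edgeE[OF sF d] by metis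
  have "independent_covering F {a}"
    using ab Fd by (auto simp: independent_covering_def independent_def covering_def)
  moreover from this have "bipartite F"
    using independent_covering_bipartition[OF sF] unfolding bipartite_def by blast
  ultimately have "(F, {a}) \<in> S_family S.\<M>" using F(1) q1 by (simp add: S_family_def)
  moreover have "degree F a = 1"
  proof -
    have "{e \<in> edges F. a \<in> e} = {d}" using Fd ab by auto
    then show ?thesis by (simp add: degree_def)
  qed
  ultimately have "\<exists>(F, S)\<in>S_family S.\<M>. \<exists>x\<in>S. degree F x = 1" by blast
  \<comment> \<open>Because subtraction is truncated, this already makes both arguments of
    \<open>f_edges\<close> zero.\<close>
  then have "k_family S.\<M> \<le> 1" unfolding k_family_def by (rule Least_le)
  then have k: "k_family S.\<M> - 1 = 0" by simp
  obtain L0 where "L0 \<in> bounded_graphs 0 0" "card (edges L0) = f_edges 0 0" by (rule f_edges_attained)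
  then have f0: "f_edges 0 0 = 0" using card_edges_bounded[of L0 0 0] by simp
  have "edges (complete_graph 0) = {}" by (auto simp: complete_graph_def)
  then show "h_edges n p (q_family \<M>) + f_edges (k_family \<M> - 1) (k_family \<M> - 1) =
      h'_edges n p (q_family \<M>)" if "1 \<le> n" for n
    using S.h_edges_eq[of n] S.h'_edges_eq[of n] that q1 k f0 by (simp add: \<M>_def)
qed

theorem theorem2p3:
  fixes p :: nat
  assumes "p \<ge> 3"
  shows
    "(\<forall>(G :: 'a graph) A.
        simple_graph G \<and> bipartite G \<and> edges G \<noteq> {} \<and> smaller_color_class G A \<longrightarrow>
        (let \<M> = decomposition_family p (edge_blowup G (p + 1));
             q = q_family \<M>; \<B> = B_family \<M>; k = k_family \<M>
         in \<exists>N. \<forall>n\<ge>N.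
              (q = card A \<longrightarrow>
                 h'_edges n p q + ex_num (q - 1) \<B> \<le> ex_num n {edge_blowup G (p + 1)} \<and>
                 ex_num n {edge_blowup G (p + 1)} \<le> h_edges n p q + f_edges (k - 1) (k - 1)) \<and>
              (q < card A \<longrightarrow>
                 ex_num n {edge_blowup G (p + 1)} = h'_edges n p q + ex_num (q - 1) \<B> \<and>
                 (\<forall>L :: nat graph. simple_graph L \<longrightarrow>
                     (L \<in> extremal_graphs n {edge_blowup G (p + 1)} \<longleftrightarrow>
                      (\<exists>Q\<in>extremal_graphs (q - 1) \<B>. graph_iso L (join Q (turan_graph p (n - q + 1)))))))))
     \<and> (\<exists>(G :: nat graph) A.
        simple_graph G \<and> bipartite G \<and> edges G \<noteq> {} \<and> smaller_color_class G A \<and>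
        (let \<M> = decomposition_family p (edge_blowup G (p + 1));
             q = q_family \<M>; \<B> = B_family \<M>
         in q = card A \<and>
            (\<exists>N. \<forall>n\<ge>N. ex_num n {edge_blowup G (p + 1)} = h'_edges n p q + ex_num (q - 1) \<B>)))
     \<and> (\<exists>(G :: nat graph) A.
        simple_graph G \<and> bipartite G \<and> edges G \<noteq> {} \<and> smaller_color_class G A \<and>
        (let \<M> = decomposition_family p (edge_blowup G (p + 1));
             q = q_family \<M>; k = k_family \<M>
         in q = card A \<and>
            (\<exists>N. \<forall>n\<ge>N. ex_num n {edge_blowup G (p + 1)} = h_edges n p q + f_edges (k - 1) (k - 1))))"
proof -
  let ?G = "Graph {0, 1} {{0, 1}} :: nat graph"
  let ?M = "decomposition_family p (edge_blowup ?G (p + 1))"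
  note S = single_edge_bounds[OF assms]
  have ne: "edges ?G \<noteq> {}" by simp
  have q: "q_family ?M = card {0 :: nat}" using S(4) by simp
  obtain N where N: "\<And>n. N \<le> n \<Longrightarrow>
      h'_edges n p (q_family ?M) + ex_num (q_family ?M - 1) (B_family ?M) \<le> ex_num n {edge_blowup ?G (p + 1)} \<and>
      ex_num n {edge_blowup ?G (p + 1)} \<le>
        h_edges n p (q_family ?M) + f_edges (k_family ?M - 1) (k_family ?M - 1)"
    using bounds_for_bipartite[OF assms S(1,2) ne S(3)] q by metis
  \<comment> \<open>The upper bound equals \<open>h'_edges\<close>, so the additional summand of the
    lower bound is forced to vanish and both inequalities become equalities.\<close>
  have eq1: "ex_num n {edge_blowup ?G (p + 1)} = h'_edges n p (q_family ?M) + ex_num (q_family ?M - 1) (B_family ?M)"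
    and eq2: "ex_num n {edge_blowup ?G (p + 1)} = h_edges n p (q_family ?M) + f_edges (k_family ?M - 1) (k_family ?M - 1)"
    if "N + 1 \<le> n" for n
    using N[of n] S(5)[of n] that by linarith+
  show ?thesis
    unfolding Let_def
    by (intro conjI) (intro allI impI, elim conjE, rule bounds_for_bipartite[OF assms]; assumption
    | intro exI[of _ ?G] exI[of _ "{0}"] conjI S(1-3) ne q exI[of _ "N + 1"] allI impI eq1; assumption
    | intro exI[of _ ?G] exI[of _ "{0}"] conjI S(1-3) ne q exI[of _ "N + 1"] allI impI eq2; assumption)+
qed

end
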